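(* Let $X$ be a quasi-normed lattice of function sequences satisfying Assumption II for some Carleson-type measure $\nu$. Let $s\in(0,\infty)$ and $r\in\mathbb N$ with $r>s$, and assume the regularity $L$ of the Daubechies wavelet system satisfies $L>s$ and $L\ge r-1$. Then, for any $f\in\Lambda_s$, $$\mathrm{dist}\left(f,\Lambda_X^s\right)_{\Lambda_s}\sim\varepsilon_{X,\nu}f+\inf\left\{\varepsilon\in(0,\infty):\nu\Big(\bigcup_{I\in V_0(s,f,\varepsilon)}T(I)\Big)<\infty\right\}$$ with positive equivalence constants independent of $f$.
   Context: Notation. For $h\in\mathbb R^n$, $\Delta_hf(x):=f(x+h/2)-f(x-h/2)$, $\Delta_h^{k+1}:=\Delta_h^k\Delta_h$; $\Delta_kf(x,y):=\sup_{|h|=y}|\Delta_h^kf(x)|$. $\Lambda_s$ ($s>0$): bounded continuous $f$ on $\mathbb R^n$ with $\|f\|_{\Lambda_s}:=\|f\|_{L^\infty}+\sup_{x\in\mathbb R^n,y\in(0,1]}\Delta_{\lfloor s\rfloor+1}f(x,y)/y^s<\infty$. $\mathrm{dist}(f,V)_{\Lambda_s}:=\inf_{g\in V\cap\Lambda_s}\|f-g\|_{\Lambda_s}$. $S_{r,j}(s,f,\varepsilon):=\{(x,y)\in\mathbb R^n\times(0,\infty):\Delta_rf(x,y)/y^s>\varepsilon,\ y\in(2^{-j-1},2^{-j}]\}$. Dyadic cubes $\mathcal D_j=\{2^{-j}(k+[0,1)^n):k\in\mathbb Z^n\}$, $\mathcal D=\bigcup_{j\ge0}\mathcal D_j$;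 $\ell(I)$ is the side length; $T(I):=I\times(\ell(I)/2,\ell(I)]$. Daubechies wavelet system of regularity $L$: $\varphi,\psi_\ell\in C^L_c$, $\ell=1,\dots,2^n-1$, $\psi_\ell$ with vanishing moments of all orders $\le L$, such that $\{\varphi(\cdot-k)\}\cup\{2^{jn/2}\psi_\ell(2^j\cdot-k)\}$ ($j\in\mathbb Z_+$, $k\in\mathbb Z^n$) is an orthonormal basis of $L^2$. Indexed by $\Omega=\{0\}\times\mathcal D_0\cup\{1,\dots,2^n-1\}\times\mathcal D$: $\psi_{(0,k+[0,1)^n)}=\varphi(\cdot-k)$, $\psi_{(\ell,2^{-j}(k+[0,1)^n))}=2^{jn/2}\psi_\ell(2^j\cdot-k)$, $I_{(\ell,I)}=I$. $V_0(s,f,\varepsilon):=\{I\in\mathcal D_0:|\int f\psi_{(0,I)}|>\varepsilon\}$. Quasi-normed lattice of function sequences: a quasi-norm $\|\cdot\|_X$ on sequences $\mathbf F=\{f_j\}_{j\in\mathbb Z_+}$ of a.e. finite measurable functions, with values in $[0,\infty]$, monotone ($|f_j|\le|g_j|$ a.e. $\forall j\Rightarrow\|\mathbf F\|_X\le\|\mathbf G\|_X$), bounded under the shifts $\{f_{j+1}\}_j$ and $\{f_{j-1}\}_j$ ($f_{-1}=0$) by $C\|\mathbf F\|_X$, and with $\{f,0,0,\dots\}$ of finite quasi-norm for every bounded compactly supported $f$. $\Lambda^s_X$: all $f\in\Lambda_s$ with $\|\{\sum_{\omega:I_\omega\in\mathcal D_j}|I_\omega|^{-s/n-1/2}|\langle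 f,\psi_\omega\rangle|\mathbf 1_{I_\omega}\}_{j}\|_X<\infty$. Hyperbolic metric on $\mathbb R^{n+1}_+$: $\rho(\mathbf x,\mathbf y):=\operatorname{arccosh}\big(1+\frac{|\mathbf x-\mathbf y|^2}{2x_{n+1}y_{n+1}}\big)$; $B_\rho(\mathbf z,t):=\{\mathbf y:\rho(\mathbf z,\mathbf y)<t\}$; for $A\subset\mathbb R^{n+1}_+$, $A_R:=\{\mathbf x:\inf_{\mathbf y\in A}\rho(\mathbf x,\mathbf y)<R\}$. $|\cdot|$ is Lebesgue measure. Carleson-type measure: a map $\nu$ from sequences $\{A_j\}_{j\in\mathbb Z_+}$ of measurable subsets of $\mathbb R^{n+1}_+$ to $[0,\infty]$ such that (i) $A_j\subset B_j\ \forall j$ implies $\nu(\{A_j\})\le\nu(\{B_j\})$; (ii) $\nu(\{A_j\cup B_j\})\le C[\nu(\{A_j\})+\nu(\{B_j\})]$; (iii) if there are $\delta,\delta'\in(0,1/10)$ independent of $j$ with $|B_\rho(\mathbf z,\delta)\cap A_j|\ge\delta'|B_\rho(\mathbf z,\delta)|$ for all $j$ and $\mathbf z\in A_j$, then for every $R>0$, $\nu(\{(A_j)_R\}_j)$ and $\nu(\{A_j\}_j)$ are finite or infinite simultaneously; (iv) $\nu(\{A_{j+1}\}_j)\le C\nu(\{A_j\}_j)$ and $\nu(\{A_{j-1}\}_j)\le C\nu(\{A_j\}_j)$ with $A_{-1}=\emptyset$. For a single set $A$, $\nu(A):=\nu(\{A,\emptyset,\emptyset,\dots\})$. Assumption II: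 there is a Carleson-type measure $\nu$ such that for every $\mathcal A\subset\mathcal D$, $\|\{\sum_{I\in\mathcal A\cap\mathcal D_j}\mathbf 1_I\}_j\|_X$ and $\nu(\{\bigcup_{I\in\mathcal A\cap\mathcal D_j}T(I)\}_j)$ are finite or infinite simultaneously. $\varepsilon_{X,\nu}f:=\inf\{\varepsilon\in(0,\infty):\nu(\{S_{r,j}(s,f,\varepsilon)\}_{j\in\mathbb Z_+})<\infty\}$. *)

theory Defs
  imports "HOL-Analysis.Analysis"
begin

definition diffop :: "real^'n \<Rightarrow> (real^'n \<Rightarrow> real) \<Rightarrow> (real^'n \<Rightarrow> real)" where
  "diffop h f = (\<lambda>x. f (x + (1/2) *\<^sub>R h) - f (x - (1/2) *\<^sub>R h))"

definition diffpow :: "nat \<Rightarrow> real^'n \<Rightarrow> (real^'n \<Rightarrow> real) \<Rightarrow> (real^'n \<Rightarrow> real)" where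
  "diffpow k h f = (diffop h ^^ k) f"

definition Delta :: "nat \<Rightarrow> (real^'n \<Rightarrow> real) \<Rightarrow> real^'n \<Rightarrow> real \<Rightarrow> ereal" where
  "Delta k f x y = (SUP h\<in>{h. norm h = y}. ereal \<bar>diffpow k h f x\<bar>)"

definition Lambda_norm :: "real \<Rightarrow> (real^'n \<Rightarrow> real) \<Rightarrow> ereal" where
  "Lambda_norm s f = (SUP x. ereal \<bar>f x\<bar>)
     + (SUP p\<in>(UNIV :: (real^'n) set) \<times> {0<..1}. Delta (nat \<lfloor>s\<rfloor> + 1) f (fst p) (snd p) / ereal (snd p powr s))"

definition Lambda :: "real \<Rightarrow> (real^'n \<Rightarrow> real) set" where
  "Lambda s = {f. continuous_on UNIV f \<and> bounded (range f) \<and> Lambda_norm s f < \<infinity>}"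

definition Lambda_dist :: "real \<Rightarrow> (real^'n \<Rightarrow> real) \<Rightarrow> (real^'n \<Rightarrow> real) set \<Rightarrow> ereal" where
  "Lambda_dist s f V = (INF g\<in>V \<inter> Lambda s. Lambda_norm s (\<lambda>x. f x - g x))"

definition Sset :: "nat \<Rightarrow> nat \<Rightarrow> real \<Rightarrow> (real^'n \<Rightarrow> real) \<Rightarrow> real \<Rightarrow> ((real^'n) \<times> real) set" where
  "Sset r j s f \<epsilon> = {(x, y). y \<in> {(1/2) ^ (j + 1) <.. (1/2) ^ j} \<and> Delta r f x y / ereal (y powr s) > ereal \<epsilon>}"

text \<open>The dyadic cube 2^{-j}(k + [0,1)^n) is indexed by the pair (j, k); D_j = {j} x Z^n.\<close>
definition cube :: "nat \<times> (int^'n) \<Rightarrow> (real^'n) set" where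
  "cube I = {x. \<forall>i. real_of_int (snd I $ i) / 2 ^ fst I \<le> x $ i \<and> x $ i < (real_of_int (snd I $ i) + 1) / 2 ^ fst I}"

definition side :: "nat \<times> (int^'n) \<Rightarrow> real" where
  "side I = (1/2) ^ fst I"

definition Tbox :: "nat \<times> (int^'n) \<Rightarrow> ((real^'n) \<times> real) set" where
  "Tbox I = cube I \<times> {side I / 2 <.. side I}"

fun Ck :: "nat \<Rightarrow> (real^'n \<Rightarrow> real) \<Rightarrow> bool" where
  "Ck 0 f = continuous_on UNIV f"
| "Ck (Suc k) f = (f differentiable_on UNIV \<and>
      (\<forall>b\<in>(Basis :: (real^'n) set). Ck k (\<lambda>x. frechet_derivative f (at x) b)))"

definition Cc :: "nat \<Rightarrow> (real^'n \<Rightarrow> real) \<Rightarrow> bool" where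
  "Cc L f = (Ck L f \<and> bounded {x. f x \<noteq> 0})"

definition L2 :: "(real^'n \<Rightarrow> real) set" where
  "L2 = {g. g \<in> borel_measurable lborel \<and> integrable lborel (\<lambda>x. (g x)^2)}"

definition L2inner :: "(real^'n \<Rightarrow> real) \<Rightarrow> (real^'n \<Rightarrow> real) \<Rightarrow> real" where
  "L2inner f g = (\<integral>x. f x * g x \<partial>lborel)"

definition Omega :: "(nat \<times> (nat \<times> (int^'n))) set" where
  "Omega = {(l, I). l < 2 ^ CARD('n) \<and> (l = 0 \<longrightarrow> fst I = 0)}"

definition wav :: "(real^'n \<Rightarrow> real) \<Rightarrow> (nat \<Rightarrow> real^'n \<Rightarrow> real)
    \<Rightarrow> nat \<times> (nat \<times> (int^'n)) \<Rightarrow> real^'n \<Rightarrow> real" where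
  "wav \<phi> \<psi> \<omega> = (case \<omega> of (l, (j, k)) \<Rightarrow>
     (if l = 0 then (\<lambda>x. \<phi> (x - (\<chi> i. real_of_int (k $ i))))
      else (\<lambda>x. 2 powr (real j * real CARD('n) / 2) * \<psi> l ((2 ^ j) *\<^sub>R x - (\<chi> i. real_of_int (k $ i))))))"

definition Daubechies :: "nat \<Rightarrow> (real^'n \<Rightarrow> real) \<Rightarrow> (nat \<Rightarrow> real^'n \<Rightarrow> real) \<Rightarrow> bool" where
  "Daubechies L \<phi> \<psi> \<longleftrightarrow>
     Cc L \<phi> \<and>
     (\<forall>l\<in>{1..<2 ^ CARD('n)}. Cc L (\<psi> l)) \<and>
     (\<forall>l\<in>{1..<2 ^ CARD('n)}. \<forall>\<alpha> :: 'n \<Rightarrow> nat. (\<Sum>i\<in>UNIV. \<alpha> i) \<le> L \<longrightarrow>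
         (\<integral>x. (\<Prod>i\<in>UNIV. (x $ i) ^ \<alpha> i) * \<psi> l x \<partial>lborel) = 0) \<and>
     (\<forall>\<omega>\<in>Omega. \<forall>\<omega>'\<in>Omega. L2inner (wav \<phi> \<psi> \<omega>) (wav \<phi> \<psi> \<omega>') = (if \<omega> = \<omega>' then 1 else 0)) \<and>
     (\<forall>g\<in>L2. (\<forall>\<omega>\<in>Omega. L2inner g (wav \<phi> \<psi> \<omega>) = 0) \<longrightarrow> (AE x in lborel. g x = 0))"

definition fseq_meas :: "(nat \<Rightarrow> real^'n \<Rightarrow> real) \<Rightarrow> bool" where
  "fseq_meas F \<longleftrightarrow> (\<forall>j. F j \<in> borel_measurable lborel)"

definition qn_lattice :: "((nat \<Rightarrow> real^'n \<Rightarrow> real) \<Rightarrow> ereal) \<Rightarrow> bool" where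
  "qn_lattice X \<longleftrightarrow>
     (\<forall>F. fseq_meas F \<longrightarrow> X F \<ge> 0) \<and>
     (\<forall>F. fseq_meas F \<longrightarrow> (X F = 0 \<longleftrightarrow> (\<forall>j. AE x in lborel. F j x = 0))) \<and>
     (\<forall>F c. fseq_meas F \<longrightarrow> X (\<lambda>j x. c * F j x) = ereal \<bar>c\<bar> * X F) \<and>
     (\<exists>K\<ge>1. \<forall>F G. fseq_meas F \<longrightarrow> fseq_meas G \<longrightarrow>
         X (\<lambda>j x. F j x + G j x) \<le> ereal K * (X F + X G)) \<and>
     (\<forall>F G. fseq_meas F \<longrightarrow> fseq_meas G \<longrightarrow>
         (\<forall>j. AE x in lborel. \<bar>F j x\<bar> \<le> \<bar>G j x\<bar>) \<longrightarrow> X F \<le> X G) \<and>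
     (\<exists>C. \<forall>F. fseq_meas F \<longrightarrow>
         X (\<lambda>j. F (j + 1)) \<le> ereal C * X F \<and>
         X (\<lambda>j. if j = 0 then (\<lambda>x. 0) else F (j - 1)) \<le> ereal C * X F) \<and>
     (\<forall>f. f \<in> borel_measurable lborel \<longrightarrow> bounded (range f) \<longrightarrow> bounded {x. f x \<noteq> 0} \<longrightarrow>
         X (\<lambda>j. if j = 0 then f else (\<lambda>x. 0)) < \<infinity>)"

definition LambdaX :: "real \<Rightarrow> ((nat \<Rightarrow> real^'n \<Rightarrow> real) \<Rightarrow> ereal) \<Rightarrow> (real^'n \<Rightarrow> real)
    \<Rightarrow> (nat \<Rightarrow> real^'n \<Rightarrow> real) \<Rightarrow> (real^'n \<Rightarrow> real) set" where
  "LambdaX s X \<phi> \<psi> = {f \<in> Lambda s.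
     X (\<lambda>j x. \<Sum>\<^sub>\<infinity>\<omega>\<in>{\<omega>\<in>Omega. fst (snd \<omega>) = j}.
          ((1/2) ^ (j * CARD('n))) powr (- s / real CARD('n) - 1/2)
          * \<bar>L2inner f (wav \<phi> \<psi> \<omega>)\<bar> * indicator (cube (snd \<omega>)) x) < \<infinity>}"

definition Hplus :: "((real^'n) \<times> real) set" where
  "Hplus = {p. snd p > 0}"

definition hrho :: "(real^'n) \<times> real \<Rightarrow> (real^'n) \<times> real \<Rightarrow> real" where
  "hrho p q = arcosh (1 + (norm (p - q))^2 / (2 * snd p * snd q))"

definition hball :: "(real^'n) \<times> real \<Rightarrow> real \<Rightarrow> ((real^'n) \<times> real) set" where
  "hball z t = {y \<in> Hplus. hrho z y < t}"

definition hnbhd :: "((real^'n) \<times> real) set \<Rightarrow> real \<Rightarrow> ((real^'n) \<times> real) set" where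
  "hnbhd A R = {x \<in> Hplus. \<exists>y\<in>A. hrho x y < R}"

definition setseq_ok :: "(nat \<Rightarrow> ((real^'n) \<times> real) set) \<Rightarrow> bool" where
  "setseq_ok A \<longleftrightarrow> (\<forall>j. A j \<subseteq> Hplus \<and> A j \<in> sets lebesgue)"

definition carleson_type :: "((nat \<Rightarrow> ((real^'n) \<times> real) set) \<Rightarrow> ereal) \<Rightarrow> bool" where
  "carleson_type \<nu> \<longleftrightarrow>
     (\<forall>A. setseq_ok A \<longrightarrow> \<nu> A \<ge> 0) \<and>
     (\<forall>A B. setseq_ok A \<longrightarrow> setseq_ok B \<longrightarrow> (\<forall>j. A j \<subseteq> B j) \<longrightarrow> \<nu> A \<le> \<nu> B) \<and>
     (\<exists>C. \<forall>A B. setseq_ok A \<longrightarrow> setseq_ok B \<longrightarrow>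
         \<nu> (\<lambda>j. A j \<union> B j) \<le> ereal C * (\<nu> A + \<nu> B)) \<and>
     (\<forall>A. setseq_ok A \<longrightarrow>
        (\<exists>\<delta> \<delta>'. 0 < \<delta> \<and> \<delta> < 1/10 \<and> 0 < \<delta>' \<and> \<delta>' < 1/10 \<and>
           (\<forall>j. \<forall>z\<in>A j. emeasure lebesgue (hball z \<delta> \<inter> A j) \<ge> ennreal \<delta>' * emeasure lebesgue (hball z \<delta>)))
        \<longrightarrow> (\<forall>R>0. (\<nu> (\<lambda>j. hnbhd (A j) R) < \<infinity> \<longleftrightarrow> \<nu> A < \<infinity>))) \<and>
     (\<exists>C. \<forall>A. setseq_ok A \<longrightarrow>
         \<nu> (\<lambda>j. A (j + 1)) \<le> ereal C * \<nu> A \<and>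
         \<nu> (\<lambda>j. if j = 0 then {} else A (j - 1)) \<le> ereal C * \<nu> A)"

definition nu1 :: "((nat \<Rightarrow> ((real^'n) \<times> real) set) \<Rightarrow> ereal) \<Rightarrow> ((real^'n) \<times> real) set \<Rightarrow> ereal" where
  "nu1 \<nu> A = \<nu> (\<lambda>j. if j = 0 then A else {})"

definition assumption_II :: "((nat \<Rightarrow> real^'n \<Rightarrow> real) \<Rightarrow> ereal) \<Rightarrow> ((nat \<Rightarrow> ((real^'n) \<times> real) set) \<Rightarrow> ereal) \<Rightarrow> bool" where
  "assumption_II X \<nu> \<longleftrightarrow> carleson_type \<nu> \<and>
     (\<forall>\<A> :: (nat \<times> (int^'n)) set.
        (X (\<lambda>j x. \<Sum>\<^sub>\<infinity>I\<in>{I\<in>\<A>. fst I = j}. indicator (cube I) x) < \<infinity>)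
        \<longleftrightarrow> (\<nu> (\<lambda>j. \<Union>I\<in>{I\<in>\<A>. fst I = j}. Tbox I) < \<infinity>))"

definition V0 :: "(real^'n \<Rightarrow> real) \<Rightarrow> (nat \<Rightarrow> real^'n \<Rightarrow> real) \<Rightarrow> (real^'n \<Rightarrow> real) \<Rightarrow> real \<Rightarrow> (nat \<times> (int^'n)) set" where
  "V0 \<phi> \<psi> f \<epsilon> = {I. fst I = 0 \<and> \<bar>L2inner f (wav \<phi> \<psi> (0, I))\<bar> > \<epsilon>}"

definition eps_Xnu :: "((nat \<Rightarrow> ((real^'n) \<times> real) set) \<Rightarrow> ereal) \<Rightarrow> nat \<Rightarrow> real \<Rightarrow> (real^'n \<Rightarrow> real) \<Rightarrow> ereal" where
  "eps_Xnu \<nu> r s f = Inf (ereal ` {\<epsilon>. 0 < \<epsilon> \<and> \<nu> (\<lambda>j. Sset r j s f \<epsilon>) < \<infinity>})"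

definition eps_V0 :: "((nat \<Rightarrow> ((real^'n) \<times> real) set) \<Rightarrow> ereal) \<Rightarrow> (real^'n \<Rightarrow> real) \<Rightarrow> (nat \<Rightarrow> real^'n \<Rightarrow> real) \<Rightarrow> (real^'n \<Rightarrow> real) \<Rightarrow> ereal" where
  "eps_V0 \<nu> \<phi> \<psi> f = Inf (ereal ` {\<epsilon>. 0 < \<epsilon> \<and> nu1 \<nu> (\<Union>I\<in>V0 \<phi> \<psi> f \<epsilon>. Tbox I) < \<infinity>})"

end

theory Submission
  imports Defs
begin

text \<open>
  Both quantities are read off the wavelet coefficients, normalised by the weight
  \<open>2 ^ (j (s + n/2))\<close> at level \<open>j\<close>.

  Whitney's inequality, together with the vanishing moments, bounds a coefficient by the \<open>r\<close>-th
  differences of \<open>f\<close> at comparable scale near the cube. Hence a cube with a large coefficient lies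
  within bounded hyperbolic distance of the set where the differences exceed the threshold, and
  deleting the small coefficients of \<open>f\<close> produces an element of \<open>\<Lambda>\<^sub>X\<^sup>s\<close> at distance \<open>O(\<epsilon>)\<close>.

  Conversely, the levels of the wavelet series of \<open>g\<close> contribute to \<open>\<Delta>\<^sub>r g(x, y) / y\<^sup>s\<close> with geometric
  decay in the distance between the level and \<open>log (1/y)\<close>, so a large difference forces a large
  coefficient at hyperbolically bounded distance. If \<open>g\<close> is in \<open>\<Lambda>\<^sub>X\<^sup>s\<close>, then these cubes form a set of
  finite \<open>\<nu>\<close>, and a perturbation of \<open>g\<close> in \<open>\<Lambda>\<^sub>s\<close> only raises the threshold.
\<close>

section \<open>Differences and Whitney's inequality\<close>

text \<open>The obstacle is locality in scale as well as in space. A large coefficient must produce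
  a large difference whose step is comparable to the cube, since much smaller steps lie at unbounded
  hyperbolic distance. Whitney's inequality is therefore needed with steps restricted to
  \<open>c <= norm h <= 1\<close>, and for functions that are merely continuous. It is obtained by
  averaging an \<open>r\<close>-th difference over steps near a fixed vector: one node stays at
  \<open>F x\<close>, and the others become box-spline averages of \<open>F\<close>, smooth enough
  for a Taylor expansion.

  Two orders of difference occur. The generators have \<open>L\<close> derivatives while
  \<open>r\<close> may equal \<open>L + 1\<close>, so level estimates use the order
  \<open>ks\<close>, which exceeds \<open>s\<close> and is at most \<open>L\<close> and
  \<open>r\<close>; order \<open>r\<close> is reached by taking further differences.

  Every comparison of cubes with strips shifts levels by a bounded amount, absorbed by the shift
  axiom for \<open>\<nu>\<close>, and moves points by a bounded hyperbolic distance, absorbed by the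
  neighbourhood axiom. The latter applies only to sets that are dense at hyperbolic scale.\<close>

lemma diffpow_expand:
  "diffpow k h f x = (\<Sum>i\<le>k. (-1)^i * real (k choose i) * f (x + (real k / 2 - real i) *\<^sub>R h))"
proof (induction k arbitrary: x)
  case 0
  show ?case by (simp add: diffpow_def)
next
  case (Suc k)
  have shift: "x - (1/2) *\<^sub>R h + c *\<^sub>R h = x + (c - 1/2) *\<^sub>R h" for c
    by (simp add: algebra_simps)
  define a where "a i = f (x + (real (Suc k) / 2 - real i) *\<^sub>R h)" for i
  have A: "diffpow k h f (x + (1/2) *\<^sub>R h) = (\<Sum>i\<le>k. (-1)^i * real (k choose i) * a i)"
    unfolding Suc.IH a_def by (intro sum.cong refl arg_cong2[where f="(*)"] arg_cong[where f=f])
      (simp add: algebra_simps add_divide_distrib)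
  have B: "diffpow k h f (x - (1/2) *\<^sub>R h) = (\<Sum>i\<le>k. (-1)^i * real (k choose i) * a (Suc i))"
    unfolding Suc.IH a_def by (intro sum.cong refl arg_cong2[where f="(*)"] arg_cong[where f=f])
      (simp only: shift, simp add: field_simps)
  have "(\<Sum>i\<le>k. (-1)^i * real (k choose i) * a i) = (\<Sum>i\<le>Suc k. (-1)^i * real (k choose i) * a i)"
    by simp
  also have "\<dots> = a 0 + (\<Sum>i\<le>k. (-1)^Suc i * real (k choose Suc i) * a (Suc i))"
    by (subst sum.atMost_Suc_shift) simp
  finally have A': "(\<Sum>i\<le>k. (-1)^i * real (k choose i) * a i) = a 0 + (\<Sum>i\<le>k. (-1)^Suc i * real (k choose Suc i) * a (Suc i))" .
  have "diffpow (Suc k) h f x = diffpow k h f (x + (1/2) *\<^sub>R h) - diffpow k h f (x - (1/2) *\<^sub>R h)"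
    by (simp add: diffpow_def diffop_def)
  also have "\<dots> = a 0 + (\<Sum>i\<le>k. (-1)^Suc i * real (Suc k choose Suc i) * a (Suc i))"
    unfolding A B A' by (simp add: sum.distrib sum_negf sum_subtractf algebra_simps)
  also have "\<dots> = (\<Sum>i\<le>Suc k. (-1)^i * real (Suc k choose i) * a i)"
    by (subst sum.atMost_Suc_shift) simp
  finally show ?case by (simp add: a_def)
qed

text \<open>Recentring and reversing the step makes the node \<open>x\<close> itself the term
  \<open>i = 0\<close>, with coefficient 1. This is the form in which Kemperman's identity is
  applied and in which \<open>whitney\<close> solves for \<open>F x\<close>.\<close>

lemma diffpow_one_sided:
  "diffpow r (- h) f (x + (real r / 2) *\<^sub>R h) = (\<Sum>i\<le>r. (-1)^i * real (r choose i) * f (x + real i *\<^sub>R h))"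
  unfolding diffpow_expand
  by (intro sum.cong refl arg_cong2[where f="(*)"] arg_cong[where f=f]) (simp add: algebra_simps)

text \<open>The product of the operators identity minus translation by \<open>v i\<close>. Compared
  with forward differences the sign is reversed in each factor, so that \<open>F x\<close> enters
  with coefficient 1.\<close>

fun mixed_diff :: "nat \<Rightarrow> (nat \<Rightarrow> 'a) \<Rightarrow> ('a::real_vector \<Rightarrow> real) \<Rightarrow> 'a \<Rightarrow> real" where
  "mixed_diff 0 v F x = F x"
| "mixed_diff (Suc m) v F x = mixed_diff m v F x - mixed_diff m v F (x + v m)"

lemma mixed_diff_expand:
  "mixed_diff m v F x = (\<Sum>S\<in>Pow {..<m}. (-1)^card S * F (x + sum v S))"
proof (induction m arbitrary: x)
  case (Suc m)
  have inj: "inj_on (insert m) (Pow {..<m})"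
    by (rule inj_on_inverseI[where g="\<lambda>S. S - {m}"]) auto
  have "(\<Sum>S\<in>Pow {..<Suc m}. (-1)^card S * F (x + sum v S))
      = (\<Sum>S\<in>Pow {..<m}. (-1)^card S * F (x + sum v S)) + (\<Sum>S\<in>insert m ` Pow {..<m}. (-1)^card S * F (x + sum v S))"
    unfolding lessThan_Suc Pow_insert by (subst sum.union_disjoint) auto
  also have "(\<Sum>S\<in>insert m ` Pow {..<m}. (-1)^card S * F (x + sum v S)) = (\<Sum>S\<in>Pow {..<m}. (-1)^card (insert m S) * F (x + sum v (insert m S)))"
    by (subst sum.reindex[OF inj]) simp
  also have "\<dots> = (\<Sum>S\<in>Pow {..<m}. - ((-1)^card S * F (x + v m + sum v S)))"
  proof (rule sum.cong[OF refl])
    fix S assume "S \<in> Pow {..<m}"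
    then have "finite S" "m \<notin> S" using finite_subset by auto
    then show "(-1)^card (insert m S) * F (x + sum v (insert m S)) = - ((-1)^card S * F (x + v m + sum v S))"
      by (simp add: algebra_simps)
  qed
  finally show ?case using Suc by (simp add: sum_negf)
qed simp

lemma mixed_diff_zero: "i < m \<Longrightarrow> v i = 0 \<Longrightarrow> mixed_diff m v F x = 0"
  by (induction m arbitrary: x) (auto simp: less_Suc_eq)

text \<open>For the induction in \<open>avg_poly_approx\<close>: the increment of \<open>g\<close>
  along a coordinate inherits a bound of one order less. Changing \<open>v\<close> at an index not
  below \<open>m\<close> does not affect \<open>mixed_diff m\<close>.\<close>

lemma mixed_diff_of_diff:
  "mixed_diff m v (\<lambda>y. g y - g (y + d)) x = mixed_diff (Suc m) (v(m := d)) g x"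
proof -
  have eq: "mixed_diff m v g x = mixed_diff m (v(k := d)) g x" if "m \<le> k" for m k and g :: "'a \<Rightarrow> real" and x
    using that by (induction m arbitrary: x) auto
  have "mixed_diff m v (\<lambda>y. g y - g (y + d)) x = mixed_diff m v g x - mixed_diff m v g (x + d)"
  proof (induction m arbitrary: x)
    case (Suc m)
    have "x + v m + d = x + d + v m" by simp
    then show ?case unfolding mixed_diff.simps Suc.IH by (simp only:)
  qed simp
  then show ?thesis using eq[of m m] by simp
qed

lemma mixed_diff_shift: "mixed_diff m v (\<lambda>y. g (y + d)) x = mixed_diff m v g (x + d)"
  by (induction m arbitrary: x) (auto simp: algebra_simps)

text \<open>Kemperman's identity. In the sum over \<^term>\<open>k\<close> every term with \<^term>\<open>0 < k\<close> vanishes,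
  because the step with index \<^term>\<open>k - 1\<close> is scaled to zero.\<close>
lemma mixed_diff_pure:
  fixes v :: "nat \<Rightarrow> real^'n"
  defines "h \<equiv> \<lambda>S. - (\<Sum>i\<in>S. (1 / real (Suc i)) *\<^sub>R v i)"
  shows "mixed_diff r v F x =
    (\<Sum>S\<in>Pow {..<r}. (-1)^card S * diffpow r (- h S) F (x + sum v S + (real r / 2) *\<^sub>R h S))"
proof -
  have "(\<Sum>S\<in>Pow {..<r}. (-1)^card S * diffpow r (- h S) F (x + sum v S + (real r / 2) *\<^sub>R h S))
     = (\<Sum>S\<in>Pow {..<r}. \<Sum>k\<le>r. (-1)^k * real (r choose k) * ((-1)^card S * F (x + sum v S + real k *\<^sub>R h S)))"
    unfolding diffpow_one_sided sum_distrib_left by (intro sum.cong refl) (simp only: ac_simps)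
  also have "\<dots> = (\<Sum>k\<le>r. (-1)^k * real (r choose k) * (\<Sum>S\<in>Pow {..<r}. (-1)^card S * F (x + sum v S + real k *\<^sub>R h S)))"
    by (subst sum.swap) (simp add: sum_distrib_left)
  also have "\<dots> = (\<Sum>k\<le>r. (-1)^k * real (r choose k) * mixed_diff r (\<lambda>i. (1 - real k / real (Suc i)) *\<^sub>R v i) F x)"
  proof (intro sum.cong refl arg_cong2[where f="(*)"])
    fix k
    have "sum v S + real k *\<^sub>R h S = (\<Sum>i\<in>S. (1 - real k / real (Suc i)) *\<^sub>R v i)" for S
      unfolding h_def by (simp add: scaleR_sum_right scaleR_diff_left sum_subtractf)
    then show "(\<Sum>S\<in>Pow {..<r}. (-1)^card S * F (x + sum v S + real k *\<^sub>R h S)) = mixed_diff r (\<lambda>i. (1 - real k / real (Suc i)) *\<^sub>R v i) F x"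
      unfolding mixed_diff_expand by (simp add: add.assoc)
  qed
  also have "\<dots> = (\<Sum>k\<in>{0}. (-1)^k * real (r choose k) * mixed_diff r (\<lambda>i. (1 - real k / real (Suc i)) *\<^sub>R v i) F x)"
  proof (rule sum.mono_neutral_right)
    show "\<forall>k\<in>{..r} - {0}. (-1)^k * real (r choose k) * mixed_diff r (\<lambda>i. (1 - real k / real (Suc i)) *\<^sub>R v i) F x = 0"
    proof
      fix k assume "k \<in> {..r} - {0}"
      then have "mixed_diff r (\<lambda>i. (1 - real k / real (Suc i)) *\<^sub>R v i) F x = 0"
        by (intro mixed_diff_zero[of "k - 1"]) auto
      then show "(-1)^k * real (r choose k) * mixed_diff r (\<lambda>i. (1 - real k / real (Suc i)) *\<^sub>R v i) F x = 0" by simp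
    qed
  qed auto
  finally show ?thesis by simp
qed

text \<open>In Kemperman's identity each nonempty \<open>S\<close> contributes a pure difference
  with step \<open>h S\<close>. All \<open>v i\<close> are positive multiples of coordinate vectors,
  so the summands of \<open>h S\<close> cannot cancel and its length is at least
  \<open>b / r\<close>; this is what keeps small steps out. The empty set gives step zero, where the
  difference vanishes because \<open>r >= 1\<close>.\<close>

lemma mixed_diff_bound:
  fixes F :: "real^'n \<Rightarrow> real"
  assumes E: "\<And>x h. norm x \<le> \<rho> \<Longrightarrow> c \<le> norm h \<Longrightarrow> norm h \<le> 1 \<Longrightarrow> \<bar>diffpow r h F x\<bar> \<le> E"
    and b: "0 < b" "c \<le> b / real r" "real r * b \<le> 1" and r: "r \<ge> 1"
    and v: "\<And>i. \<exists>j. v i = b *\<^sub>R axis j 1"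
    and x: "norm x + real r * b + real r / 2 \<le> \<rho>" and E0: "0 \<le> E"
  shows "\<bar>mixed_diff r v F x\<bar> \<le> 2 ^ r * E"
proof -
  define h where "h = (\<lambda>S. - (\<Sum>i\<in>S. (1 / real (Suc i)) *\<^sub>R v i))"
  have nv: "norm (v i) = b" for i using v[of i] b(1) by auto
  have "\<bar>diffpow r (- h S) F (x + sum v S + (real r / 2) *\<^sub>R h S)\<bar> \<le> E" if S: "S \<in> Pow {..<r}" for S
  proof (cases "S = {}")
    case True
    have "diffpow r 0 F y = 0" for y
      using r by (cases r) (auto simp: diffpow_def diffop_def)
    then show ?thesis using True E0 by (simp add: h_def)
  next
    case False
    have fin: "finite S" using S finite_subset by auto
    have cS: "card S \<le> r" using S card_mono[of "{..<r}" S] by auto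
    then have cSb: "real (card S) * b \<le> real r * b" using b by (simp add: mult_right_mono)
    have "norm (h S) \<le> (\<Sum>i\<in>S. norm ((1 / real (Suc i)) *\<^sub>R v i))" unfolding h_def norm_minus_cancel by (rule norm_sum)
    also have "\<dots> \<le> (\<Sum>i\<in>S. b)" by (intro sum_mono) (use b(1) in \<open>auto simp: nv divide_simps\<close>)
    finally have hb: "norm (h S) \<le> real r * b" using cSb by simp
    have sb: "norm (sum v S) \<le> real r * b"
      using norm_sum[of v S] cSb by (simp add: nv)
    obtain i0 where i0: "i0 \<in> S" using False by auto
    obtain j where j: "v i0 = b *\<^sub>R axis j 1" using v by blast
    have i0r: "real (Suc i0) \<le> real r" using i0 S by auto
    have pos: "0 \<le> v i $ j" for i using v[of i] b(1) by (auto simp: axis_def)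
    have "b / real r \<le> b / real (Suc i0)" using b(1) i0r by (intro divide_left_mono) auto
    then have "c \<le> b / real (Suc i0)" using b(2) by linarith
    also have "\<dots> \<le> (\<Sum>i\<in>S. (1 / real (Suc i)) * v i $ j)"
      using member_le_sum[of i0 S "\<lambda>i. (1 / real (Suc i)) * v i $ j"] i0 fin pos j by (auto simp: axis_def)
    also have "\<dots> = - (h S) $ j" by (simp add: h_def)
    also have "\<dots> \<le> norm (h S)" using component_le_norm_cart[of "h S" j] by simp
    finally have hc: "c \<le> norm (- h S)" by simp
    have "norm (x + sum v S + (real r / 2) *\<^sub>R h S) \<le> norm x + norm (sum v S) + real r / 2 * norm (h S)"
      using norm_triangle_ineq[of "x + sum v S" "(real r / 2) *\<^sub>R h S"] norm_triangle_ineq[of x "sum v S"] by simp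
    also have "\<dots> \<le> norm x + real r * b + real r / 2 * 1"
      using hb sb b by (intro add_mono mult_left_mono) auto
    finally have "norm (x + sum v S + (real r / 2) *\<^sub>R h S) \<le> \<rho>" using x by simp
    then show ?thesis using hc hb b by (intro E) auto
  qed
  moreover have eq: "mixed_diff r v F x =
    (\<Sum>S\<in>Pow {..<r}. (-1)^card S * diffpow r (- h S) F (x + sum v S + (real r / 2) *\<^sub>R h S))"
    unfolding h_def by (rule mixed_diff_pure)
  ultimately have "\<bar>mixed_diff r v F x\<bar> \<le> (\<Sum>S\<in>Pow {..<r}. E)"
    unfolding eq by (intro order_trans[OF sum_abs] sum_mono) (simp add: abs_mult)
  then show ?thesis by (simp add: card_Pow)
qed

section \<open>Iterated averages over segments, that is, averages against box splines\<close>

fun avg :: "'a list \<Rightarrow> ('a::real_normed_vector \<Rightarrow> real) \<Rightarrow> 'a \<Rightarrow> real" where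
  "avg [] g x = g x"
| "avg (d # ds) g x = integral {0..1} (\<lambda>t. avg ds g (x + t *\<^sub>R d))"

lemma continuous_on_avg:
  assumes "continuous_on UNIV g"
  shows "continuous_on UNIV (avg ds g)"
proof (induction ds)
  case (Cons d ds)
  have "continuous_on (UNIV \<times> cbox 0 1) (\<lambda>(x, t). avg ds g (x + t *\<^sub>R d))"
    unfolding split_def by (intro continuous_on_compose2[OF Cons] continuous_intros) auto
  from integral_continuous_on_param[OF this] show ?case by simp
qed (use assms in simp)

lemma avg_integrable:
  assumes "continuous_on UNIV g"
  shows "(\<lambda>t. avg ds g (x + t *\<^sub>R d)) integrable_on {0..1::real}"
  by (intro integrable_continuous_real continuous_on_compose2[OF continuous_on_avg[OF assms]] continuous_intros) auto

lemma avg_bound: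
  fixes g :: "'a::real_normed_vector \<Rightarrow> real"
  assumes "continuous_on UNIV g" "\<And>y. norm (y - x) \<le> sum_list (map norm ds) \<Longrightarrow> \<bar>g y\<bar> \<le> B"
  shows "\<bar>avg ds g x\<bar> \<le> B"
  using assms(2)
proof (induction ds arbitrary: x)
  case (Cons d ds)
  have "\<bar>avg ds g (x + t *\<^sub>R d)\<bar> \<le> B" if "t \<in> {0..1}" for t
  proof (rule Cons.IH)
    fix y assume y: "norm (y - (x + t *\<^sub>R d)) \<le> sum_list (map norm ds)"
    have "norm (t *\<^sub>R d) \<le> norm d" using that by (simp add: mult_left_le_one_le)
    then have "norm (y - x) \<le> sum_list (map norm (d # ds))"
      using y norm_triangle_ineq[of "y - (x + t *\<^sub>R d)" "t *\<^sub>R d"] by simp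
    then show "\<bar>g y\<bar> \<le> B" by (rule Cons.prems)
  qed
  moreover from this[of 0] have "0 \<le> B" by (simp add: order_trans[OF abs_ge_zero])
  moreover have "(\<lambda>t. avg ds g (x + t *\<^sub>R d)) integrable_on cbox 0 1"
    using avg_integrable[OF assms(1), of ds x d] by simp
  ultimately have "norm (integral (cbox 0 1) (\<lambda>t. avg ds g (x + t *\<^sub>R d))) \<le> B * measure lborel (cbox 0 (1::real))"
    by (intro integrable_bound) auto
  then show ?case by simp
qed simp

lemma avg_shift: "avg ds (\<lambda>y. g (y + d)) x = avg ds g (x + d)"
proof (induction ds arbitrary: x)
  case (Cons a ds)
  have "x + t *\<^sub>R a + d = x + d + t *\<^sub>R a" for t by simp
  then show ?case unfolding avg.simps Cons.IH by (simp only:)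
qed simp

text \<open>Averaging over the step \<open>h\<close> of a difference amounts, at the node with
  factor \<open>c\<close>, to averaging \<open>F\<close> along directions dilated by
  \<open>c\<close>.\<close>

lemma avg_scale:
  "avg ds (\<lambda>h. F (x + c *\<^sub>R h)) v = avg (map ((*\<^sub>R) c) ds) F (x + c *\<^sub>R v)"
proof (induction ds arbitrary: v)
  case (Cons a ds)
  have "x + c *\<^sub>R (v + t *\<^sub>R a) = x + c *\<^sub>R v + t *\<^sub>R (c *\<^sub>R a)" for t
    by (simp add: algebra_simps)
  then show ?case unfolding avg.simps list.map Cons.IH by (simp only:)
qed simp

lemma avg_diff:
  assumes "continuous_on UNIV f" "continuous_on UNIV g"
  shows "avg ds (\<lambda>y. f y - g y) x = avg ds f x - avg ds g x"
proof (induction ds arbitrary: x)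
  case (Cons a ds)
  show ?case unfolding avg.simps Cons.IH
    by (intro integral_diff avg_integrable assms)
qed simp

lemma avg_sum:
  assumes "finite I" "\<And>i. i \<in> I \<Longrightarrow> continuous_on UNIV (f i)"
  shows "avg ds (\<lambda>y. \<Sum>i\<in>I. c i * f i y) x = (\<Sum>i\<in>I. c i * avg ds (f i) x)"
proof (induction ds arbitrary: x)
  case (Cons a ds)
  have "integral {0..1} (\<lambda>t. \<Sum>i\<in>I. c i * avg ds (f i) (x + t *\<^sub>R a))
      = (\<Sum>i\<in>I. integral {0..1} (\<lambda>t. c i * avg ds (f i) (x + t *\<^sub>R a)))"
  proof (rule integral_sum[OF assms(1)])
    fix i assume "i \<in> I"
    then show "(\<lambda>t. c i * avg ds (f i) (x + t *\<^sub>R a)) integrable_on {0..1}"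
      by (intro integrable_on_mult_right avg_integrable assms(2))
  qed
  then show ?case unfolding avg.simps Cons.IH by simp
qed simp

lemma avg_swap:
  assumes "continuous_on UNIV g"
  shows "avg (d # e # ds) g = avg (e # d # ds) g"
proof
  fix x
  have "continuous_on (cbox (0,0) (1,1)) (\<lambda>(t,u). avg ds g (x + t *\<^sub>R d + u *\<^sub>R e))"
    unfolding split_def by (intro continuous_on_compose2[OF continuous_on_avg[OF assms]] continuous_intros) auto
  from integral_swap_continuous[OF this]
  have "integral {0..1} (\<lambda>t. integral {0..1} (\<lambda>u. avg ds g (x + t *\<^sub>R d + u *\<^sub>R e)))
      = integral {0..1} (\<lambda>u. integral {0..1} (\<lambda>t. avg ds g (x + t *\<^sub>R d + u *\<^sub>R e)))" by simp
  moreover have "x + t *\<^sub>R d + u *\<^sub>R e = x + u *\<^sub>R e + t *\<^sub>R d" for t u by simp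
  ultimately show "avg (d # e # ds) g x = avg (e # d # ds) g x" by (simp only: avg.simps)
qed

text \<open>By Fubini the directions commute, so the one along which a derivative is to be taken can
  be moved to the front.\<close>

lemma avg_remove1:
  assumes "continuous_on UNIV g" "d \<in> set ds"
  shows "avg ds g = avg (d # remove1 d ds) g"
  using assms(2)
proof (induction ds)
  case (Cons e ds)
  show ?case
  proof (cases "e = d")
    case False
    then have "avg ds g = avg (d # remove1 d ds) g" using Cons by auto
    then have "avg (e # ds) g = avg (e # d # remove1 d ds) g" by (simp only: avg.simps fun_eq_iff) simp
    then show ?thesis using False avg_swap[OF assms(1), of e d] by simp
  qed simp
qed simp

text \<open>The fundamental theorem of calculus turns the derivative along an averaged direction
  into a difference of the remaining average, so each direction in the list buys one derivative of a
  merely continuous function.\<close>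

lemma avg_directional_derivative:
  assumes g: "continuous_on UNIV g"
  shows "((\<lambda>t. avg (d # ds) g (x + t *\<^sub>R d)) has_real_derivative (avg ds g (x + d) - avg ds g x)) (at 0)"
proof -
  define H where "H = (\<lambda>t. avg ds g (x + t *\<^sub>R d))"
  \<comment> \<open>For \<open>t\<close> in (-1,1) and \<open>u\<close> in [0,1] the sum
    \<open>t + u\<close> stays in the open interval (-1,2), where the primitive is differentiable
    from both sides.\<close>
  have H: "continuous_on {-1..2} H"
    unfolding H_def by (intro continuous_on_compose2[OF continuous_on_avg[OF g]] continuous_intros) auto
  then obtain Q where Q: "\<And>t. t \<in> {-1..2} \<Longrightarrow> (Q has_vector_derivative H t) (at t within {-1..2})"
    using antiderivative_continuous[of "-1" 2 H] by blast
  have QD: "(Q has_real_derivative H t) (at t)" if "t \<in> {-1<..<2}" for t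
  proof -
    have "at t within {-1..2} = at t"
      by (rule at_within_interior) (use that in auto)
    then show ?thesis using Q[of t] that by (simp add: has_real_derivative_iff_has_vector_derivative)
  qed
  have eq: "avg (d # ds) g (x + t *\<^sub>R d) = Q (t + 1) - Q t" if "t \<in> {-1<..<1}" for t
  proof -
    have "((\<lambda>u. H (t + u)) has_integral (Q (t + 1) - Q (t + 0))) {0..1}"
    proof (rule fundamental_theorem_of_calculus)
      fix u :: real assume "u \<in> {0..1}"
      then have "(Q has_real_derivative H (t + u)) (at (t + u))" using that by (intro QD) auto
      then have "((\<lambda>u. Q (t + u)) has_real_derivative H (t + u)) (at u)"
        using DERIV_shift[of Q "H (t+u)" u t] by (simp add: add.commute)
      then show "((\<lambda>u. Q (t + u)) has_vector_derivative H (t + u)) (at u within {0..1})"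
        using has_real_derivative_iff_has_vector_derivative has_vector_derivative_at_within by blast
    qed simp
    then have "integral {0..1} (\<lambda>u. H (t + u)) = Q (t + 1) - Q t" by (simp add: integral_unique)
    moreover have "avg (d # ds) g (x + t *\<^sub>R d) = integral {0..1} (\<lambda>u. H (t + u))"
      by (simp add: H_def algebra_simps)
    ultimately show ?thesis by simp
  qed
  have "((\<lambda>t. Q (t + 1) - Q t) has_real_derivative (H 1 - H 0)) (at 0)"
    using DERIV_shift[of Q "H 1" 0 1] QD[of 0] QD[of 1] by (intro DERIV_diff) auto
  then have "((\<lambda>t. avg (d # ds) g (x + t *\<^sub>R d)) has_real_derivative (H 1 - H 0)) (at 0)"
    by (rule has_field_derivative_transform_within_open[where S="{-1<..<1}"]) (use eq in auto)
  then show ?thesis by (simp add: H_def)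
qed

text \<open>The increment from \<open>x\<close> to \<open>x + h\<close> is made one coordinate at a
  time; the mean value theorem evaluates each partial increment near \<open>x\<close>, and
  continuity of the partials at \<open>x\<close> compares it with the linear part.\<close>

lemma has_derivative_of_continuous_partials:
  fixes f :: "real^'n \<Rightarrow> real"
  assumes d: "\<And>j x. ((\<lambda>t. f (x + t *\<^sub>R axis j 1)) has_real_derivative f' j x) (at 0)"
    and c: "\<And>j. isCont (f' j) x"
  shows "(f has_derivative (\<lambda>h. \<Sum>j\<in>UNIV. h $ j * f' j x)) (at x)"
proof -
  have mvt: "\<exists>\<theta>\<in>{0..1}. f (y + t *\<^sub>R axis j 1) - f y = t * f' j (y + (\<theta> * t) *\<^sub>R axis j 1)" for y j t
  proof -
    have D: "((\<lambda>u. f (y + (u * t) *\<^sub>R axis j 1)) has_real_derivative t * f' j (y + (u * t) *\<^sub>R axis j 1)) (at u)" for u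
    proof -
      have eq: "y + (u * t) *\<^sub>R axis j 1 + ((v - u) * t) *\<^sub>R axis j 1 = y + (v * t) *\<^sub>R axis j 1" for v
        by (simp add: algebra_simps)
      have "((\<lambda>w. f ((y + (u * t) *\<^sub>R axis j 1) + w *\<^sub>R axis j 1)) \<circ> (\<lambda>v. (v - u) * t) has_real_derivative
          f' j (y + (u * t) *\<^sub>R axis j 1) * t) (at u)"
        by (rule DERIV_chain) (use d in \<open>auto intro!: derivative_eq_intros\<close>)
      then show ?thesis unfolding o_def eq by (simp only: mult.commute)
    qed
    obtain z :: real where "0 < z" "z < 1" "f (y + (1 * t) *\<^sub>R axis j 1) - f (y + (0 * t) *\<^sub>R axis j 1) = (1 - 0) * (t * f' j (y + (z * t) *\<^sub>R axis j 1))"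
      using MVT2[of 0 1 "\<lambda>u. f (y + (u * t) *\<^sub>R axis j 1)" "\<lambda>u. t * f' j (y + (u * t) *\<^sub>R axis j 1)"] D by auto
    then show ?thesis by (intro bexI[of _ z]) auto
  qed
  have step: "\<exists>\<delta>>0. \<forall>h. norm h < \<delta> \<longrightarrow> \<bar>f (x + (\<Sum>j\<in>S. h $ j *\<^sub>R axis j 1)) - f x - (\<Sum>j\<in>S. h $ j * f' j x)\<bar> \<le> e * norm h"
    if "finite S" "e > 0" for S e
    using that
  proof (induction S arbitrary: e rule: finite_induct)
    case empty
    then show ?case by (intro exI[of _ 1]) auto
  next
    case (insert k S)
    obtain \<delta>1 where \<delta>1: "\<delta>1 > 0" "\<And>h. norm h < \<delta>1 \<Longrightarrow> \<bar>f (x + (\<Sum>j\<in>S. h $ j *\<^sub>R axis j 1)) - f x - (\<Sum>j\<in>S. h $ j * f' j x)\<bar> \<le> e / 2 * norm h"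
      using insert.IH[of "e/2"] insert.prems by auto
    obtain \<delta>2 where \<delta>2: "\<delta>2 > 0" "\<And>y. dist y x < \<delta>2 \<Longrightarrow> dist (f' k y) (f' k x) < e / 2"
      using c[of k] insert.prems unfolding continuous_at_eps_delta by (meson half_gt_zero)
    \<comment> \<open>After the coordinates in \<open>S\<close> and part of coordinate
      \<open>k\<close> have moved, the point is within \<open>N * norm h\<close> of
      \<open>x\<close>.\<close>
    define N where "N = real (card S) + 1"
    have N: "N > 0" by (simp add: N_def)
    show ?case
    proof (intro exI[of _ "min \<delta>1 (\<delta>2 / N)"] conjI allI impI)
      show "min \<delta>1 (\<delta>2 / N) > 0" using \<delta>1 \<delta>2 N by simp
      fix h :: "real^'n" assume h: "norm h < min \<delta>1 (\<delta>2 / N)"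
      define y where "y = x + (\<Sum>j\<in>S. h $ j *\<^sub>R axis j 1)"
      obtain \<theta> where \<theta>: "\<theta> \<in> {0..1}" "f (y + h $ k *\<^sub>R axis k 1) - f y = h $ k * f' k (y + (\<theta> * h $ k) *\<^sub>R axis k 1)"
        using mvt by blast
      have "norm (y + (\<theta> * h $ k) *\<^sub>R axis k 1 - x) \<le> norm (\<Sum>j\<in>S. h $ j *\<^sub>R axis j (1::real)) + \<bar>\<theta> * h $ k\<bar>"
        unfolding y_def using norm_triangle_ineq[of "\<Sum>j\<in>S. h $ j *\<^sub>R axis j (1::real)" "(\<theta> * h $ k) *\<^sub>R axis k 1"] by simp
      also have "\<dots> \<le> (\<Sum>j\<in>S. norm h) + norm h"
      proof (intro add_mono)
        show "norm (\<Sum>j\<in>S. h $ j *\<^sub>R axis j (1::real)) \<le> (\<Sum>j\<in>S. norm h)"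
          by (intro order_trans[OF norm_sum] sum_mono) (simp add: component_le_norm_cart)
        show "\<bar>\<theta> * h $ k\<bar> \<le> norm h" using \<theta>(1) component_le_norm_cart[of h k]
          by (simp add: abs_mult) (meson abs_ge_zero mult_left_le_one_le order_trans)
      qed
      also have "\<dots> = N * norm h" by (simp add: N_def algebra_simps)
      also have "\<dots> < \<delta>2" using h N by (simp add: field_simps)
      finally have "dist (f' k (y + (\<theta> * h $ k) *\<^sub>R axis k 1)) (f' k x) < e / 2"
        by (intro \<delta>2) (simp add: dist_norm)
      then have "\<bar>h $ k\<bar> * \<bar>f' k (y + (\<theta> * h $ k) *\<^sub>R axis k 1) - f' k x\<bar> \<le> norm h * (e / 2)"
        by (intro mult_mono) (auto simp: component_le_norm_cart dist_real_def)
      then have A: "\<bar>f (y + h $ k *\<^sub>R axis k 1) - f y - h $ k * f' k x\<bar> \<le> norm h * (e / 2)"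
        unfolding \<theta>(2) by (simp add: abs_mult[symmetric] algebra_simps)
      have B: "\<bar>f y - f x - (\<Sum>j\<in>S. h $ j * f' j x)\<bar> \<le> e / 2 * norm h"
        unfolding y_def using \<delta>1(2)[of h] h by simp
      have "x + (\<Sum>j\<in>insert k S. h $ j *\<^sub>R axis j 1) = y + h $ k *\<^sub>R axis k 1"
        using insert.hyps by (simp add: y_def algebra_simps)
      moreover have "(\<Sum>j\<in>insert k S. h $ j * f' j x) = h $ k * f' k x + (\<Sum>j\<in>S. h $ j * f' j x)"
        using insert.hyps by simp
      moreover have "norm h * (e / 2) = e * norm h / 2" "e / 2 * norm h = e * norm h / 2" by simp_all
      ultimately show "\<bar>f (x + (\<Sum>j\<in>insert k S. h $ j *\<^sub>R axis j 1)) - f x - (\<Sum>j\<in>insert k S. h $ j * f' j x)\<bar> \<le> e * norm h"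
        using A B by (simp only:)
    qed
  qed
  have "\<exists>d>0. \<forall>y. norm (y - x) < d \<longrightarrow> norm (f y - f x - (\<Sum>j\<in>UNIV. (y - x) $ j * f' j x)) \<le> e * norm (y - x)"
    if e: "e > 0" for e
  proof -
    obtain \<delta> where \<delta>: "\<delta> > 0" "\<forall>h. norm h < \<delta> \<longrightarrow> \<bar>f (x + (\<Sum>j\<in>UNIV. h $ j *\<^sub>R axis j 1)) - f x - (\<Sum>j\<in>UNIV. h $ j * f' j x)\<bar> \<le> e * norm h"
      using step[of UNIV e] e by auto
    have ex: "(\<Sum>j\<in>UNIV. h $ j *\<^sub>R axis j (1::real)) = h" for h :: "real^'n"
      using basis_expansion[of h] by (simp add: scalar_mult_eq_scaleR)
    show ?thesis
    proof (intro exI[of _ \<delta>] conjI allI impI)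
      fix y assume "norm (y - x) < \<delta>"
      then show "norm (f y - f x - (\<Sum>j\<in>UNIV. (y - x) $ j * f' j x)) \<le> e * norm (y - x)"
        using \<delta>(2)[rule_format, of "y - x"] unfolding ex by simp
    qed (use \<delta> in auto)
  qed
  moreover have "bounded_linear (\<lambda>h. \<Sum>j\<in>UNIV. h $ j * f' j x)"
    by (intro bounded_linear_sum bounded_linear_mult_const bounded_linear_vec_nth)
  ultimately show ?thesis unfolding has_derivative_at_alt by auto
qed

text \<open>Polynomials of degree below \<open>m\<close>, with monomials indexed by words in the
  coordinates instead of multi-indices. Coefficients are not unique, but each integration in the
  Taylor induction simply prepends a letter.\<close>

definition word_poly :: "nat \<Rightarrow> ('n list \<Rightarrow> real) \<Rightarrow> real^'n::finite \<Rightarrow> real" where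
  "word_poly m c x = (\<Sum>w\<in>{w. length w < m}. c w * prod_list (map (($) x) w))"

lemma finite_words: "finite {w :: 'n::finite list. length w < m}"
  by (rule finite_subset[OF _ finite_lists_length_le[of UNIV m]]) auto

lemma word_poly_Suc:
  "word_poly (Suc m) c x = c [] + (\<Sum>j\<in>UNIV. \<Sum>w\<in>{w. length w < m}. c (j # w) * (x $ j * prod_list (map (($) x) w)))"
proof -
  have split: "{w :: 'n list. length w < Suc m} = insert [] ((\<lambda>(j, w). j # w) ` (UNIV \<times> {w. length w < m}))"
    by (auto simp: image_iff length_Suc_conv less_Suc_eq_0_disj)
  have inj: "inj_on (\<lambda>(j, w :: 'n list). j # w) (UNIV \<times> {w. length w < m})"
    by (auto simp: inj_on_def)
  show ?thesis unfolding word_poly_def split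
    by (subst sum.insert) (auto simp: finite_words sum.reindex[OF inj[unfolded split_def]] sum.cartesian_product split_def)
qed

lemma prod_list_scale:
  "prod_list (map (($) (t *\<^sub>R x)) w) = t ^ length w * prod_list (map (($) (x::real^'n)) w)"
  by (induction w) auto

text \<open>Taylor expansion along rays: integrating the polynomial approximants of the partial
  derivatives along the segment from the origin gives the approximant of the function itself,
  whether or not they are the partial derivatives of a common function.\<close>
lemma avg_poly_approx:
  fixes g :: "real^'n \<Rightarrow> real"
  assumes b: "b > 0" and \<rho>: "\<rho> \<ge> 0"
    and g: "continuous_on UNIV g"
    and ds: "\<And>j. m \<le> count_list ds (b *\<^sub>R axis j 1)"
    and rad: "\<rho> + sum_list (map norm ds) \<le> \<rho>'"
    and E: "\<And>v y. (\<forall>i. \<exists>j. v i = b *\<^sub>R axis j 1) \<Longrightarrow> norm y \<le> \<rho>' \<Longrightarrow> \<bar>mixed_diff m v g y\<bar> \<le> E"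
  shows "\<exists>c. \<forall>x. norm x \<le> \<rho> \<longrightarrow> \<bar>avg ds g x - word_poly m c x\<bar> \<le> (real CARD('n) * \<rho> / b) ^ m * E"
  using g ds rad E
proof (induction m arbitrary: ds g)
  case 0
  have gE: "\<bar>g y\<bar> \<le> E" if "norm y \<le> \<rho>'" for y
    using 0(4)[of "\<lambda>_. b *\<^sub>R axis undefined 1" y] that by auto
  have "\<bar>avg ds g x\<bar> \<le> E" if "norm x \<le> \<rho>" for x
  proof (rule avg_bound[OF 0(1)])
    fix y assume "norm (y - x) \<le> sum_list (map norm ds)"
    then have "norm y \<le> \<rho>'" using 0(3) that norm_triangle_ineq[of "y - x" x] by simp
    then show "\<bar>g y\<bar> \<le> E" by (rule gE)
  qed
  then show ?case by (simp add: word_poly_def)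
next
  case (Suc m)
  define d where "d j = b *\<^sub>R (axis j 1 :: real^'n)" for j
  define ds' where "ds' j = remove1 (d j) ds" for j
  define g' where "g' j y = g y - g (y + d j)" for j y
  have g'_eta: "g' j = (\<lambda>y. g y - g (y + d j))" for j
    by (simp add: fun_eq_iff g'_def)
  define u where "u = avg ds g"
  \<comment> \<open>The candidate partial derivative. The minus sign comes from \<open>g' j\<close>
    being identity minus translation, and dividing by \<open>b\<close> passes from the direction
    \<open>d j\<close> to the unit vector.\<close>
  define u' where "u' j x = - avg (ds' j) (g' j) x / b" for j x
  define K where "K = (real CARD('n) * \<rho> / b) ^ m * E"
  have dmem: "d j \<in> set ds" for j
    using Suc.prems(2)[of j] count_list_0_iff[of ds "d j"] by (auto simp: d_def)
  have cg': "continuous_on UNIV (g' j)" for j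
    unfolding g'_def by (intro continuous_intros continuous_on_compose2[OF Suc.prems(1)]) auto
  have cgs: "continuous_on UNIV (\<lambda>y. g (y + d j))" for j
    by (intro continuous_intros continuous_on_compose2[OF Suc.prems(1)]) auto
  have u_eq: "u = avg (d j # ds' j) g" for j
    unfolding u_def ds'_def by (rule avg_remove1[OF Suc.prems(1) dmem])
  have cnt: "m \<le> count_list (ds' j) (b *\<^sub>R axis i 1)" for i j
    using Suc.prems(2)[of i] by (auto simp: ds'_def count_list_remove1 split: if_splits)
  have nds': "\<rho> + sum_list (map norm (ds' j)) \<le> \<rho>'" for j
    using Suc.prems(3) sum_list_map_remove1[OF dmem[of j], of norm] unfolding ds'_def
    by (smt (verit) norm_ge_zero)
  have "\<exists>c. \<forall>x. norm x \<le> \<rho> \<longrightarrow> \<bar>avg (ds' j) (g' j) x - word_poly m c x\<bar> \<le> K" for j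
    unfolding K_def
  proof (rule Suc.IH[OF cg' cnt nds'])
    fix v :: "nat \<Rightarrow> real^'n" and y :: "real^'n"
    assume v: "\<forall>i. \<exists>j. v i = b *\<^sub>R axis j 1" and y: "norm y \<le> \<rho>'"
    have "\<forall>i. \<exists>k. (v(m := d j)) i = b *\<^sub>R axis k 1" using v by (auto simp: d_def)
    from Suc.prems(4)[OF this y] show "\<bar>mixed_diff m v (g' j) y\<bar> \<le> E"
      unfolding g'_def mixed_diff_of_diff .
  qed
  then obtain c where c: "\<And>j x. norm x \<le> \<rho> \<Longrightarrow> \<bar>avg (ds' j) (g' j) x - word_poly m (c j) x\<bar> \<le> K"
    by metis
  have partial: "((\<lambda>t. u (x + t *\<^sub>R axis j 1)) has_real_derivative u' j x) (at 0)" for j x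
  proof -
    have "((\<lambda>t. u (x + t *\<^sub>R d j)) has_real_derivative (avg (ds' j) g (x + d j) - avg (ds' j) g x)) (at 0)"
      using avg_directional_derivative[OF Suc.prems(1), of "d j" "ds' j" x] u_eq[of j] by simp
    then have "((\<lambda>t. u (x + t *\<^sub>R d j)) has_real_derivative (b * u' j x)) (at (0 / b))"
      using b avg_diff[OF Suc.prems(1) cgs, of "ds' j" j x] by (simp add: u'_def g'_eta avg_shift)
    then have "((\<lambda>t. u (x + t *\<^sub>R d j)) \<circ> (\<lambda>t. t / b) has_real_derivative (b * u' j x) * (1 / b)) (at 0)"
      by (rule DERIV_chain) (use b in \<open>auto intro!: derivative_eq_intros\<close>)
    then show ?thesis using b by (simp add: o_def d_def)
  qed
  have cu': "isCont (u' j) x" for j x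
  proof -
    have "continuous_on UNIV (u' j)"
      unfolding u'_def by (intro continuous_intros continuous_on_avg cg') (use b in auto)
    then show ?thesis by (simp add: continuous_on_eq_continuous_at)
  qed
  have deriv: "(u has_derivative (\<lambda>h. \<Sum>j\<in>UNIV. h $ j * u' j x)) (at x)" for x
    by (rule has_derivative_of_continuous_partials[OF partial cu'])
  \<comment> \<open>Integrating \<open>x $ j\<close> times the monomial of \<open>w'\<close> along
    the ray divides it by its degree \<open>Suc (length w')\<close>; the minus sign and
    \<open>b\<close> match \<open>u'\<close>. The empty word carries the value at the
    origin.\<close>
  define c' where "c' w = (case w of [] \<Rightarrow> u 0 | j # w' \<Rightarrow> - c j w' / (b * real (Suc (length w'))))" for w
  have "\<bar>u x - word_poly (Suc m) c' x\<bar> \<le> (real CARD('n) * \<rho> / b) ^ Suc m * E" if x: "norm x \<le> \<rho>" for x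
  proof -
    define v where "v t = u (t *\<^sub>R x) - word_poly (Suc m) c' (t *\<^sub>R x)" for t
    define v' where "v' t = (\<Sum>j\<in>UNIV. x $ j * (u' j (t *\<^sub>R x) + word_poly m (c j) (t *\<^sub>R x) / b))" for t
    have "(v has_real_derivative v' t) (at t)" for t
    proof -
      have "((\<lambda>t. u (t *\<^sub>R x)) has_derivative (\<lambda>h. \<Sum>j\<in>UNIV. (h *\<^sub>R x) $ j * u' j (t *\<^sub>R x))) (at t)"
        by (rule has_derivative_compose[OF _ deriv]) (auto intro!: derivative_eq_intros)
      then have 1: "((\<lambda>t. u (t *\<^sub>R x)) has_real_derivative (\<Sum>j\<in>UNIV. x $ j * u' j (t *\<^sub>R x))) (at t)"
        unfolding has_field_derivative_def
        by (rule has_derivative_eq_rhs) (simp add: fun_eq_iff sum_distrib_left sum_distrib_right mult_ac)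
      have 2: "((\<lambda>t. word_poly (Suc m) c' (t *\<^sub>R x)) has_real_derivative
          (\<Sum>j\<in>UNIV. x $ j * (- word_poly m (c j) (t *\<^sub>R x) / b))) (at t)"
      proof -
        let ?k = "\<lambda>j w. x $ j * (- c j w / b) * prod_list (map (($) x) w)"
        have "word_poly (Suc m) c' (\<tau> *\<^sub>R x) = u 0 + (\<Sum>j\<in>UNIV. \<Sum>w\<in>{w. length w < m}.
            ?k j w * (\<tau> ^ Suc (length w) / real (Suc (length w))))" for \<tau>
          unfolding word_poly_Suc prod_list_scale
          by (intro arg_cong2[where f="(+)"] sum.cong refl) (use b in \<open>auto simp: c'_def field_simps\<close>)
        moreover have "((\<lambda>\<tau>. ?k j w * (\<tau> ^ Suc (length w) / real (Suc (length w)))) has_real_derivative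
            ?k j w * t ^ length w) (at t)" for j w
        proof -
          have "((\<lambda>\<tau>::real. \<tau> ^ Suc (length w)) has_real_derivative real (Suc (length w)) * t ^ length w) (at t)"
            using DERIV_pow[of "Suc (length w)" t] by simp
          from DERIV_cdivide[OF this, of "real (Suc (length w))"]
          have "((\<lambda>\<tau>. \<tau> ^ Suc (length w) / real (Suc (length w))) has_real_derivative t ^ length w) (at t)" by simp
          then show ?thesis by (rule DERIV_cmult)
        qed
        then have "((\<lambda>\<tau>. u 0 + (\<Sum>j\<in>UNIV. \<Sum>w\<in>{w. length w < m}. ?k j w * (\<tau> ^ Suc (length w) / real (Suc (length w)))))
          has_real_derivative 0 + (\<Sum>j\<in>UNIV. \<Sum>w\<in>{w. length w < m}. ?k j w * t ^ length w)) (at t)"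
          by (intro DERIV_add DERIV_const DERIV_sum)
        moreover have "(\<Sum>j\<in>UNIV. x $ j * (- word_poly m (c j) (t *\<^sub>R x) / b))
            = 0 + (\<Sum>j\<in>UNIV. \<Sum>w\<in>{w. length w < m}. ?k j w * t ^ length w)"
          unfolding word_poly_def prod_list_scale sum_distrib_left sum_divide_distrib sum_negf[symmetric] add_0
          by (intro sum.cong refl) simp
        ultimately show ?thesis by simp
      qed
      show ?thesis unfolding v_def v'_def
        by (rule DERIV_cong[OF DERIV_diff[OF 1 2]])
          (simp add: sum_subtractf[symmetric] algebra_simps)
    qed
    then obtain z :: real where z: "0 < z" "z < 1" "v 1 - v 0 = (1 - 0) * v' z"
      using MVT2[of 0 1 v v'] by auto
    have v0: "v 0 = 0"
      by (simp add: v_def word_poly_Suc c'_def)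
    \<comment> \<open>Each coordinate contributes \<open>\<rho> * (K / b)\<close>; this is the
      origin of the factor \<open>CARD('n) * \<rho> / b\<close> gained per order.\<close>
    have "\<bar>v' z\<bar> \<le> (\<Sum>j\<in>(UNIV::'n set). \<rho> * (K / b))"
      unfolding v'_def
    proof (intro order_trans[OF sum_abs] sum_mono)
      fix j :: 'n
      have "norm (z *\<^sub>R x) \<le> \<rho>" using z x \<rho> by (simp add: mult_le_one mult_left_le_one_le order_trans[OF mult_left_le_one_le])
      from c[OF this, of j] have "\<bar>(avg (ds' j) (g' j) (z *\<^sub>R x) - word_poly m (c j) (z *\<^sub>R x)) / b\<bar> \<le> K / b"
        using b by (simp add: divide_right_mono)
      moreover have "u' j (z *\<^sub>R x) + word_poly m (c j) (z *\<^sub>R x) / b = - ((avg (ds' j) (g' j) (z *\<^sub>R x) - word_poly m (c j) (z *\<^sub>R x)) / b)"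
        by (simp add: u'_def diff_divide_distrib)
      ultimately have "\<bar>u' j (z *\<^sub>R x) + word_poly m (c j) (z *\<^sub>R x) / b\<bar> \<le> K / b" by simp
      then show "\<bar>x $ j * (u' j (z *\<^sub>R x) + word_poly m (c j) (z *\<^sub>R x) / b)\<bar> \<le> \<rho> * (K / b)"
        unfolding abs_mult using component_le_norm_cart[of x j] x \<rho> by (intro mult_mono) auto
    qed
    then have "\<bar>v 1\<bar> \<le> real CARD('n) * (\<rho> * (K / b))" using z v0 by simp
    then show ?thesis by (simp add: v_def K_def mult_ac)
  qed
  then show ?case unfolding u_def by blast
qed

text \<open>Average an \<open>r\<close>-th difference over steps \<open>h\<close> in a small box
  around \<open>v0\<close>. The node \<open>i = 0\<close> gives \<open>F x\<close>, the average of
  the whole difference is at most \<open>E\<close>, and the nodes \<open>i >= 1\<close> are averages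
  of \<open>F\<close> along \<open>r\<close> copies of each coordinate direction, which
  \<open>avg_poly_approx\<close> replaces by polynomials of degree below \<open>r\<close>. All
  nonzero steps used have length between \<open>c\<close> and 1.\<close>

lemma whitney:
  fixes \<rho>1 :: real
  assumes r: "r \<ge> 1" and \<rho>1: "\<rho>1 > 0"
  obtains C c \<rho> where "C > 0" "c > 0" "c \<le> 1" "\<rho> > 0"
    "\<And>(F :: real^'n \<Rightarrow> real) E. continuous_on UNIV F \<Longrightarrow> 0 \<le> E \<Longrightarrow>
      (\<And>x h. norm x \<le> \<rho> \<Longrightarrow> c \<le> norm h \<Longrightarrow> norm h \<le> 1 \<Longrightarrow> \<bar>diffpow r h F x\<bar> \<le> E) \<Longrightarrow>
      \<exists>q. \<forall>x. norm x \<le> \<rho>1 \<longrightarrow> \<bar>F x - word_poly r q x\<bar> \<le> C * E"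
proof -
  define n where "n = real CARD('n)"
  define R where "R = real r"
  have n1: "n \<ge> 1" using zero_less_card_finite[where 'a='n] by (simp add: n_def)
  have R1: "R \<ge> 1" using r by (simp add: R_def)
  \<comment> \<open>The directions at node \<open>i\<close> have total length
    \<open>R * n * (i * a)\<close>, which for \<open>i <= r\<close> is at most
    \<open>R^2 * n * a = 1/3\<close>.\<close>
  define a where "a = 1 / (3 * R^2 * n)"
  have a0: "a > 0" using n1 R1 by (simp add: a_def)
  have aR: "R^2 * n * a = 1 / 3" using n1 R1 by (simp add: a_def)
  have aRn: "R * n * a \<le> 1 / 3"
  proof -
    have "R * (n * a) \<le> R^2 * (n * a)" using R1 n1 a0 by (intro mult_right_mono) (auto simp: power2_eq_square)
    then show ?thesis using aR by (simp add: mult.assoc)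
  qed
  have aRR: "R^2 * a \<le> 1 / 3"
  proof -
    have "R^2 * a * 1 \<le> R^2 * a * n" using R1 n1 a0 by (intro mult_left_mono) auto
    then show ?thesis using aR by (simp add: mult_ac)
  qed
  define j0 where "j0 = (undefined :: 'n)"
  \<comment> \<open>Twice as long as the total spread \<open>R * n * a\<close> of the directions
    \<open>ds\<close>, so every step \<open>h\<close> in the average satisfies
    \<open>R * n * a <= norm h <= 3 * (R * n * a)\<close>.\<close>
  define v0 where "v0 = (2 * R * n * a) *\<^sub>R (axis j0 1 :: real^'n)"
  have nv0: "norm v0 = 2 * (R * n * a)" using R1 n1 a0 by (simp add: v0_def)
  obtain js :: "'n list" where js: "set js = UNIV" "distinct js"
    using finite_distinct_list[OF finite[of "UNIV :: 'n set"]] by auto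
  have ljs: "real (length js) = n" using js distinct_card[of js] by (simp add: n_def)
  \<comment> \<open>Each coordinate direction occurs \<open>r\<close> times, since the Taylor
    induction may use up the same direction at every order.\<close>
  define ds where "ds = concat (replicate r (map (\<lambda>j. a *\<^sub>R (axis j 1 :: real^'n)) js))"
  have cnt1: "1 \<le> count_list (map (\<lambda>j. b *\<^sub>R (axis j 1 :: real^'n)) js) (b *\<^sub>R axis j 1)" for b j
    using js(1) count_list_0_iff[of "map (\<lambda>j. b *\<^sub>R (axis j 1 :: real^'n)) js" "b *\<^sub>R axis j 1"]
    by (auto simp: image_iff Suc_le_eq)
  have map_ds: "map ((*\<^sub>R) t) ds = concat (replicate r (map (\<lambda>j. (t * a) *\<^sub>R (axis j 1 :: real^'n)) js))" for t
    by (simp add: ds_def map_concat o_def)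
  have cnt: "r \<le> count_list (map ((*\<^sub>R) t) ds) ((t * a) *\<^sub>R axis j 1)" for t j
  proof -
    have "k \<le> count_list (concat (replicate k (map (\<lambda>j. b *\<^sub>R (axis j 1 :: real^'n)) js))) (b *\<^sub>R axis j 1)" for k b
      by (induction k) (use cnt1[of b j] in auto)
    then show ?thesis unfolding map_ds .
  qed
  have sum_js: "sum_list (map norm (map (\<lambda>j. b *\<^sub>R (axis j 1 :: real^'n)) js)) = n * \<bar>b\<bar>" for b
    by (simp add: o_def sum_list_triv ljs)
  have sum_ds: "sum_list (map norm (map ((*\<^sub>R) t) ds)) = R * (n * \<bar>t * a\<bar>)" for t
  proof -
    have "sum_list (map norm (concat (replicate k (map (\<lambda>j. b *\<^sub>R (axis j 1 :: real^'n)) js)))) = real k * (n * \<bar>b\<bar>)" for k b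
      by (induction k) (simp_all only: replicate.simps concat.simps map_append sum_list_append sum_js, simp_all add: algebra_simps)
    then show ?thesis unfolding map_ds R_def .
  qed
  have sum_ds1: "sum_list (map norm ds) = R * n * a" using sum_ds[of 1] a0 by (simp add: o_def)
  \<comment> \<open>The shortest admissible step comes from node \<open>i = 1\<close>, where the
    mixed differences have spacing \<open>a\<close> and Kemperman's steps are at least
    \<open>a / r\<close>. In \<open>C\<close>, one factor \<open>2 ^ r\<close> bounds the sum of the
    binomial weights, the other is the number of subsets in \<open>mixed_diff_bound\<close>.\<close>
  define c where "c = a / R"
  define \<rho> where "\<rho> = \<rho>1 + 2 + R"
  define C where "C = 1 + 4 ^ r * (n * \<rho>1 / a) ^ r"
  have cR: "c \<le> R * n * a"
  proof -
    have "a / R \<le> a" using a0 R1 by (simp add: divide_le_eq)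
    also have "\<dots> \<le> R * n * a" using a0 R1 n1 mult_mono[of 1 R 1 n] by simp
    finally show ?thesis by (simp add: c_def)
  qed
  show ?thesis
  proof
    show "C > 0" "c > 0" "\<rho> > 0" using a0 R1 n1 \<rho>1 by (auto simp: C_def c_def \<rho>_def intro!: add_pos_nonneg)
    show "c \<le> 1" using cR aRn by simp
    fix F :: "real^'n \<Rightarrow> real" and E
    assume F: "continuous_on UNIV F" and E0: "0 \<le> E"
      and E: "\<And>x h. norm x \<le> \<rho> \<Longrightarrow> c \<le> norm h \<Longrightarrow> norm h \<le> 1 \<Longrightarrow> \<bar>diffpow r h F x\<bar> \<le> E"
    have FA: "\<exists>q. \<forall>x. norm x \<le> \<rho>1 \<longrightarrow> \<bar>avg (map ((*\<^sub>R) (real i)) ds) (\<lambda>y. F (y + real i *\<^sub>R v0)) x - word_poly r q x\<bar>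
        \<le> (n * \<rho>1 / (real i * a)) ^ r * (2 ^ r * E)" if i: "i \<in> {1..r}" for i
      unfolding n_def
    proof (rule avg_poly_approx[where \<rho>'="\<rho>1 + 1/3"])
      have i1: "1 \<le> real i" "real i \<le> R" using i by (auto simp: R_def)
      have ia: "real i * a \<le> R * a" using i1 a0 by simp
      show b0: "0 < real i * a" using a0 i1 by simp
      show "0 \<le> \<rho>1" using \<rho>1 by simp
      show "continuous_on UNIV (\<lambda>y. F (y + real i *\<^sub>R v0))"
        by (intro continuous_on_compose2[OF F] continuous_intros) auto
      show "r \<le> count_list (map ((*\<^sub>R) (real i)) ds) ((real i * a) *\<^sub>R axis j 1)" for j by (rule cnt)
      have "R * (n * (real i * a)) \<le> R * (n * (R * a))"
        using ia R1 n1 by (intro mult_left_mono) auto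
      then have "R * (n * (real i * a)) \<le> 1 / 3" using aR by (simp add: power2_eq_square mult_ac)
      then show "\<rho>1 + sum_list (map norm (map ((*\<^sub>R) (real i)) ds)) \<le> \<rho>1 + 1 / 3"
        unfolding sum_ds using b0 by simp
      fix v :: "nat \<Rightarrow> real^'n" and y :: "real^'n"
      assume v: "\<forall>k. \<exists>j. v k = (real i * a) *\<^sub>R axis j 1" and y: "norm y \<le> \<rho>1 + 1/3"
      have Rb: "real r * (real i * a) \<le> 1 / 3"
        using mult_left_mono[OF ia, of R] R1 aRR by (simp add: R_def power2_eq_square mult_ac)
      have "real i * (2 * (R * n * a)) \<le> R * (2 * (R * n * a))"
        using i1 R1 n1 a0 by (intro mult_right_mono) auto
      then have nv: "norm (real i *\<^sub>R v0) \<le> 2 / 3" using aR by (simp add: nv0 power2_eq_square mult_ac)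
      show "\<bar>mixed_diff r v (\<lambda>y. F (y + real i *\<^sub>R v0)) y\<bar> \<le> 2 ^ r * E"
        unfolding mixed_diff_shift
      proof (rule mixed_diff_bound[OF E _ _ _ r _ _ E0])
        show "0 < real i * a" by (rule b0)
        show "c \<le> real i * a / real r" using i1 a0 R1 by (simp add: c_def R_def divide_right_mono)
        show "real r * (real i * a) \<le> 1" using Rb by simp
        show "\<exists>j. v k = (real i * a) *\<^sub>R axis j 1" for k using v by simp
        show "norm (y + real i *\<^sub>R v0) + real r * (real i * a) + real r / 2 \<le> \<rho>"
          using Rb nv y norm_triangle_ineq[of y "real i *\<^sub>R v0"] R1 by (simp add: \<rho>_def R_def)
      qed
    qed
    then obtain q where q: "\<And>i x. i \<in> {1..r} \<Longrightarrow> norm x \<le> \<rho>1 \<Longrightarrow>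
      \<bar>avg (map ((*\<^sub>R) (real i)) ds) (\<lambda>y. F (y + real i *\<^sub>R v0)) x - word_poly r (q i) x\<bar> \<le> (n * \<rho>1 / (real i * a)) ^ r * (2 ^ r * E)"
      by metis
    define w where "w i = (-1)^i * real (r choose i)" for i
    \<comment> \<open>The coefficients of the combination of node polynomials that remains after
      solving the averaged difference for \<open>F x\<close>.\<close>
    define Q where "Q ws = - (\<Sum>i\<in>{1..r}. w i * q i ws)" for ws
    have wQ: "word_poly r Q x = - (\<Sum>i\<in>{1..r}. w i * word_poly r (q i) x)" for x
    proof -
      have "(\<Sum>i\<in>{1..r}. w i * word_poly r (q i) x) = (\<Sum>ws\<in>{ws. length ws < r}. \<Sum>i\<in>{1..r}. w i * (q i ws * prod_list (map (($) x) ws)))"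
        unfolding word_poly_def sum_distrib_left by (rule sum.swap)
      then show ?thesis unfolding word_poly_def Q_def sum_negf[symmetric]
        by (simp add: sum_distrib_right mult.assoc sum_negf)
    qed
    have "\<bar>F x - word_poly r Q x\<bar> \<le> C * E" if x: "norm x \<le> \<rho>1" for x
    proof -
      define A where "A i = avg (map ((*\<^sub>R) (real i)) ds) (\<lambda>y. F (y + real i *\<^sub>R v0)) x" for i
      have cF: "continuous_on UNIV (\<lambda>h. F (x + real i *\<^sub>R h))" for i
        by (intro continuous_on_compose2[OF F] continuous_intros) auto
      have "avg ds (\<lambda>h. \<Sum>i\<le>r. w i * F (x + real i *\<^sub>R h)) v0 = (\<Sum>i\<le>r. w i * avg ds (\<lambda>h. F (x + real i *\<^sub>R h)) v0)"
        by (rule avg_sum) (use cF in auto)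
      also have "\<dots> = (\<Sum>i\<le>r. w i * A i)"
        unfolding A_def avg_scale avg_shift ..
      also have "\<dots> = F x + (\<Sum>i\<in>{1..r}. w i * A i)"
      proof -
        have "A 0 = F x"
        proof -
          have "avg (map ((*\<^sub>R) 0) es) F x = F x" for es :: "(real^'n) list"
            by (induction es arbitrary: x) auto
          then show ?thesis by (simp add: A_def)
        qed
        moreover have "{..r} = insert 0 {1..r}" by auto
        ultimately show ?thesis by (simp add: w_def)
      qed
      finally have eq: "F x = avg ds (\<lambda>h. \<Sum>i\<le>r. w i * F (x + real i *\<^sub>R h)) v0 - (\<Sum>i\<in>{1..r}. w i * A i)" by simp
      have b1: "\<bar>avg ds (\<lambda>h. \<Sum>i\<le>r. w i * F (x + real i *\<^sub>R h)) v0\<bar> \<le> E"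
      proof (rule avg_bound)
        show "continuous_on UNIV (\<lambda>h. \<Sum>i\<le>r. w i * F (x + real i *\<^sub>R h))"
          by (intro continuous_intros cF)
        fix h assume h: "norm (h - v0) \<le> sum_list (map norm ds)"
        have h1: "norm h \<le> 3 * (R * n * a)" "R * n * a \<le> norm h"
          using h norm_triangle_ineq[of "h - v0" v0] norm_triangle_ineq2[of v0 h] unfolding sum_ds1 nv0
          by (auto simp: norm_minus_commute)
        have "norm (x + (real r / 2) *\<^sub>R h) \<le> \<rho>1 + R / 2 * norm h"
          using norm_triangle_ineq[of x "(real r / 2) *\<^sub>R h"] x by (simp add: R_def)
        also have "\<dots> \<le> \<rho>1 + R / 2 * 1" using h1 aRn R1 by (intro add_mono mult_left_mono) auto
        finally have "\<bar>diffpow r (- h) F (x + (real r / 2) *\<^sub>R h)\<bar> \<le> E"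
          using h1 aRn cR R1 by (intro E) (auto simp: \<rho>_def)
        then show "\<bar>\<Sum>i\<le>r. w i * F (x + real i *\<^sub>R h)\<bar> \<le> E"
          unfolding diffpow_one_sided w_def .
      qed
      have b2: "\<bar>\<Sum>i\<in>{1..r}. w i * (A i - word_poly r (q i) x)\<bar> \<le> (\<Sum>i\<in>{1..r}. real (r choose i) * ((n * \<rho>1 / a) ^ r * (2 ^ r * E)))"
      proof (intro order_trans[OF sum_abs] sum_mono)
        fix i assume i: "i \<in> {1..r}"
        have "\<bar>A i - word_poly r (q i) x\<bar> \<le> (n * \<rho>1 / (real i * a)) ^ r * (2 ^ r * E)"
          unfolding A_def using q[OF i x] .
        also have "\<dots> \<le> (n * \<rho>1 / a) ^ r * (2 ^ r * E)"
        proof -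
          have "1 * a \<le> real i * a" using i a0 by (intro mult_right_mono) auto
          then have "n * \<rho>1 / (real i * a) \<le> n * \<rho>1 / a" using n1 \<rho>1 a0 i
            by (intro divide_left_mono) auto
          then show ?thesis using E0 n1 \<rho>1 a0 by (intro mult_right_mono power_mono) auto
        qed
        finally show "\<bar>w i * (A i - word_poly r (q i) x)\<bar> \<le> real (r choose i) * ((n * \<rho>1 / a) ^ r * (2 ^ r * E))"
          by (simp add: w_def abs_mult mult_left_mono)
      qed
      also have "\<dots> \<le> 2 ^ r * ((n * \<rho>1 / a) ^ r * (2 ^ r * E))"
      proof -
        have "(\<Sum>i\<in>{1..r}. real (r choose i)) \<le> (\<Sum>i\<le>r. real (r choose i))" by (rule sum_mono2) auto
        also have "\<dots> = 2 ^ r" using choose_row_sum[of r] by (metis of_nat_numeral of_nat_power of_nat_sum)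
        finally show ?thesis unfolding sum_distrib_right[symmetric]
          using E0 n1 \<rho>1 a0 by (intro mult_right_mono) auto
      qed
      also have "\<dots> = 4 ^ r * (n * \<rho>1 / a) ^ r * E"
      proof -
        have "(4::real) ^ r = 2 ^ r * 2 ^ r" by (simp add: power_mult_distrib[symmetric])
        then show ?thesis by (simp only: mult_ac)
      qed
      finally have b3: "\<bar>\<Sum>i\<in>{1..r}. w i * (A i - word_poly r (q i) x)\<bar> \<le> 4 ^ r * (n * \<rho>1 / a) ^ r * E" .
      have "F x - word_poly r Q x = avg ds (\<lambda>h. \<Sum>i\<le>r. w i * F (x + real i *\<^sub>R h)) v0 - (\<Sum>i\<in>{1..r}. w i * (A i - word_poly r (q i) x))"
        unfolding wQ by (subst eq) (simp add: right_diff_distrib sum_subtractf)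
      then show ?thesis using b1 b3 unfolding C_def by (simp add: distrib_right)
    qed
    then show "\<exists>q. \<forall>x. norm x \<le> \<rho>1 \<longrightarrow> \<bar>F x - word_poly r q x\<bar> \<le> C * E" by blast
  qed
qed

section \<open>Pairing with functions that have vanishing moments\<close>

lemma integrable_compact_support:
  fixes f :: "'a::euclidean_space \<Rightarrow> real"
  assumes "continuous_on UNIV f" "\<And>x. f x \<noteq> 0 \<Longrightarrow> norm x \<le> R"
  shows "integrable lborel f"
proof -
  have "integrable lborel (\<lambda>x. indicator (cball 0 R) x *\<^sub>R f x)"
    by (intro borel_integrable_compact) (auto intro: continuous_on_subset[OF assms(1)])
  moreover have "(\<lambda>x. indicator (cball 0 R) x *\<^sub>R f x) = f"
    using assms(2) by (auto simp: fun_eq_iff indicator_def)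
  ultimately show ?thesis by simp
qed

text \<open>The moment condition removes the Whitney polynomial from the integral, leaving only the
  approximation error on a ball containing the support of \<open>\<psi>\<close>.\<close>

lemma vanishing_moments_pairing:
  fixes \<psi> :: "real^'n \<Rightarrow> real"
  assumes r: "r \<ge> 1" and \<psi>: "continuous_on UNIV \<psi>" and supp: "bounded {x. \<psi> x \<noteq> 0}"
    and mom: "\<And>w. length w < r \<Longrightarrow> (\<integral>x. prod_list (map (($) x) w) * \<psi> x \<partial>lborel) = 0"
  obtains C c \<rho> where "C > 0" "c > 0" "c \<le> 1" "\<rho> > 0"
    "\<And>(F :: real^'n \<Rightarrow> real) E. continuous_on UNIV F \<Longrightarrow> 0 \<le> E \<Longrightarrow>
      (\<And>x h. norm x \<le> \<rho> \<Longrightarrow> c \<le> norm h \<Longrightarrow> norm h \<le> 1 \<Longrightarrow> \<bar>diffpow r h F x\<bar> \<le> E) \<Longrightarrow>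
      \<bar>\<integral>x. F x * \<psi> x \<partial>lborel\<bar> \<le> C * E"
proof -
  obtain \<rho>1 where \<rho>1: "\<rho>1 > 0" "\<And>x. \<psi> x \<noteq> 0 \<Longrightarrow> norm x \<le> \<rho>1"
    using supp unfolding bounded_pos by auto
  obtain C c \<rho> where W: "C > 0" "c > 0" "c \<le> 1" "\<rho> > 0"
    "\<And>(F :: real^'n \<Rightarrow> real) E. continuous_on UNIV F \<Longrightarrow> 0 \<le> E \<Longrightarrow>
      (\<And>x h. norm x \<le> \<rho> \<Longrightarrow> c \<le> norm h \<Longrightarrow> norm h \<le> 1 \<Longrightarrow> \<bar>diffpow r h F x\<bar> \<le> E) \<Longrightarrow>
      \<exists>q. \<forall>x. norm x \<le> \<rho>1 \<longrightarrow> \<bar>F x - word_poly r q x\<bar> \<le> C * E"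
    using whitney[OF r \<rho>1(1)] by blast
  define I where "I = (\<integral>x. \<bar>\<psi> x\<bar> \<partial>lborel)"
  have I0: "I \<ge> 0" by (simp add: I_def)
  have int: "integrable lborel (\<lambda>x. f x * \<psi> x)" if "continuous_on UNIV f" for f :: "real^'n \<Rightarrow> real"
    by (rule integrable_compact_support[where R=\<rho>1]) (use that \<psi> \<rho>1 in \<open>auto intro!: continuous_intros\<close>)
  show ?thesis
  \<comment> \<open>Adding 1 keeps the constant positive without a positive lower bound for
    \<open>I\<close>.\<close>
  proof (rule that[of "C * (I + 1)" c \<rho>])
    show "C * (I + 1) > 0" using W I0 by (intro mult_pos_pos) auto
    fix F :: "real^'n \<Rightarrow> real" and E
    assume F: "continuous_on UNIV F" and E0: "0 \<le> E"
      and E: "\<And>x h. norm x \<le> \<rho> \<Longrightarrow> c \<le> norm h \<Longrightarrow> norm h \<le> 1 \<Longrightarrow> \<bar>diffpow r h F x\<bar> \<le> E"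
    obtain q where q: "\<And>x. norm x \<le> \<rho>1 \<Longrightarrow> \<bar>F x - word_poly r q x\<bar> \<le> C * E"
      using W(5)[OF F E0 E] by auto
    have cw: "continuous_on UNIV (\<lambda>x::real^'n. prod_list (map (($) x) w))" for w :: "'n list"
      by (induction w) (auto intro!: continuous_intros)
    have cP: "continuous_on UNIV (word_poly r q)"
      unfolding word_poly_def by (intro continuous_intros cw)
    have "(\<integral>x. word_poly r q x * \<psi> x \<partial>lborel) = (\<integral>x. (\<Sum>w\<in>{w. length w < r}. q w * (prod_list (map (($) x) w) * \<psi> x)) \<partial>lborel)"
      by (simp add: word_poly_def sum_distrib_right mult.assoc)
    also have "\<dots> = (\<Sum>w\<in>{w. length w < r}. \<integral>x. q w * (prod_list (map (($) x) w) * \<psi> x) \<partial>lborel)"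
      by (rule Bochner_Integration.integral_sum) (intro integrable_mult_right int cw)
    also have "\<dots> = 0" using mom by simp
    finally have P0: "(\<integral>x. word_poly r q x * \<psi> x \<partial>lborel) = 0" .
    have "(\<integral>x. F x * \<psi> x \<partial>lborel) = (\<integral>x. (F x - word_poly r q x) * \<psi> x \<partial>lborel)"
      using P0 int[OF F] int[OF cP] by (simp add: left_diff_distrib)
    also have "\<bar>\<dots>\<bar> \<le> (\<integral>x. C * E * \<bar>\<psi> x\<bar> \<partial>lborel)"
    proof (rule order_trans[OF integral_abs_bound integral_mono])
      show "integrable lborel (\<lambda>x. \<bar>(F x - word_poly r q x) * \<psi> x\<bar>)"
        by (intro integrable_abs int continuous_intros F cP)
      show "integrable lborel (\<lambda>x. C * E * \<bar>\<psi> x\<bar>)"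
        using int[of "\<lambda>_. 1"] by (intro integrable_mult_right integrable_abs) simp
      show "\<bar>(F x - word_poly r q x) * \<psi> x\<bar> \<le> C * E * \<bar>\<psi> x\<bar>" for x
        using q[of x] \<rho>1(2)[of x] by (cases "\<psi> x = 0") (auto simp: abs_mult intro!: mult_right_mono)
    qed
    also have "\<dots> = C * I * E" by (simp add: I_def)
    also have "\<dots> \<le> C * (I + 1) * E" using W E0 by (intro mult_right_mono mult_left_mono) auto
    finally show "\<bar>\<integral>x. F x * \<psi> x \<partial>lborel\<bar> \<le> C * (I + 1) * E" .
  qed (use W in auto)
qed

section \<open>Level sums of wavelet series\<close>

lemma diffpow_diff: "diffpow m h (\<lambda>x. f x - g x) x = diffpow m h f x - diffpow m h g x"
  unfolding diffpow_expand by (simp add: right_diff_distrib sum_subtractf)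

lemma diffpow_sum:
  "diffpow m h (\<lambda>x. \<Sum>i\<in>I. c i * f i x) x = (\<Sum>i\<in>I. c i * diffpow m h (f i) x)"
  unfolding diffpow_expand sum_distrib_left
  by (subst sum.swap) (intro sum.cong refl, simp only: ac_simps)

lemma diffpow_affine:
  "diffpow m h (\<lambda>x. a * f (t *\<^sub>R x - v)) x = a * diffpow m (t *\<^sub>R h) f (t *\<^sub>R x - v)"
proof -
  have "t *\<^sub>R (x + c *\<^sub>R h) - v = t *\<^sub>R x - v + c *\<^sub>R (t *\<^sub>R h)" for c
    by (simp add: algebra_simps)
  then show ?thesis unfolding diffpow_expand sum_distrib_left by (simp only: ac_simps)
qed

lemma diffpow_cong:
  assumes "\<And>i. i \<le> m \<Longrightarrow> f (x + (real m / 2 - real i) *\<^sub>R h) = g (x + (real m / 2 - real i) *\<^sub>R h)"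
  shows "diffpow m h f x = diffpow m h g x"
  unfolding diffpow_expand by (intro sum.cong refl) (simp add: assms)

lemma diffpow_add: "diffpow (m + k) h f = diffpow m h (diffpow k h f)"
  by (simp add: diffpow_def funpow_add)

lemma sum_choose_real: "(\<Sum>i\<le>m. real (m choose i)) = 2 ^ m"
  using choose_row_sum[of m] by (metis of_nat_numeral of_nat_power of_nat_sum)

lemma diffpow_bound:
  assumes "\<And>i. i \<le> m \<Longrightarrow> \<bar>f (x + (real m / 2 - real i) *\<^sub>R h)\<bar> \<le> B"
  shows "\<bar>diffpow m h f x\<bar> \<le> 2 ^ m * B"
proof -
  have "\<bar>diffpow m h f x\<bar> \<le> (\<Sum>i\<le>m. real (m choose i) * B)"
    unfolding diffpow_expand
    by (intro order_trans[OF sum_abs] sum_mono) (simp add: abs_mult mult_left_mono assms)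
  also have "\<dots> = 2 ^ m * B" by (simp add: sum_distrib_right[symmetric] sum_choose_real)
  finally show ?thesis .
qed

lemma diffpow_order_bound:
  assumes "k \<le> r" "\<And>x. \<bar>diffpow k h f x\<bar> \<le> B"
  shows "\<bar>diffpow r h f x\<bar> \<le> 2 ^ (r - k) * B"
  using diffpow_bound[of "r - k" "diffpow k h f" x h B] assms diffpow_add[of "r - k" k h f] by simp

lemma Ck_continuous: "Ck m f \<Longrightarrow> continuous_on UNIV f"
  by (cases m) (auto intro: differentiable_imp_continuous_on)

lemma Ck_mono: "Ck m f \<Longrightarrow> k \<le> m \<Longrightarrow> Ck k f"
proof (induction m arbitrary: k f)
  case (Suc m)
  show ?case
  proof (cases k)
    case 0
    then show ?thesis using Ck_continuous[OF Suc.prems(1)] by simp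
  next
    case (Suc k')
    then show ?thesis using Suc.IH Suc.prems by auto
  qed
qed simp

lemma compact_support_bound:
  fixes f :: "'a::euclidean_space \<Rightarrow> real"
  assumes "continuous_on UNIV f" "bounded {x. f x \<noteq> 0}"
  obtains B where "B > 0" "\<And>x. \<bar>f x\<bar> \<le> B"
proof -
  obtain R where R: "\<And>x. f x \<noteq> 0 \<Longrightarrow> norm x \<le> R" using assms(2) unfolding bounded_iff by auto
  have "bounded (f ` cball 0 R)"
    by (intro compact_imp_bounded compact_continuous_image continuous_on_subset[OF assms(1)]) auto
  then obtain B where B: "B > 0" "\<And>x. norm x \<le> R \<Longrightarrow> \<bar>f x\<bar> \<le> B" unfolding bounded_pos by auto
  have "\<bar>f x\<bar> \<le> B" for x using B R[of x] by (cases "f x = 0") auto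
  then show ?thesis using that B by blast
qed

text \<open>Induction on the order: the mean value theorem writes one difference as a directional
  derivative. The partial derivatives are again compactly supported, with one derivative less, so
  the remaining differences are bounded by induction.\<close>

lemma Ck_diffpow_bound:
  fixes f :: "real^'n \<Rightarrow> real"
  assumes "Ck m f" "bounded {x. f x \<noteq> 0}"
  shows "\<exists>B>0. \<forall>h x. \<bar>diffpow m h f x\<bar> \<le> B * norm h ^ m"
  using assms
proof (induction m arbitrary: f)
  case 0
  then show ?case using compact_support_bound[of f] by (auto simp: diffpow_def)
next
  case (Suc m)
  define p where "p b x = frechet_derivative f (at x) b" for b x
  have D: "(f has_derivative frechet_derivative f (at x)) (at x)" for x
    using Suc.prems(1) by (auto simp: differentiable_on_def frechet_derivative_works)
  have supp: "bounded {x. p b x \<noteq> 0}" for b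
  proof (rule bounded_subset[OF bounded_closure[OF Suc.prems(2)]])
    show "{x. p b x \<noteq> 0} \<subseteq> closure {x. f x \<noteq> 0}"
    proof (rule ccontr)
      assume "\<not> ?thesis"
      then obtain x where x: "p b x \<noteq> 0" "x \<notin> closure {x. f x \<noteq> 0}" by auto
      have "(f has_derivative (\<lambda>_. 0)) (at x)"
        by (rule has_derivative_transform_within_open[of "\<lambda>_. 0" _ x UNIV "- closure {x. f x \<noteq> 0}"])
          (use x closure_subset[of "{x. f x \<noteq> 0}"] in auto)
      then have "frechet_derivative f (at x) = (\<lambda>_. 0)" using frechet_derivative_at by metis
      then show False using x by (simp add: p_def)
    qed
  qed
  have "\<exists>B>0. \<forall>h x. \<bar>diffpow m h (p b) x\<bar> \<le> B * norm h ^ m" if "b \<in> Basis" for b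
    by (rule Suc.IH[OF _ supp]) (use Suc.prems(1) that in \<open>auto simp: p_def[abs_def]\<close>)
  then obtain B where B: "\<And>b. b \<in> Basis \<Longrightarrow> B b > 0" "\<And>b h x. b \<in> Basis \<Longrightarrow> \<bar>diffpow m h (p b) x\<bar> \<le> B b * norm h ^ m"
    by metis
  define C where "C = (\<Sum>b\<in>(Basis::(real^'n) set). B b)"
  have "C > 0" unfolding C_def by (intro sum_pos B) auto
  moreover have "\<bar>diffpow (Suc m) h f x\<bar> \<le> C * norm h ^ Suc m" for h x
  proof -
    \<comment> \<open>The outermost difference is centred, so it is the increment of
      \<open>G\<close> over [-1/2, 1/2], an interval of length one.\<close>
    define G where "G t = diffpow m h f (x + t *\<^sub>R h)" for t
    define G' where "G' t = (\<Sum>b\<in>Basis. (h \<bullet> b) * diffpow m h (p b) (x + t *\<^sub>R h))" for t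
    have "(G has_real_derivative G' t) (at t)" for t
    proof -
      have lin: "frechet_derivative f (at y) (u *\<^sub>R h) = u * (\<Sum>b\<in>Basis. (h \<bullet> b) * p b y)" for y u
      proof -
        have L: "linear (frechet_derivative f (at y))" using has_derivative_linear[OF D] .
        have "frechet_derivative f (at y) h = frechet_derivative f (at y) (\<Sum>b\<in>Basis. (h \<bullet> b) *\<^sub>R b)"
          by (simp add: euclidean_representation)
        also have "\<dots> = (\<Sum>b\<in>Basis. (h \<bullet> b) * p b y)"
          by (simp add: linear_sum[OF L] linear_scale[OF L] p_def)
        finally show ?thesis by (simp add: linear_scale[OF L])
      qed
      have "((\<lambda>t. f (x + t *\<^sub>R h + v)) has_real_derivative (\<Sum>b\<in>Basis. (h \<bullet> b) * p b (x + t *\<^sub>R h + v))) (at t)" for v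
      proof -
        have "((\<lambda>t. f (x + t *\<^sub>R h + v)) has_derivative (\<lambda>u. frechet_derivative f (at (x + t *\<^sub>R h + v)) (u *\<^sub>R h))) (at t)"
          by (rule has_derivative_compose[OF _ D]) (auto intro!: derivative_eq_intros)
        then show ?thesis unfolding has_field_derivative_def lin
          by (rule has_derivative_eq_rhs) (simp add: fun_eq_iff mult.commute)
      qed
      then have "(G has_real_derivative (\<Sum>i\<le>m. (-1)^i * real (m choose i) * (\<Sum>b\<in>Basis. (h \<bullet> b) * p b (x + t *\<^sub>R h + (real m / 2 - real i) *\<^sub>R h)))) (at t)"
        unfolding G_def diffpow_expand by (intro DERIV_sum DERIV_cmult)
      moreover have "(\<Sum>i\<le>m. (-1)^i * real (m choose i) * (\<Sum>b\<in>Basis. (h \<bullet> b) * p b (x + t *\<^sub>R h + (real m / 2 - real i) *\<^sub>R h))) = G' t"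
        unfolding G'_def diffpow_expand sum_distrib_left
        by (subst sum.swap) (simp only: ac_simps)
      ultimately show ?thesis by simp
    qed
    then obtain z :: real where z: "G (1/2) - G (-1/2) = (1/2 - (-1/2)) * G' z"
      using MVT2[of "-1/2" "1/2" G G'] by auto
    have "\<bar>G' z\<bar> \<le> (\<Sum>b\<in>Basis. norm h * (B b * norm h ^ m))"
      unfolding G'_def
      by (intro order_trans[OF sum_abs] sum_mono) (auto simp: abs_mult intro!: mult_mono B Basis_le_norm)
    also have "\<dots> = C * norm h ^ Suc m"
      by (simp add: C_def sum_distrib_right sum_distrib_left mult_ac)
    finally have "\<bar>G' z\<bar> \<le> C * norm h ^ Suc m" .
    moreover have "diffpow (Suc m) h f x = G (1/2) - G (-1/2)"
      by (simp add: G_def diffpow_def diffop_def)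
    ultimately show ?thesis using z by simp
  qed
  ultimately show ?case by blast
qed

section \<open>Dyadic indices and lattice points\<close>

definition intvec :: "int^'n \<Rightarrow> real^'n" where
  "intvec k = (\<chi> i. real_of_int (k $ i))"

definition floorvec :: "nat \<Rightarrow> real^'n \<Rightarrow> int^'n" where
  "floorvec j x = (\<chi> i. \<lfloor>2 ^ j * x $ i\<rfloor>)"

text \<open>The half-open cubes of one level partition space, so membership becomes an equation for
  the index; pointwise sums over cubes then collapse to one term.\<close>

lemma cube_iff: "x \<in> cube (j, k) \<longleftrightarrow> k = floorvec j x"
proof -
  have "real_of_int m / 2 ^ j \<le> y \<and> y < (real_of_int m + 1) / 2 ^ j \<longleftrightarrow> m = \<lfloor>2 ^ j * y\<rfloor>" for m y
    by (auto simp: field_simps floor_eq_iff eq_commute[of m] intro: floor_unique)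
  then show ?thesis by (simp add: cube_def floorvec_def vec_eq_iff)
qed

lemma card_int_box:
  fixes z :: "real^'n"
  assumes "\<rho> \<ge> 0"
  shows "finite {k. norm (z - intvec k) \<le> \<rho>}" "card {k. norm (z - intvec k) \<le> \<rho>} \<le> nat \<lceil>2 * \<rho> + 1\<rceil> ^ CARD('n)"
proof -
  define A where "A i = {\<lceil>z $ i - \<rho>\<rceil>..\<lfloor>z $ i + \<rho>\<rfloor>}" for i
  have cA: "card (A i) \<le> nat \<lceil>2 * \<rho> + 1\<rceil>" for i
  proof -
    have "\<lfloor>z $ i + \<rho>\<rfloor> + 1 - \<lceil>z $ i - \<rho>\<rceil> \<le> \<lceil>2 * \<rho> + 1\<rceil>" by linarith
    then show ?thesis by (simp add: A_def)
  qed
  have sub: "{k. norm (z - intvec k) \<le> \<rho>} \<subseteq> vec_lambda ` (PiE UNIV A)"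
  proof
    fix k assume "k \<in> {k. norm (z - intvec k) \<le> \<rho>}"
    then have "\<bar>z $ i - real_of_int (k $ i)\<bar> \<le> \<rho>" for i
      using component_le_norm_cart[of "z - intvec k" i] by (simp add: intvec_def)
    then have "z $ i - \<rho> \<le> real_of_int (k $ i) \<and> real_of_int (k $ i) \<le> z $ i + \<rho>" for i
      by (smt (verit))
    then have "k $ i \<in> A i" for i by (simp add: A_def ceiling_le_iff le_floor_iff)
    then show "k \<in> vec_lambda ` (PiE UNIV A)"
      by (intro image_eqI[of _ _ "($) k"]) auto
  qed
  have fin: "finite (PiE UNIV A)" by (intro finite_PiE) (auto simp: A_def)
  show "finite {k. norm (z - intvec k) \<le> \<rho>}" by (rule finite_subset[OF sub]) (use fin in auto)
  have "card {k. norm (z - intvec k) \<le> \<rho>} \<le> card (vec_lambda ` (PiE UNIV A))"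
    by (rule card_mono[OF _ sub]) (use fin in auto)
  also have "\<dots> \<le> card (PiE UNIV A)" by (rule card_image_le[OF fin])
  also have "\<dots> = (\<Prod>i\<in>UNIV. card (A i))" by (simp add: card_PiE)
  also have "\<dots> \<le> (\<Prod>i\<in>(UNIV::'n set). nat \<lceil>2 * \<rho> + 1\<rceil>)" by (intro prod_mono) (use cA in auto)
  finally show "card {k. norm (z - intvec k) \<le> \<rho>} \<le> nat \<lceil>2 * \<rho> + 1\<rceil> ^ CARD('n)" by simp
qed

text \<open>At least one derivative makes the level sums Lipschitz (\<open>lev_lipschitz\<close>);
  in the theorem \<open>1 <= L\<close> follows from \<open>0 < s < L\<close>.\<close>

locale wavelet_system =
  fixes L :: nat and \<phi> :: "real^'n \<Rightarrow> real" and \<psi> :: "nat \<Rightarrow> real^'n \<Rightarrow> real"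
  assumes daub: "Daubechies L \<phi> \<psi>" and L1: "L \<ge> 1"
begin

definition gen :: "nat \<Rightarrow> real^'n \<Rightarrow> real" where
  "gen l = (if l = 0 then \<phi> else \<psi> l)"

abbreviation W :: "nat \<times> (nat \<times> (int^'n)) \<Rightarrow> real^'n \<Rightarrow> real" where
  "W \<equiv> wav \<phi> \<psi>"

abbreviation lv :: "nat \<times> (nat \<times> (int^'n)) \<Rightarrow> nat" where
  "lv \<omega> \<equiv> fst (snd \<omega>)"

lemma W_eq: "\<omega> \<in> Omega \<Longrightarrow> W \<omega> x = 2 powr (real (lv \<omega>) * real CARD('n) / 2) * gen (fst \<omega>) (2 ^ lv \<omega> *\<^sub>R x - intvec (snd (snd \<omega>)))"
  by (auto simp: wav_def Omega_def gen_def intvec_def split: prod.splits)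

lemma gen_Cc: "l < 2 ^ CARD('n) \<Longrightarrow> Cc L (gen l)"
  using daub by (auto simp: Daubechies_def gen_def)

lemma gen_continuous: "l < 2 ^ CARD('n) \<Longrightarrow> continuous_on UNIV (gen l)"
  using gen_Cc[of l] Ck_continuous by (auto simp: Cc_def)

lemma gen_support: obtains \<rho> where "\<rho> \<ge> 1" "\<And>l x. l < 2 ^ CARD('n) \<Longrightarrow> gen l x \<noteq> 0 \<Longrightarrow> norm x \<le> \<rho>"
proof -
  have "bounded (\<Union>l<2 ^ CARD('n). {x. gen l x \<noteq> 0})"
    using gen_Cc by (auto simp: Cc_def)
  then obtain a where a: "a > 0" "\<And>x. x \<in> (\<Union>l<2 ^ CARD('n). {x. gen l x \<noteq> 0}) \<Longrightarrow> norm x \<le> a"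
    unfolding bounded_pos by auto
  show ?thesis by (rule that[of "max a 1"]) (use a in \<open>force simp: max_def\<close>)+
qed

text \<open>A support radius common to all generators, fixed once so that it can enter
  \<open>near\<close>, \<open>Nw\<close> and \<open>box_set\<close>.\<close>

definition \<rho>0 where "\<rho>0 = (SOME \<rho>. \<rho> \<ge> 1 \<and> (\<forall>l x. l < 2 ^ CARD('n) \<longrightarrow> gen l x \<noteq> 0 \<longrightarrow> norm x \<le> \<rho>))"

lemma rho0: "\<rho>0 \<ge> 1" "l < 2 ^ CARD('n) \<Longrightarrow> gen l x \<noteq> 0 \<Longrightarrow> norm x \<le> \<rho>0"
proof -
  have "\<exists>\<rho>. \<rho> \<ge> 1 \<and> (\<forall>l x. l < 2 ^ CARD('n) \<longrightarrow> gen l x \<noteq> 0 \<longrightarrow> norm x \<le> \<rho>)"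
    using gen_support by metis
  from someI_ex[OF this] show "\<rho>0 \<ge> 1" "l < 2 ^ CARD('n) \<Longrightarrow> gen l x \<noteq> 0 \<Longrightarrow> norm x \<le> \<rho>0"
    unfolding \<rho>0_def[symmetric] by blast+
qed

lemma gen_diffpow_bound:
  assumes "m \<le> L"
  obtains B where "B > 0" "\<And>l h x. l < 2 ^ CARD('n) \<Longrightarrow> \<bar>diffpow m h (gen l) x\<bar> \<le> B * norm h ^ m"
proof -
  have "\<exists>B>0. \<forall>h x. \<bar>diffpow m h (gen l) x\<bar> \<le> B * norm h ^ m" if "l < 2 ^ CARD('n)" for l
    using gen_Cc[OF that] Ck_mono[OF _ assms] Ck_diffpow_bound by (auto simp: Cc_def)
  then obtain B where B: "\<And>l. l < 2 ^ CARD('n) \<Longrightarrow> B l > 0"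
    "\<And>l h x. l < 2 ^ CARD('n) \<Longrightarrow> \<bar>diffpow m h (gen l) x\<bar> \<le> B l * norm h ^ m" by metis
  show ?thesis
  proof (rule that[of "\<Sum>l<2 ^ CARD('n). B l"])
    show "(\<Sum>l<2 ^ CARD('n). B l) > 0" by (intro sum_pos B) (auto simp: lessThan_empty_iff)
    fix l h x assume l: "l < (2::nat) ^ CARD('n)"
    have "B l \<le> (\<Sum>l<2 ^ CARD('n). B l)"
      by (rule member_le_sum) (use l B in \<open>auto intro: less_imp_le\<close>)
    then show "\<bar>diffpow m h (gen l) x\<bar> \<le> (\<Sum>l<2 ^ CARD('n). B l) * norm h ^ m"
      using B(2)[OF l, of h x] by (meson mult_right_mono norm_ge_zero order_trans zero_le_power)
  qed
qed

text \<open>Defined through the support radius rather than by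
  \<open>W \<omega> x \<noteq> 0\<close>: it still contains every wavelet of level \<open>j\<close>
  alive at \<open>x\<close>, and \<open>Nw\<close> bounds its size for all \<open>j\<close> and
  \<open>x\<close>.\<close>

definition near :: "nat \<Rightarrow> real^'n \<Rightarrow> (nat \<times> (nat \<times> (int^'n))) set" where
  "near j x = {\<omega> \<in> Omega. lv \<omega> = j \<and> norm (2 ^ j *\<^sub>R x - intvec (snd (snd \<omega>))) \<le> \<rho>0}"

definition Nw :: nat where "Nw = 2 ^ CARD('n) * nat \<lceil>2 * \<rho>0 + 1\<rceil> ^ CARD('n)"

lemma W_near: "\<omega> \<in> Omega \<Longrightarrow> W \<omega> x \<noteq> 0 \<Longrightarrow> \<omega> \<in> near (lv \<omega>) x"
  using rho0 by (auto simp: W_eq near_def Omega_def)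

lemma near_finite: "finite (near j x)" and near_card: "card (near j x) \<le> Nw"
proof -
  define K where "K = {k. norm (2 ^ j *\<^sub>R x - intvec k) \<le> \<rho>0}"
  have K: "finite K" "card K \<le> nat \<lceil>2 * \<rho>0 + 1\<rceil> ^ CARD('n)"
    unfolding K_def using card_int_box[of \<rho>0 "2 ^ j *\<^sub>R x"] rho0(1) by auto
  have sub: "near j x \<subseteq> (\<lambda>(l, k). (l, (j, k))) ` ({..<2 ^ CARD('n)} \<times> K)"
    by (auto simp: near_def Omega_def K_def image_iff)
  show "finite (near j x)" by (rule finite_subset[OF sub]) (use K in auto)
  have "card (near j x) \<le> card ((\<lambda>(l, k). (l, (j, k))) ` ({..<(2::nat) ^ CARD('n)} \<times> K))"
    by (rule card_mono[OF _ sub]) (use K in auto)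
  also have "\<dots> \<le> card ({..<(2::nat) ^ CARD('n)} \<times> K)" by (rule card_image_le) (use K in auto)
  also have "\<dots> \<le> Nw" using K by (simp add: Nw_def card_cartesian_product)
  finally show "card (near j x) \<le> Nw" .
qed

text \<open>Locally finite, hence meaningful for arbitrary coefficients; decay of \<open>c\<close>
  matters only for estimates and when levels are summed.\<close>

definition lev :: "(nat \<times> (nat \<times> (int^'n)) \<Rightarrow> real) \<Rightarrow> nat \<Rightarrow> real^'n \<Rightarrow> real" where
  "lev c j x = (\<Sum>\<omega>\<in>near j x. c \<omega> * W \<omega> x)"

lemma lev_superset:
  assumes "finite T" "near j x \<subseteq> T" "\<And>\<omega>. \<omega> \<in> T \<Longrightarrow> \<omega> \<in> Omega \<and> lv \<omega> = j"
  shows "lev c j x = (\<Sum>\<omega>\<in>T. c \<omega> * W \<omega> x)"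
  unfolding lev_def
  by (rule sum.mono_neutral_left) (use assms W_near in force)+

text \<open>The coefficient side of the norm of \<open>Lambda \<sigma>\<close>; the summand
  \<open>n / 2\<close> compensates the \<open>L2\<close> normalisation of the wavelets.\<close>

definition coef_bound :: "real \<Rightarrow> real \<Rightarrow> (nat \<times> (nat \<times> (int^'n)) \<Rightarrow> real) \<Rightarrow> bool" where
  "coef_bound \<sigma> M c \<longleftrightarrow> (\<forall>\<omega>\<in>Omega. \<bar>c \<omega>\<bar> \<le> M * 2 powr (- real (lv \<omega>) * (\<sigma> + real CARD('n) / 2)))"

lemma powr_cancel: "2 powr (- real j * (\<sigma> + n / 2)) * 2 powr (real j * n / 2) = 2 powr (- real j * \<sigma>)"
  by (simp add: powr_add[symmetric] algebra_simps)

lemma lev_bound: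
  obtains B where "B > 0" "\<And>\<sigma> M c j x. coef_bound \<sigma> M c \<Longrightarrow> 0 \<le> M \<Longrightarrow> \<bar>lev c j x\<bar> \<le> B * M * 2 powr (- real j * \<sigma>)"
proof -
  obtain B where B: "B > 0" "\<And>l h x. l < 2 ^ CARD('n) \<Longrightarrow> \<bar>diffpow 0 h (gen l) x\<bar> \<le> B * norm h ^ 0"
    using gen_diffpow_bound[of 0] by auto
  have gB: "\<bar>gen l x\<bar> \<le> B" if "l < 2 ^ CARD('n)" for l x
    using B(2)[OF that, of 0 x] by (simp add: diffpow_def)
  have "\<bar>lev c j x\<bar> \<le> (B * real (Nw + 1)) * M * 2 powr (- real j * \<sigma>)" if c: "coef_bound \<sigma> M c" and M: "0 \<le> M" for c \<sigma> M j x
  proof -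
    have "\<bar>lev c j x\<bar> \<le> (\<Sum>\<omega>\<in>near j x. B * M * 2 powr (- real j * \<sigma>))"
      unfolding lev_def
    proof (intro order_trans[OF sum_abs] sum_mono)
      fix \<omega> assume \<omega>: "\<omega> \<in> near j x"
      then have o: "\<omega> \<in> Omega" "lv \<omega> = j" by (auto simp: near_def)
      then have l: "fst \<omega> < 2 ^ CARD('n)" by (auto simp: Omega_def)
      have "\<bar>c \<omega> * W \<omega> x\<bar> \<le> (M * 2 powr (- real j * (\<sigma> + real CARD('n) / 2))) * (2 powr (real j * real CARD('n) / 2) * B)"
        unfolding abs_mult W_eq[OF o(1)]
        by (intro mult_mono) (use c o gB[OF l] M in \<open>auto simp: coef_bound_def\<close>)
      also have "\<dots> = B * M * (2 powr (- real j * (\<sigma> + real CARD('n) / 2)) * 2 powr (real j * real CARD('n) / 2))" by simp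
      finally show "\<bar>c \<omega> * W \<omega> x\<bar> \<le> B * M * 2 powr (- real j * \<sigma>)" unfolding powr_cancel .
    qed
    also have "\<dots> = real (card (near j x)) * (B * M * 2 powr (- real j * \<sigma>))" by simp
    also have "\<dots> \<le> real (Nw + 1) * (B * M * 2 powr (- real j * \<sigma>))"
      using near_card[of j x] B M by (intro mult_right_mono) auto
    finally show ?thesis by (simp add: mult_ac)
  qed
  then show ?thesis using that[of "B * real (Nw + 1)"] B by auto
qed

text \<open>Collecting the wavelets that may be alive at any of the \<open>m + 1\<close> nodes gives
  one finite index set valid at all nodes, so the difference can be taken term by term; dilation by
  \<open>2 ^ j\<close> then rescales the estimate for the generators.\<close>

lemma lev_diffpow_bound:
  assumes "m \<le> L"
  obtains B where "B > 0" "\<And>\<sigma> M c j x h. coef_bound \<sigma> M c \<Longrightarrow> 0 \<le> M \<Longrightarrow>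
    \<bar>diffpow m h (lev c j) x\<bar> \<le> B * M * 2 powr (- real j * \<sigma>) * (2 ^ j * norm h) ^ m"
proof -
  obtain B where B: "B > 0" "\<And>l h x. l < 2 ^ CARD('n) \<Longrightarrow> \<bar>diffpow m h (gen l) x\<bar> \<le> B * norm h ^ m"
    using gen_diffpow_bound[OF assms] by auto
  have "\<bar>diffpow m h (lev c j) x\<bar> \<le> (B * real ((m + 1) * Nw + 1)) * M * 2 powr (- real j * \<sigma>) * (2 ^ j * norm h) ^ m"
    if c: "coef_bound \<sigma> M c" and M: "0 \<le> M" for c \<sigma> M j x h
  proof -
    define T where "T = (\<Union>i\<le>m. near j (x + (real m / 2 - real i) *\<^sub>R h))"
    have T: "finite T" "\<And>\<omega>. \<omega> \<in> T \<Longrightarrow> \<omega> \<in> Omega \<and> lv \<omega> = j"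
      by (auto simp: T_def near_finite) (auto simp: near_def)
    have cT: "card T \<le> (m + 1) * Nw"
    proof -
      have "card T \<le> (\<Sum>i\<le>m. card (near j (x + (real m / 2 - real i) *\<^sub>R h)))"
        unfolding T_def by (rule card_UN_le) auto
      also have "\<dots> \<le> (\<Sum>i\<le>m. Nw)" by (intro sum_mono near_card)
      finally show ?thesis by simp
    qed
    have "diffpow m h (lev c j) x = diffpow m h (\<lambda>x. \<Sum>\<omega>\<in>T. c \<omega> * W \<omega> x) x"
      by (rule diffpow_cong, rule lev_superset) (use T in \<open>auto simp: T_def\<close>)
    also have "\<dots> = (\<Sum>\<omega>\<in>T. c \<omega> * diffpow m h (W \<omega>) x)" by (rule diffpow_sum)
    finally have eq: "diffpow m h (lev c j) x = (\<Sum>\<omega>\<in>T. c \<omega> * diffpow m h (W \<omega>) x)" .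
    have "\<bar>diffpow m h (lev c j) x\<bar> \<le> (\<Sum>\<omega>\<in>T. B * M * 2 powr (- real j * \<sigma>) * (2 ^ j * norm h) ^ m)"
      unfolding eq
    proof (intro order_trans[OF sum_abs] sum_mono)
      fix \<omega> assume "\<omega> \<in> T"
      then have o: "\<omega> \<in> Omega" "lv \<omega> = j" using T by auto
      then have l: "fst \<omega> < 2 ^ CARD('n)" by (auto simp: Omega_def)
      have W': "W \<omega> = (\<lambda>x. 2 powr (real j * real CARD('n) / 2) * gen (fst \<omega>) (2 ^ j *\<^sub>R x - intvec (snd (snd \<omega>))))"
        using W_eq[OF o(1)] o(2) by auto
      have "\<bar>c \<omega> * diffpow m h (W \<omega>) x\<bar> \<le> (M * 2 powr (- real j * (\<sigma> + real CARD('n) / 2)))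
          * (2 powr (real j * real CARD('n) / 2) * (B * norm (2 ^ j *\<^sub>R h) ^ m))"
        unfolding abs_mult W' diffpow_affine
        by (intro mult_mono) (use c o B(2)[OF l, of "2 ^ j *\<^sub>R h"] M in \<open>auto simp: coef_bound_def\<close>)
      also have "\<dots> = B * M * (2 powr (- real j * (\<sigma> + real CARD('n) / 2)) * 2 powr (real j * real CARD('n) / 2)) * (2 ^ j * norm h) ^ m" by simp
      finally show "\<bar>c \<omega> * diffpow m h (W \<omega>) x\<bar> \<le> B * M * 2 powr (- real j * \<sigma>) * (2 ^ j * norm h) ^ m" unfolding powr_cancel .
    qed
    also have "\<dots> = real (card T) * (B * M * 2 powr (- real j * \<sigma>) * (2 ^ j * norm h) ^ m)" by simp
    also have "\<dots> \<le> real ((m + 1) * Nw + 1) * (B * M * 2 powr (- real j * \<sigma>) * (2 ^ j * norm h) ^ m)"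
      using cT B M by (intro mult_right_mono) (auto simp del: of_nat_mult of_nat_add of_nat_Suc intro!: mult_nonneg_nonneg)
    finally show ?thesis by (simp add: mult_ac)
  qed
  then show ?thesis using that[of "B * real ((m + 1) * Nw + 1)"] B by (auto simp del: of_nat_mult of_nat_add of_nat_Suc)
qed

text \<open>Replaces the point-dependent set \<open>near j x\<close> by one finite set serving a
  whole ball, as needed for continuity and for interchanging the level sum with integrals.\<close>

definition box_set :: "nat \<Rightarrow> real \<Rightarrow> (nat \<times> (nat \<times> (int^'n))) set" where
  "box_set j R = {\<omega> \<in> Omega. lv \<omega> = j \<and> norm (intvec (snd (snd \<omega>))) \<le> 2 ^ j * R + \<rho>0}"

lemma box_set_finite: "finite (box_set j R)"
proof (cases "2 ^ j * R + \<rho>0 \<ge> 0")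
  case True
  define K where "K = {k :: int^'n. norm (0 - intvec k) \<le> 2 ^ j * R + \<rho>0}"
  have "finite K" unfolding K_def using card_int_box(1)[OF True] by blast
  moreover have "box_set j R \<subseteq> (\<lambda>(l, k). (l, (j, k))) ` ({..<2 ^ CARD('n)} \<times> K)"
    by (auto simp: box_set_def Omega_def K_def image_iff)
  ultimately show ?thesis by (meson finite_SigmaI finite_imageI finite_lessThan finite_subset)
next
  case False
  then have "box_set j R = {}" by (auto simp: box_set_def) (meson norm_ge_zero order_trans)
  then show ?thesis by simp
qed

lemma lev_box: "norm x \<le> R \<Longrightarrow> lev c j x = (\<Sum>\<omega>\<in>box_set j R. c \<omega> * W \<omega> x)"
proof (rule lev_superset[OF box_set_finite])
  assume x: "norm x \<le> R"
  show "near j x \<subseteq> box_set j R"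
  proof
    fix \<omega> assume o: "\<omega> \<in> near j x"
    have "norm (intvec (snd (snd \<omega>))) \<le> norm (2 ^ j *\<^sub>R x) + norm (2 ^ j *\<^sub>R x - intvec (snd (snd \<omega>)))"
      by (metis norm_triangle_sub norm_minus_commute)
    also have "\<dots> \<le> 2 ^ j * R + \<rho>0" using o x by (intro add_mono) (auto simp: near_def)
    finally show "\<omega> \<in> box_set j R" using o by (auto simp: near_def box_set_def)
  qed
qed (auto simp: box_set_def)

lemma W_continuous: "\<omega> \<in> Omega \<Longrightarrow> continuous_on UNIV (W \<omega>)"
proof -
  assume o: "\<omega> \<in> Omega"
  then have "fst \<omega> < 2 ^ CARD('n)" by (auto simp: Omega_def)
  then show ?thesis unfolding W_eq[OF o, abs_def]
    by (intro continuous_intros continuous_on_compose2[OF gen_continuous]) auto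
qed

lemma W_support:
  assumes "\<omega> \<in> Omega" "W \<omega> x \<noteq> 0"
  shows "norm x \<le> (norm (intvec (snd (snd \<omega>))) + \<rho>0) / 2 ^ lv \<omega>"
proof -
  let ?k = "intvec (snd (snd \<omega>))"
  have "norm (2 ^ lv \<omega> *\<^sub>R x - ?k) \<le> \<rho>0" using W_near[OF assms] by (simp add: near_def)
  then have "norm (2 ^ lv \<omega> *\<^sub>R x) \<le> norm ?k + \<rho>0"
    using norm_triangle_ineq[of "2 ^ lv \<omega> *\<^sub>R x - ?k" ?k] by simp
  then show ?thesis by (simp add: field_simps)
qed

lemma lev_continuous: "continuous_on UNIV (lev c j)"
proof -
  have "continuous_on (ball 0 R) (lev c j)" for R
  proof -
    have "continuous_on (ball 0 R) (\<lambda>x. \<Sum>\<omega>\<in>box_set j R. c \<omega> * W \<omega> x)"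
      by (intro continuous_intros continuous_on_subset[OF W_continuous]) (auto simp: box_set_def)
    then show ?thesis by (rule continuous_on_eq) (auto intro!: lev_box[symmetric])
  qed
  then have "continuous_on (\<Union>R. ball 0 R) (lev c j)" by (intro continuous_on_open_UN) auto
  moreover have "(\<Union>R. ball (0::real^'n) R) = UNIV" by (auto intro: lt_ex gt_ex)
  ultimately show ?thesis by simp
qed

end

section \<open>Synthesis and coefficient estimates\<close>

lemma continuous_AE_zero:
  fixes f :: "'a::euclidean_space \<Rightarrow> real"
  assumes "continuous_on UNIV f" "AE x in lborel. f x = 0"
  shows "f x = 0"
proof -
  have op: "open {x. f x \<noteq> 0}"
    using open_Collect_neq[OF assms(1), of "\<lambda>_. 0"] by simp
  then have "{x. f x \<noteq> 0} \<in> null_sets lborel"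
    using assms(2) by (subst (asm) AE_iff_null) (auto simp: borel_open)
  then have "negligible {x. f x \<noteq> 0}"
    using null_sets_completionI negligible_iff_null_sets by blast
  then show ?thesis using open_not_negligible[OF op] by auto
qed

lemma uniform_limit_pairing:
  fixes u :: "'a::euclidean_space \<Rightarrow> real"
  assumes lim: "uniform_limit UNIV uJ u sequentially"
    and c: "\<And>J. continuous_on UNIV (uJ J)" "continuous_on UNIV u" "continuous_on UNIV \<theta>"
    and supp: "\<And>x. \<theta> x \<noteq> 0 \<Longrightarrow> norm x \<le> R"
  shows "(\<lambda>J. \<integral>x. uJ J x * \<theta> x \<partial>lborel) \<longlonglongrightarrow> (\<integral>x. u x * \<theta> x \<partial>lborel)"
proof (rule LIMSEQ_I)
  fix e :: real assume e: "e > 0"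
  have int: "integrable lborel (\<lambda>x. f x * \<theta> x)" if "continuous_on UNIV f" for f
    by (rule integrable_compact_support[where R=R]) (use that c supp in \<open>auto intro!: continuous_intros\<close>)
  define I where "I = (\<integral>x. \<bar>\<theta> x\<bar> \<partial>lborel)"
  have I: "I \<ge> 0" by (simp add: I_def)
  have "\<forall>\<^sub>F J in sequentially. \<forall>x\<in>UNIV. dist (uJ J x) (u x) < e / (I + 1)"
    using uniform_limitD[OF lim, of "e / (I + 1)"] e I by simp
  then obtain N where N: "\<And>J x. J \<ge> N \<Longrightarrow> \<bar>uJ J x - u x\<bar> < e / (I + 1)"
    by (auto simp: eventually_sequentially dist_real_def)
  show "\<exists>N. \<forall>J\<ge>N. norm ((\<integral>x. uJ J x * \<theta> x \<partial>lborel) - (\<integral>x. u x * \<theta> x \<partial>lborel)) < e"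
  proof (intro exI[of _ N] allI impI)
    fix J assume J: "J \<ge> N"
    have "(\<integral>x. uJ J x * \<theta> x \<partial>lborel) - (\<integral>x. u x * \<theta> x \<partial>lborel) = (\<integral>x. (uJ J x - u x) * \<theta> x \<partial>lborel)"
      using int[OF c(1)] int[OF c(2)] by (simp add: left_diff_distrib)
    also have "\<bar>\<dots>\<bar> \<le> (\<integral>x. e / (I + 1) * \<bar>\<theta> x\<bar> \<partial>lborel)"
    proof (rule order_trans[OF integral_abs_bound integral_mono])
      show "integrable lborel (\<lambda>x. \<bar>(uJ J x - u x) * \<theta> x\<bar>)"
        by (intro integrable_abs int continuous_intros c)
      show "integrable lborel (\<lambda>x. e / (I + 1) * \<bar>\<theta> x\<bar>)"
        using int[of "\<lambda>_. 1"] by (intro integrable_mult_right integrable_abs) simp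
      show "\<bar>(uJ J x - u x) * \<theta> x\<bar> \<le> e / (I + 1) * \<bar>\<theta> x\<bar>" for x
        unfolding abs_mult using N[OF J, of x] by (intro mult_right_mono) auto
    qed
    also have "\<dots> = e * (I / (I + 1))" by (simp add: I_def)
    also have "\<dots> < e * 1" using e I by (intro mult_strict_left_mono) auto
    finally show "norm ((\<integral>x. uJ J x * \<theta> x \<partial>lborel) - (\<integral>x. u x * \<theta> x \<partial>lborel)) < e" by simp
  qed
qed

lemma lborel_integral_affine:
  fixes f :: "real^'n \<Rightarrow> real"
  assumes "a > 0" and [measurable]: "f \<in> borel_measurable borel"
  shows "(\<integral>x. f x \<partial>lborel) = a ^ CARD('n) * (\<integral>z. f (t + a *\<^sub>R z) \<partial>lborel)"
proof -
  have "(\<integral>x. f x \<partial>lborel) = (\<integral>x. f x \<partial>density (distr lborel borel (\<lambda>x. t + a *\<^sub>R x)) (\<lambda>_. ennreal (\<bar>a\<bar> ^ DIM(real^'n))))"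
    using lborel_affine[of a t] assms(1) by (simp add: ennreal_power)
  also have "\<dots> = a ^ CARD('n) * (\<integral>z. f (t + a *\<^sub>R z) \<partial>lborel)"
    using assms(1) by (simp add: integral_density integral_distr)
  finally show ?thesis .
qed

context wavelet_system
begin

lemma lev_lipschitz:
  obtains B where "B > 0" "\<And>\<sigma> M c j x y. coef_bound \<sigma> M c \<Longrightarrow> 0 \<le> M \<Longrightarrow>
    \<bar>lev c j x - lev c j y\<bar> \<le> B * M * 2 powr (- real j * \<sigma>) * (2 ^ j * norm (x - y))"
proof -
  obtain B where B: "B > 0" "\<And>\<sigma> M c j x h. coef_bound \<sigma> M c \<Longrightarrow> 0 \<le> M \<Longrightarrow>
    \<bar>diffpow 1 h (lev c j) x\<bar> \<le> B * M * 2 powr (- real j * \<sigma>) * (2 ^ j * norm h) ^ 1"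
    using lev_diffpow_bound[OF L1] by blast
  have "lev c j x - lev c j y = diffpow 1 (x - y) (lev c j) ((1/2) *\<^sub>R (x + y))" for c j x y
  proof -
    have "(1/2) *\<^sub>R (x + y) + (1/2) *\<^sub>R (x - y) = x" "(1/2) *\<^sub>R (x + y) - (1/2) *\<^sub>R (x - y) = y"
      by (simp_all add: algebra_simps flip: scaleR_add_left)
    then show ?thesis by (simp add: diffpow_def diffop_def)
  qed
  then show ?thesis using that[of B] B by simp
qed

definition synth :: "(nat \<times> (nat \<times> (int^'n)) \<Rightarrow> real) \<Rightarrow> real^'n \<Rightarrow> real" where
  "synth c x = (\<Sum>j. lev c j x)"

lemma powr_geometric: "2 powr (- real j * \<sigma>) = (2 powr (- \<sigma>)) ^ j"
  by (simp add: powr_powr mult.commute flip: powr_realpow)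

lemma powr_neg_lt1: "\<sigma> > 0 \<Longrightarrow> 2 powr (- \<sigma>) < (1::real)"
  using powr_less_mono[of "-\<sigma>" 0 2] by simp

lemma synth_uniform_limit:
  assumes "coef_bound \<sigma> M c" "\<sigma> > 0" "M \<ge> 0"
  shows "uniform_limit UNIV (\<lambda>J x. \<Sum>j<J. lev c j x) (synth c) sequentially"
proof -
  obtain B where B: "B > 0" "\<And>\<sigma> M c j x. coef_bound \<sigma> M c \<Longrightarrow> 0 \<le> M \<Longrightarrow> \<bar>lev c j x\<bar> \<le> B * M * 2 powr (- real j * \<sigma>)"
    using lev_bound by blast
  show ?thesis unfolding synth_def[abs_def]
  proof (rule Weierstrass_m_test)
    show "norm (lev c j x) \<le> B * M * (2 powr (- \<sigma>)) ^ j" for j x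
      using B(2)[OF assms(1,3), of j x] unfolding powr_geometric by simp
    show "summable (\<lambda>j. B * M * (2 powr (- \<sigma>)) ^ j)"
      using powr_neg_lt1[OF assms(2)] by (intro summable_mult summable_geometric) simp
  qed
qed

lemma synth_continuous:
  assumes "coef_bound \<sigma> M c" "\<sigma> > 0" "M \<ge> 0"
  shows "continuous_on UNIV (synth c)"
  by (rule uniform_limit_theorem[OF _ synth_uniform_limit[OF assms]])
    (auto intro!: always_eventually continuous_intros lev_continuous)

lemma synth_sums:
  assumes "coef_bound \<sigma> M c" "\<sigma> > 0" "M \<ge> 0"
  shows "(\<lambda>j. lev c j x) sums synth c x"
  using tendsto_uniform_limitI[OF synth_uniform_limit[OF assms], of x] by (simp add: sums_def)

lemma pairing_integrable:
  assumes "continuous_on UNIV f" "\<omega> \<in> Omega"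
  shows "integrable lborel (\<lambda>x. f x * W \<omega> x)"
  by (rule integrable_compact_support[where R="(norm (intvec (snd (snd \<omega>))) + \<rho>0) / 2 ^ lv \<omega>"])
    (use assms W_continuous[OF assms(2)] W_support[OF assms(2)] in \<open>auto intro!: continuous_intros\<close>)

text \<open>On a ball containing the support of \<open>W \<omega>'\<close> the level sum is one
  finite sum, so orthonormality applies term by term.\<close>

lemma lev_coef:
  assumes \<omega>': "\<omega>' \<in> Omega"
  shows "L2inner (lev c j) (W \<omega>') = (if lv \<omega>' = j then c \<omega>' else 0)"
proof -
  define R where "R = (norm (intvec (snd (snd \<omega>'))) + \<rho>0) / 2 ^ lv \<omega>'"
  have lv_mem: "\<omega>' \<in> box_set j R" if "lv \<omega>' = j"
    using \<omega>' that rho0(1) by (auto simp: box_set_def R_def)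
  have "lev c j x * W \<omega>' x = (\<Sum>\<omega>\<in>box_set j R. c \<omega> * (W \<omega> x * W \<omega>' x))" for x
    using lev_box[of x R c j] W_support[OF \<omega>', of x] by (cases "W \<omega>' x = 0") (auto simp: R_def sum_distrib_right mult.assoc)
  then have "L2inner (lev c j) (W \<omega>') = (\<integral>x. (\<Sum>\<omega>\<in>box_set j R. c \<omega> * (W \<omega> x * W \<omega>' x)) \<partial>lborel)"
    by (simp add: L2inner_def)
  also have "\<dots> = (\<Sum>\<omega>\<in>box_set j R. \<integral>x. c \<omega> * (W \<omega> x * W \<omega>' x) \<partial>lborel)"
    by (rule Bochner_Integration.integral_sum)
      (intro integrable_mult_right pairing_integrable W_continuous \<omega>', auto simp: box_set_def)
  also have "\<dots> = (\<Sum>\<omega>\<in>box_set j R. if \<omega> = \<omega>' then c \<omega> else 0)"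
  proof (rule sum.cong[OF refl])
    fix \<omega> assume "\<omega> \<in> box_set j R"
    then have "L2inner (W \<omega>) (W \<omega>') = (if \<omega> = \<omega>' then 1 else 0)"
      using daub \<omega>' by (auto simp: Daubechies_def box_set_def)
    then show "(\<integral>x. c \<omega> * (W \<omega> x * W \<omega>' x) \<partial>lborel) = (if \<omega> = \<omega>' then c \<omega> else 0)"
      by (simp add: L2inner_def)
  qed
  also have "\<dots> = (if lv \<omega>' = j then c \<omega>' else 0)"
    using lv_mem by (auto simp: box_set_finite sum.delta) (auto simp: box_set_def)
  finally show ?thesis .
qed

text \<open>Pairing the partial sums over levels with \<open>W \<omega>\<close> is constant once the
  level of \<open>\<omega>\<close> has been passed; uniform convergence carries this value to the
  limit because \<open>W \<omega>\<close> has compact support.\<close>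

lemma synth_coef:
  assumes c: "coef_bound \<sigma> M c" "\<sigma> > 0" "M \<ge> 0" and \<omega>: "\<omega> \<in> Omega"
  shows "L2inner (synth c) (W \<omega>) = c \<omega>"
proof -
  have "(\<lambda>J. \<integral>x. (\<Sum>j<J. lev c j x) * W \<omega> x \<partial>lborel) \<longlonglongrightarrow> (\<integral>x. synth c x * W \<omega> x \<partial>lborel)"
    by (rule uniform_limit_pairing[OF synth_uniform_limit[OF c]])
      (auto intro!: continuous_intros lev_continuous synth_continuous[OF c] W_continuous \<omega> W_support)
  moreover have "(\<integral>x. (\<Sum>j<J. lev c j x) * W \<omega> x \<partial>lborel) = c \<omega>" if "J > lv \<omega>" for J
  proof -
    have "(\<integral>x. (\<Sum>j<J. lev c j x) * W \<omega> x \<partial>lborel) = (\<Sum>j<J. L2inner (lev c j) (W \<omega>))"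
      unfolding sum_distrib_right L2inner_def
      by (rule Bochner_Integration.integral_sum) (intro pairing_integrable lev_continuous \<omega>)
    then show ?thesis using that by (simp add: lev_coef[OF \<omega>])
  qed
  then have "(\<lambda>J. \<integral>x. (\<Sum>j<J. lev c j x) * W \<omega> x \<partial>lborel) \<longlonglongrightarrow> c \<omega>"
    by (intro tendsto_eventually eventually_sequentiallyI[of "Suc (lv \<omega>)"]) auto
  ultimately show ?thesis unfolding L2inner_def by (rule LIMSEQ_unique)
qed

text \<open>Counting letters turns a word into a multi-index of order \<open>length w\<close>, the
  form in which \<open>Daubechies\<close> states the moments.\<close>

lemma psi_moments:
  assumes "l \<in> {1..<2 ^ CARD('n)}" "length w \<le> L"
  shows "(\<integral>x. prod_list (map (($) x) w) * \<psi> l x \<partial>lborel) = 0"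
proof -
  have "prod_list (map (($) x) w) = (\<Prod>i\<in>UNIV. (x $ i) ^ count_list w i)" for x :: "real^'n"
  proof (induction w)
    case (Cons a w)
    have "(\<Prod>i\<in>UNIV. (x $ i) ^ count_list (a # w) i) = (\<Prod>i\<in>UNIV. (if i = a then x $ i else 1) * (x $ i) ^ count_list w i)"
      by (rule prod.cong) auto
    also have "\<dots> = x $ a * (\<Prod>i\<in>UNIV. (x $ i) ^ count_list w i)"
      by (simp add: prod.distrib)
    finally show ?case using Cons by simp
  qed simp
  moreover have "(\<Sum>i\<in>UNIV. count_list w i) = length w"
    by (rule sum_count_set) auto
  ultimately show ?thesis using daub assms by (auto simp: Daubechies_def)
qed

text \<open>Rescaling the cube of \<open>\<omega>\<close> to unit size reduces this to
  \<open>vanishing_moments_pairing\<close>. The index 0 is excluded because moments are prescribed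
  only for the \<open>\<psi> l\<close>; as these are finitely many, the constants can be made
  uniform.\<close>

lemma coef_local_bound:
  assumes r: "r \<ge> 1" "r - 1 \<le> L"
  obtains C c \<rho> where "C > 0" "c > 0" "c \<le> 1" "\<rho> > 0"
    "\<And>f \<omega> E. continuous_on UNIV f \<Longrightarrow> \<omega> \<in> Omega \<Longrightarrow> fst \<omega> \<noteq> 0 \<Longrightarrow> 0 \<le> E \<Longrightarrow>
      (\<And>x h. norm (2 ^ lv \<omega> *\<^sub>R x - intvec (snd (snd \<omega>))) \<le> \<rho> \<Longrightarrow> c \<le> 2 ^ lv \<omega> * norm h \<Longrightarrow> 2 ^ lv \<omega> * norm h \<le> 1 \<Longrightarrow>
        \<bar>diffpow r h f x\<bar> \<le> E) \<Longrightarrow>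
      \<bar>L2inner f (W \<omega>)\<bar> \<le> C * 2 powr (- real (lv \<omega>) * real CARD('n) / 2) * E"
proof -
  define Ls where "Ls = {1..<(2::nat) ^ CARD('n)}"
  have "(2::nat) ^ 1 \<le> 2 ^ CARD('n)"
    using zero_less_card_finite[where 'a='n] by (intro power_increasing) auto
  then have Ls: "finite Ls" "Ls \<noteq> {}" by (auto simp: Ls_def)
  define Q where "Q l C c \<rho> \<longleftrightarrow> C > 0 \<and> c > 0 \<and> c \<le> 1 \<and> \<rho> > 0 \<and>
      (\<forall>F E. continuous_on UNIV F \<longrightarrow> 0 \<le> E \<longrightarrow>
      (\<forall>x h. norm x \<le> \<rho> \<longrightarrow> c \<le> norm h \<longrightarrow> norm h \<le> 1 \<longrightarrow> \<bar>diffpow r h F x\<bar> \<le> E) \<longrightarrow>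
      \<bar>\<integral>x. F x * \<psi> l x \<partial>lborel\<bar> \<le> C * E)" for l C c \<rho>
  have "\<exists>C c \<rho>. Q l C c \<rho>" if l: "l \<in> Ls" for l
  proof -
    have l': "l < 2 ^ CARD('n)" "l \<noteq> 0" using l by (auto simp: Ls_def)
    have A: "continuous_on UNIV (\<psi> l)" "bounded {x. \<psi> l x \<noteq> 0}"
      using gen_continuous[OF l'(1)] gen_Cc[OF l'(1)] l'(2) by (auto simp: gen_def Cc_def)
    have mom: "(\<integral>x. prod_list (map (($) x) w) * \<psi> l x \<partial>lborel) = 0" if "length w < r" for w
      by (rule psi_moments) (use l r that in \<open>auto simp: Ls_def\<close>)
    show ?thesis
      apply (rule vanishing_moments_pairing[OF r(1) A mom], assumption)
      subgoal for C c \<rho> by (rule exI[of _ C], rule exI[of _ c], rule exI[of _ \<rho>]) (auto simp: Q_def)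
      done
  qed
  then obtain C c \<rho> where CQ: "\<And>l. l \<in> Ls \<Longrightarrow> Q l (C l) (c l) (\<rho> l)" by metis
  then have P: "\<And>l. l \<in> Ls \<Longrightarrow> C l > 0" "\<And>l. l \<in> Ls \<Longrightarrow> c l > 0" "\<And>l. l \<in> Ls \<Longrightarrow> c l \<le> 1" "\<And>l. l \<in> Ls \<Longrightarrow> \<rho> l > 0"
    by (auto simp: Q_def)
  have P5: "\<bar>\<integral>x. F x * \<psi> l x \<partial>lborel\<bar> \<le> C l * E" if "l \<in> Ls" "continuous_on UNIV F" "0 \<le> E"
      "\<forall>x h. norm x \<le> \<rho> l \<longrightarrow> c l \<le> norm h \<longrightarrow> norm h \<le> 1 \<longrightarrow> \<bar>diffpow r h F x\<bar> \<le> E" for l F E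
    using CQ[OF that(1)] that unfolding Q_def by blast
  define C' where "C' = Max (C ` Ls)"
  \<comment> \<open>The least of the lower step bounds enlarges the range of steps on which
    smallness is assumed, so one hypothesis serves every \<open>l\<close>.\<close>
  define c' where "c' = Min (c ` Ls)"
  define \<rho>' where "\<rho>' = Max (\<rho> ` Ls)"
  have le: "C l \<le> C'" "c' \<le> c l" "\<rho> l \<le> \<rho>'" if "l \<in> Ls" for l
    using that Ls by (auto simp: C'_def c'_def \<rho>'_def)
  obtain l0 where l0: "l0 \<in> Ls" using Ls by auto
  show ?thesis
  proof (rule that[of C' c' \<rho>'])
    show "C' > 0" "\<rho>' > 0" using le[OF l0] P(1,4)[OF l0] by linarith+
    show "c' > 0" unfolding c'_def using Ls P(2) by auto
    show "c' \<le> 1" using le(2)[OF l0] P(3)[OF l0] by linarith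
    fix f \<omega> E
    assume f: "continuous_on UNIV f" and \<omega>: "\<omega> \<in> Omega" "fst \<omega> \<noteq> 0" and E0: "0 \<le> E"
      and E: "\<And>x h. norm (2 ^ lv \<omega> *\<^sub>R x - intvec (snd (snd \<omega>))) \<le> \<rho>' \<Longrightarrow> c' \<le> 2 ^ lv \<omega> * norm h \<Longrightarrow> 2 ^ lv \<omega> * norm h \<le> 1 \<Longrightarrow>
        \<bar>diffpow r h f x\<bar> \<le> E"
    define l where "l = fst \<omega>"
    define j where "j = lv \<omega>"
    define k where "k = intvec (snd (snd \<omega>))"
    define a where "a = (1/2::real) ^ j"
    have a: "a > 0" "2 ^ j * a = 1" by (auto simp: a_def power_mult_distrib[symmetric])
    have l: "l \<in> Ls" using \<omega> by (auto simp: l_def Ls_def Omega_def)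
    define F where "F z = f (a *\<^sub>R k + a *\<^sub>R z)" for z
    have F: "continuous_on UNIV F" unfolding F_def
      by (intro continuous_intros continuous_on_compose2[OF f]) auto
    have gl: "gen l = \<psi> l" using \<omega> by (simp add: gen_def l_def)
    have "L2inner f (W \<omega>) = a ^ CARD('n) * (\<integral>z. f (a *\<^sub>R k + a *\<^sub>R z) * W \<omega> (a *\<^sub>R k + a *\<^sub>R z) \<partial>lborel)"
      unfolding L2inner_def
      by (rule lborel_integral_affine[OF a(1)])
        (intro borel_measurable_continuous_onI continuous_intros f W_continuous \<omega>)
    also have "(\<integral>z. f (a *\<^sub>R k + a *\<^sub>R z) * W \<omega> (a *\<^sub>R k + a *\<^sub>R z) \<partial>lborel)
        = (\<integral>z. 2 powr (real j * real CARD('n) / 2) * (F z * \<psi> l z) \<partial>lborel)"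
    proof -
      have "2 ^ j *\<^sub>R (a *\<^sub>R k + a *\<^sub>R z) - k = z" for z
        using a(2) by (simp add: scaleR_add_right)
      then show ?thesis unfolding W_eq[OF \<omega>(1)] F_def
        by (simp add: j_def k_def l_def gl[unfolded l_def] mult_ac)
    qed
    finally have eq: "L2inner f (W \<omega>) = (a ^ CARD('n) * 2 powr (real j * real CARD('n) / 2)) * (\<integral>z. F z * \<psi> l z \<partial>lborel)"
      by simp
    have pw: "a ^ CARD('n) * 2 powr (real j * real CARD('n) / 2) = 2 powr (- real j * real CARD('n) / 2)"
    proof -
      have "a = 2 powr (- real j)" by (simp add: a_def powr_minus powr_realpow power_one_over inverse_eq_divide)
      then have "a ^ CARD('n) = 2 powr (- real j * real CARD('n))"
        by (simp add: powr_powr powr_realpow[symmetric])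
      then show ?thesis by (simp add: powr_add[symmetric])
    qed
    have "\<bar>\<integral>z. F z * \<psi> l z \<partial>lborel\<bar> \<le> C l * E"
    proof (rule P5[OF l F E0], intro allI impI)
      fix x h :: "real^'n" assume xh: "norm x \<le> \<rho> l" "c l \<le> norm h" "norm h \<le> 1"
      have "diffpow r h F x = diffpow r (a *\<^sub>R h) f (a *\<^sub>R x + a *\<^sub>R k)"
        using diffpow_affine[of r h 1 f a "- (a *\<^sub>R k)" x] by (simp add: F_def[abs_def] add.commute)
      also have "\<bar>\<dots>\<bar> \<le> E"
      proof (rule E)
        have 1: "2 ^ j *\<^sub>R (a *\<^sub>R x + a *\<^sub>R k) - k = x" using a(2) by (simp add: scaleR_add_right)
        show "norm (2 ^ lv \<omega> *\<^sub>R (a *\<^sub>R x + a *\<^sub>R k) - intvec (snd (snd \<omega>))) \<le> \<rho>'"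
          using 1 xh(1) le(3)[OF l] by (simp add: j_def[symmetric] k_def[symmetric])
        have "2 ^ j * norm (a *\<^sub>R h) = norm h" using a by (simp add: mult.assoc[symmetric])
        then have "2 ^ lv \<omega> * norm (a *\<^sub>R h) = norm h" by (simp only: j_def)
        then show "c' \<le> 2 ^ lv \<omega> * norm (a *\<^sub>R h)" "2 ^ lv \<omega> * norm (a *\<^sub>R h) \<le> 1"
          using xh le(2)[OF l] by linarith+
      qed
      finally show "\<bar>diffpow r h F x\<bar> \<le> E" .
    qed
    also have "\<dots> \<le> C' * E" using le(1)[OF l] E0 by (rule mult_right_mono)
    finally show "\<bar>L2inner f (W \<omega>)\<bar> \<le> C' * 2 powr (- real (lv \<omega>) * real CARD('n) / 2) * E"
      unfolding eq pw abs_mult by (simp add: j_def mult_ac)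
  qed
qed

text \<open>Order and exponent stay free because two instances are needed: order 1 with exponent 1
  for Lipschitz test functions, and order \<open>r\<close> with exponent \<open>s\<close> for
  elements of \<open>Lambda s\<close>. Scaling coefficients live on level 0 and are controlled by
  the sup bound alone.\<close>

lemma coef_bound_of_smooth:
  assumes r: "r \<ge> 1" "r - 1 \<le> L"
  obtains K where "K > 0" "\<And>f A \<sigma>. continuous_on UNIV f \<Longrightarrow> (\<And>x. \<bar>f x\<bar> \<le> A) \<Longrightarrow> \<sigma> > 0 \<Longrightarrow>
     (\<And>x h. 0 < norm h \<Longrightarrow> norm h \<le> 1 \<Longrightarrow> \<bar>diffpow r h f x\<bar> \<le> A * norm h powr \<sigma>) \<Longrightarrow>
     coef_bound \<sigma> (K * A) (\<lambda>\<omega>. L2inner f (W \<omega>))"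
proof -
  obtain C c \<rho> where C: "C > 0" "c > 0" "c \<le> 1" "\<rho> > 0"
    "\<And>f \<omega> E. continuous_on UNIV f \<Longrightarrow> \<omega> \<in> Omega \<Longrightarrow> fst \<omega> \<noteq> 0 \<Longrightarrow> 0 \<le> E \<Longrightarrow>
      (\<And>x h. norm (2 ^ lv \<omega> *\<^sub>R x - intvec (snd (snd \<omega>))) \<le> \<rho> \<Longrightarrow> c \<le> 2 ^ lv \<omega> * norm h \<Longrightarrow> 2 ^ lv \<omega> * norm h \<le> 1 \<Longrightarrow>
        \<bar>diffpow r h f x\<bar> \<le> E) \<Longrightarrow>
      \<bar>L2inner f (W \<omega>)\<bar> \<le> C * 2 powr (- real (lv \<omega>) * real CARD('n) / 2) * E"
    using coef_local_bound[OF r] by blast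
  define I where "I = (\<integral>x. \<bar>\<phi> x\<bar> \<partial>lborel)"
  have I0: "I \<ge> 0" by (simp add: I_def)
  show ?thesis
  proof (rule that[of "C + I"])
    show "C + I > 0" using C I0 by simp
    fix f :: "real^'n \<Rightarrow> real" and A \<sigma>
    assume f: "continuous_on UNIV f" "\<And>x. \<bar>f x\<bar> \<le> A" and \<sigma>: "\<sigma> > 0"
      and d: "\<And>x h. 0 < norm h \<Longrightarrow> norm h \<le> 1 \<Longrightarrow> \<bar>diffpow r h f x\<bar> \<le> A * norm h powr \<sigma>"
    have A0: "A \<ge> 0" using f(2)[of 0] abs_ge_zero[of "f 0"] by linarith
    show "coef_bound \<sigma> ((C + I) * A) (\<lambda>\<omega>. L2inner f (W \<omega>))"
      unfolding coef_bound_def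
    proof
      fix \<omega> :: "nat \<times> (nat \<times> (int^'n))" assume \<omega>: "\<omega> \<in> Omega"
      show "\<bar>L2inner f (W \<omega>)\<bar> \<le> (C + I) * A * 2 powr (- real (lv \<omega>) * (\<sigma> + real CARD('n) / 2))"
      proof (cases "fst \<omega> = 0")
        case True
        then have j0: "lv \<omega> = 0" using \<omega> by (auto simp: Omega_def)
        have Weq: "W \<omega> x = \<phi> (x - intvec (snd (snd \<omega>)))" for x
          using W_eq[OF \<omega>, of x] True j0 by (simp add: gen_def)
        have "\<bar>L2inner f (W \<omega>)\<bar> \<le> (\<integral>x. A * \<bar>W \<omega> x\<bar> \<partial>lborel)"
          unfolding L2inner_def
        proof (rule order_trans[OF integral_abs_bound integral_mono])
          show "integrable lborel (\<lambda>x. \<bar>f x * W \<omega> x\<bar>)" by (intro integrable_abs pairing_integrable f \<omega>)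
          show "integrable lborel (\<lambda>x. A * \<bar>W \<omega> x\<bar>)"
            using pairing_integrable[OF _ \<omega>, of "\<lambda>_. 1"] by (intro integrable_mult_right integrable_abs) simp
          show "\<bar>f x * W \<omega> x\<bar> \<le> A * \<bar>W \<omega> x\<bar>" for x unfolding abs_mult by (intro mult_right_mono f) auto
        qed
        also have "\<dots> = A * I"
        proof -
          have "(\<integral>x. \<bar>W \<omega> x\<bar> \<partial>lborel) = 1 ^ CARD('n) * (\<integral>z. \<bar>W \<omega> (intvec (snd (snd \<omega>)) + 1 *\<^sub>R z)\<bar> \<partial>lborel)"
            by (rule lborel_integral_affine)
              (auto intro!: borel_measurable_continuous_onI continuous_intros W_continuous \<omega>)
          also have "\<dots> = I" by (simp add: Weq I_def)
          finally show ?thesis by simp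
        qed
        also have "\<dots> \<le> (C + I) * A" using C A0 by (simp add: algebra_simps)
        finally show ?thesis by (simp add: j0)
      next
        case False
        have "\<bar>L2inner f (W \<omega>)\<bar> \<le> C * 2 powr (- real (lv \<omega>) * real CARD('n) / 2) * (A * 2 powr (- real (lv \<omega>) * \<sigma>))"
        proof (rule C(5)[OF f(1) \<omega> False])
          show "0 \<le> A * 2 powr (- real (lv \<omega>) * \<sigma>)" using A0 by simp
          fix x h :: "real^'n"
          assume h: "c \<le> 2 ^ lv \<omega> * norm h" "2 ^ lv \<omega> * norm h \<le> 1"
          have h0: "0 < norm h" using h(1) C(2) by (smt (verit) mult_nonneg_nonpos zero_le_power)
          have hj: "norm h \<le> 2 powr (- real (lv \<omega>))"
            using h(2) by (simp add: powr_minus powr_realpow field_simps)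
          also have "\<dots> \<le> 1" using powr_mono[of "- real (lv \<omega>)" 0 2] by simp
          finally have "\<bar>diffpow r h f x\<bar> \<le> A * norm h powr \<sigma>" by (intro d h0)
          also have "\<dots> \<le> A * (2 powr (- real (lv \<omega>))) powr \<sigma>"
            using A0 hj \<sigma> h0 by (intro mult_left_mono powr_mono2) auto
          finally show "\<bar>diffpow r h f x\<bar> \<le> A * 2 powr (- real (lv \<omega>) * \<sigma>)" by (simp add: powr_powr)
        qed
        also have "\<dots> = C * A * (2 powr (- real (lv \<omega>) * real CARD('n) / 2) * 2 powr (- real (lv \<omega>) * \<sigma>))" by simp
        also have "2 powr (- real (lv \<omega>) * real CARD('n) / 2) * 2 powr (- real (lv \<omega>) * \<sigma>) = 2 powr (- real (lv \<omega>) * (\<sigma> + real CARD('n) / 2))"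
          unfolding powr_add[symmetric] by (simp add: algebra_simps)
        also have "C * A * 2 powr (- real (lv \<omega>) * (\<sigma> + real CARD('n) / 2)) \<le> (C + I) * A * 2 powr (- real (lv \<omega>) * (\<sigma> + real CARD('n) / 2))"
          using A0 I0 by (intro mult_right_mono) auto
        finally show ?thesis .
      qed
    qed
  qed
qed

text \<open>A wavelet with nonzero coefficient must meet the support of \<open>\<theta>\<close>, and
  its own support has diameter at most \<open>2 * \<rho>0\<close>. The series thus stays in one
  ball; the error \<open>\<theta> - synth c\<close> is continuous with compact support, hence in
  \<open>L2\<close>, and completeness makes it vanish.\<close>

lemma lipschitz_expansion:
  assumes \<theta>: "continuous_on UNIV \<theta>" "\<And>x. \<bar>\<theta> x\<bar> \<le> A" "\<And>x y. \<bar>\<theta> x - \<theta> y\<bar> \<le> A * norm (x - y)"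
    and supp: "\<And>x. \<theta> x \<noteq> 0 \<Longrightarrow> norm x \<le> R"
  defines "c \<equiv> \<lambda>\<omega>. L2inner \<theta> (W \<omega>)"
  obtains M where "M \<ge> 0" "coef_bound 1 M c" "synth c = \<theta>"
    "\<And>\<omega> x. \<omega> \<in> Omega \<Longrightarrow> c \<omega> * W \<omega> x \<noteq> 0 \<Longrightarrow> norm x \<le> R + 2 * \<rho>0"
proof -
  have one: "1 - 1 \<le> L" by simp
  obtain K where K: "K > 0" "\<And>f A \<sigma>. continuous_on UNIV f \<Longrightarrow> (\<And>x. \<bar>f x\<bar> \<le> A) \<Longrightarrow> \<sigma> > 0 \<Longrightarrow>
     (\<And>x h. 0 < norm h \<Longrightarrow> norm h \<le> 1 \<Longrightarrow> \<bar>diffpow 1 h f x\<bar> \<le> A * norm h powr \<sigma>) \<Longrightarrow>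
     coef_bound \<sigma> (K * A) (\<lambda>\<omega>. L2inner f (W \<omega>))"
    using coef_bound_of_smooth[OF order_refl one] by blast
  have A0: "A \<ge> 0" using \<theta>(2)[of 0] abs_ge_zero[of "\<theta> 0"] by linarith
  have cb: "coef_bound 1 (K * A) c" unfolding c_def
  proof (rule K(2)[OF \<theta>(1,2)])
    fix x h :: "real^'n" assume "0 < norm h"
    then show "\<bar>diffpow 1 h \<theta> x\<bar> \<le> A * norm h powr 1"
      using \<theta>(3)[of "x + (1/2) *\<^sub>R h" "x - (1/2) *\<^sub>R h"]
      by (simp add: diffpow_def diffop_def flip: scaleR_add_left)
  qed simp
  have KA: "K * A \<ge> 0" using K A0 by simp
  have csupp: "norm x \<le> R + 2 * \<rho>0" if \<omega>: "\<omega> \<in> Omega" "c \<omega> * W \<omega> x \<noteq> 0" for \<omega> x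
  proof -
    define j where "j = lv \<omega>"
    obtain y where y: "\<theta> y \<noteq> 0" "W \<omega> y \<noteq> 0"
    proof (rule ccontr)
      assume "\<not> thesis"
      then have "\<theta> y * W \<omega> y = 0" for y using that by auto
      then have "L2inner \<theta> (W \<omega>) = 0" unfolding L2inner_def by (simp only:) simp
      then show False using \<omega>(2) by (simp add: c_def)
    qed
    have 1: "norm (2 ^ j *\<^sub>R x - intvec (snd (snd \<omega>))) \<le> \<rho>0" using W_near[OF \<omega>(1), of x] \<omega>(2) by (simp add: near_def j_def)
    have 2: "norm (2 ^ j *\<^sub>R y - intvec (snd (snd \<omega>))) \<le> \<rho>0" using W_near[OF \<omega>(1) y(2)] by (simp add: near_def j_def)
    have "norm (2 ^ j *\<^sub>R (x - y)) \<le> 2 * \<rho>0"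
      using norm_triangle_ineq4[of "2 ^ j *\<^sub>R x - intvec (snd (snd \<omega>))" "2 ^ j *\<^sub>R y - intvec (snd (snd \<omega>))"] 1 2
      by (simp add: scaleR_diff_right)
    then have 3: "2 ^ j * norm (x - y) \<le> 2 * \<rho>0" by simp
    have "1 * norm (x - y) \<le> 2 ^ j * norm (x - y)" by (intro mult_right_mono) auto
    then have "norm (x - y) \<le> 2 * \<rho>0" using 3 by linarith
    then show ?thesis using supp[OF y(1)] norm_triangle_ineq[of "x - y" y] by simp
  qed
  have lsupp: "norm x \<le> R + 2 * \<rho>0" if nz: "lev c j x \<noteq> 0" for j x
  proof -
    obtain \<omega> where \<omega>: "\<omega> \<in> near j x" "c \<omega> * W \<omega> x \<noteq> 0"
      using nz unfolding lev_def by (rule sum.not_neutral_contains_not_neutral)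
    then show ?thesis using csupp[of \<omega> x] by (simp add: near_def)
  qed
  define g where "g x = \<theta> x - synth c x" for x
  have cs: "continuous_on UNIV (synth c)" by (rule synth_continuous[OF cb _ KA]) simp
  have cg: "continuous_on UNIV g" unfolding g_def by (intro continuous_intros \<theta> cs)
  have gs: "norm x \<le> R + 2 * \<rho>0" if "g x \<noteq> 0" for x
  proof (cases "\<theta> x = 0")
    case False
    then show ?thesis using supp[OF False] rho0(1) by linarith
  next
    case True
    have "\<exists>j. lev c j x \<noteq> 0"
    proof (rule ccontr)
      assume "\<not> ?thesis"
      then have "synth c x = 0" by (simp add: synth_def)
      then show False using True that by (simp add: g_def)
    qed
    then show ?thesis using lsupp by blast
  qed
  have "g \<in> L2" unfolding L2_def
  proof safe
    show "g \<in> borel_measurable lborel" using borel_measurable_continuous_onI[OF cg] by simp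
    show "integrable lborel (\<lambda>x. (g x)\<^sup>2)"
      by (rule integrable_compact_support[where R="R + 2 * \<rho>0"]) (auto intro!: continuous_intros cg gs)
  qed
  moreover have "L2inner g (W \<omega>) = 0" if "\<omega> \<in> Omega" for \<omega>
  proof -
    have "L2inner g (W \<omega>) = L2inner \<theta> (W \<omega>) - L2inner (synth c) (W \<omega>)"
      unfolding L2inner_def g_def left_diff_distrib
      by (rule Bochner_Integration.integral_diff) (intro pairing_integrable that \<theta> cs)+
    then show ?thesis using synth_coef[OF cb _ KA that] by (simp add: c_def)
  qed
  ultimately have "AE x in lborel. g x = 0" using daub unfolding Daubechies_def by blast
  from continuous_AE_zero[OF cg this] have "synth c = \<theta>" by (auto simp: g_def fun_eq_iff)
  then show ?thesis using that[OF KA cb] csupp by blast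
qed

text \<open>A bounded function need not be in \<^const>\<open>L2\<close>, so completeness of the system is not directly
  applicable. It is applied to Lipschitz test functions with compact support instead, whose
  wavelet series converge uniformly with common compact support.\<close>
lemma zero_coef_imp_zero:
  assumes h: "continuous_on UNIV h" and z: "\<And>\<omega>. \<omega> \<in> Omega \<Longrightarrow> L2inner h (W \<omega>) = 0"
  shows "h x0 = 0"
proof (rule ccontr)
  assume nz: "h x0 \<noteq> 0"
  have "isCont h x0" using h by (simp add: continuous_on_eq_continuous_at)
  then obtain \<delta> where \<delta>: "\<delta> > 0" "\<And>x. dist x x0 < \<delta> \<Longrightarrow> dist (h x) (h x0) < \<bar>h x0\<bar>"
    unfolding continuous_at_eps_delta using nz by (meson zero_less_abs_iff)
  \<comment> \<open>A tent supported where \<open>h\<close> keeps the sign it has at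
    \<open>x0\<close>.\<close>
  define \<theta> where "\<theta> x = max 0 (1 - norm (x - x0) / \<delta>)" for x
  define A where "A = max 1 (1 / \<delta>)"
  have \<theta>c: "continuous_on UNIV \<theta>" unfolding \<theta>_def by (intro continuous_intros) (use \<delta> in auto)
  have \<theta>b: "\<bar>\<theta> x\<bar> \<le> A" for x
  proof -
    have "norm (x - x0) / \<delta> \<ge> 0" using \<delta> by simp
    then have "\<bar>\<theta> x\<bar> \<le> 1" by (simp add: \<theta>_def)
    then show ?thesis by (simp add: A_def)
  qed
  have \<theta>l: "\<bar>\<theta> x - \<theta> y\<bar> \<le> A * norm (x - y)" for x y
  proof -
    have "\<bar>\<theta> x - \<theta> y\<bar> \<le> \<bar>norm (x - x0) / \<delta> - norm (y - x0) / \<delta>\<bar>" by (auto simp: \<theta>_def max_def)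
    also have "\<dots> = \<bar>norm (x - x0) - norm (y - x0)\<bar> / \<delta>" using \<delta> by (simp add: diff_divide_distrib[symmetric])
    also have "\<dots> \<le> norm (x - y) / \<delta>"
      using \<delta> norm_triangle_ineq3[of "x - x0" "y - x0"] by (intro divide_right_mono) auto
    also have "\<dots> = 1 / \<delta> * norm (x - y)" by simp
    also have "\<dots> \<le> A * norm (x - y)" by (intro mult_right_mono) (auto simp: A_def)
    finally show ?thesis .
  qed
  have \<theta>s: "dist x x0 < \<delta>" if "\<theta> x \<noteq> 0" for x
    using that \<delta> by (auto simp: \<theta>_def max_def dist_norm field_simps split: if_splits)
  have \<theta>s': "norm x \<le> norm x0 + \<delta>" if "\<theta> x \<noteq> 0" for x
    using \<theta>s[OF that] norm_triangle_ineq[of "x - x0" x0] by (simp add: dist_norm)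
  define c where "c = (\<lambda>\<omega>. L2inner \<theta> (W \<omega>))"
  define R where "R = norm x0 + \<delta> + 2 * \<rho>0"
  obtain M where M: "M \<ge> 0" "coef_bound 1 M c" "synth c = \<theta>"
    "\<And>\<omega> x. \<omega> \<in> Omega \<Longrightarrow> c \<omega> * W \<omega> x \<noteq> 0 \<Longrightarrow> norm x \<le> R"
    unfolding c_def R_def using lipschitz_expansion[OF \<theta>c \<theta>b \<theta>l \<theta>s'] by blast
  have lev_eq: "lev c j x = (\<Sum>\<omega>\<in>box_set j R. c \<omega> * W \<omega> x)" for j x
  proof (cases "norm x \<le> R")
    case False
    then have "c \<omega> * W \<omega> x = 0" if "\<omega> \<in> Omega" for \<omega> using M(4)[OF that, of x] by auto
    then have "lev c j x = 0" "(\<Sum>\<omega>\<in>box_set j R. c \<omega> * W \<omega> x) = 0"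
      unfolding lev_def by (auto intro!: sum.neutral simp: near_def box_set_def)
    then show ?thesis by simp
  qed (rule lev_box)
  have lsupp: "norm x \<le> R" if nz: "lev c j x \<noteq> 0" for j x
  proof -
    obtain \<omega> where \<omega>: "\<omega> \<in> near j x" "c \<omega> * W \<omega> x \<noteq> 0"
      using nz unfolding lev_def by (rule sum.not_neutral_contains_not_neutral)
    then show ?thesis using M(4)[of \<omega> x] by (simp add: near_def)
  qed
  \<comment> \<open>Equal to 1 wherever a level sum of \<open>c\<close> is nonzero, so inserting it
    changes no integral against such a sum, while \<open>h x * cut x\<close> becomes compactly
    supported as \<open>uniform_limit_pairing\<close> requires.\<close>
  define cut where "cut x = max 0 (min 1 (R + 1 - norm x))" for x :: "real^'n"
  have cut1: "cut x = 1" if "norm x \<le> R" for x using that by (simp add: cut_def)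
  have "(\<lambda>J. \<integral>x. (\<Sum>j<J. lev c j x) * (h x * cut x) \<partial>lborel) \<longlonglongrightarrow> (\<integral>x. synth c x * (h x * cut x) \<partial>lborel)"
  proof (rule uniform_limit_pairing[OF synth_uniform_limit[OF M(2) _ M(1)], where R="R + 1"])
    show "continuous_on UNIV (\<lambda>x. h x * cut x)" unfolding cut_def by (intro continuous_intros h)
    show "norm x \<le> R + 1" if "h x * cut x \<noteq> 0" for x using that by (auto simp: cut_def max_def min_def split: if_splits)
  qed (auto intro!: continuous_intros lev_continuous synth_continuous[OF M(2) _ M(1)])
  moreover have "(\<integral>x. (\<Sum>j<J. lev c j x) * (h x * cut x) \<partial>lborel) = 0" for J
  proof -
    have 2: "lev c j x * (h x * cut x) = h x * lev c j x" for j x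
      using lsupp[of j x] cut1[of x] by (cases "lev c j x = 0") auto
    have "L2inner h (lev c j) = 0" for j
    proof -
      have "L2inner h (lev c j) = (\<integral>x. (\<Sum>\<omega>\<in>box_set j R. c \<omega> * (h x * W \<omega> x)) \<partial>lborel)"
        unfolding L2inner_def lev_eq by (simp add: sum_distrib_left mult_ac)
      also have "\<dots> = (\<Sum>\<omega>\<in>box_set j R. \<integral>x. c \<omega> * (h x * W \<omega> x) \<partial>lborel)"
        by (rule Bochner_Integration.integral_sum)
          (intro integrable_mult_right pairing_integrable h, auto simp: box_set_def)
      also have "\<dots> = 0" using z by (intro sum.neutral) (auto simp: L2inner_def box_set_def)
      finally show ?thesis .
    qed
    moreover have "(\<integral>x. (\<Sum>j<J. lev c j x) * (h x * cut x) \<partial>lborel) = (\<Sum>j<J. L2inner h (lev c j))"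
      unfolding sum_distrib_right 2 L2inner_def
      by (rule Bochner_Integration.integral_sum)
        (rule integrable_compact_support[where R=R], auto intro!: continuous_intros h lev_continuous lsupp)
    ultimately show ?thesis by simp
  qed
  ultimately have "(\<integral>x. synth c x * (h x * cut x) \<partial>lborel) = 0" by (simp add: LIMSEQ_const_iff)
  moreover have "synth c x * (h x * cut x) = h x * \<theta> x" for x
  proof -
    have "\<theta> x \<noteq> 0 \<Longrightarrow> cut x = 1" using \<theta>s'[of x] rho0(1) by (intro cut1) (simp add: R_def)
    then show ?thesis unfolding M(3) by (cases "\<theta> x = 0") auto
  qed
  ultimately have i0: "(\<integral>x. h x * \<theta> x \<partial>lborel) = 0" by simp
  \<comment> \<open>The sign makes the integrand nonnegative, so a vanishing integral forces it to
    vanish almost everywhere and then everywhere, by continuity.\<close>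
  define u where "u x = sgn (h x0) * (h x * \<theta> x)" for x
  have cu: "continuous_on UNIV u" unfolding u_def by (intro continuous_intros h \<theta>c)
  have u0: "u x \<ge> 0" for x
  proof (cases "\<theta> x = 0")
    case False
    have "0 \<le> sgn (h x0) * h x"
      using \<delta>(2)[OF \<theta>s[OF False]] by (auto simp: dist_real_def sgn_if abs_if split: if_splits)
    moreover have "\<theta> x \<ge> 0" by (simp add: \<theta>_def)
    ultimately show ?thesis unfolding u_def by (simp add: mult.assoc[symmetric])
  qed (simp add: u_def)
  have "integrable lborel u"
    by (rule integrable_compact_support[OF cu, where R="norm x0 + \<delta>"]) (auto simp: u_def intro: \<theta>s')
  moreover have "(\<integral>x. u x \<partial>lborel) = 0" unfolding u_def using i0 by simp
  ultimately have "AE x in lborel. u x = 0"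
    using integral_nonneg_eq_0_iff_AE[of lborel u] u0 by simp
  from continuous_AE_zero[OF cu this, of x0] show False
    using nz by (simp add: u_def \<theta>_def sgn_if split: if_splits)
qed

end

section \<open>Differences of wavelet series\<close>

definition gap :: "nat \<Rightarrow> nat \<Rightarrow> nat" where "gap j J = (if j \<le> J then J - j else j - J)"

lemma sum_gap_power:
  assumes "0 < q" "q < (1::real)"
  shows "(\<Sum>j<N. q ^ gap j J) \<le> 2 / (1 - q)"
proof -
  have geo: "(\<Sum>d<m. q ^ d) \<le> 1 / (1 - q)" for m
    using sum_le_suminf[of "\<lambda>d. q ^ d" "{..<m}"] assms suminf_geometric[of q] by (simp add: summable_geometric)
  have "(\<Sum>j<N. q ^ gap j J) \<le> (\<Sum>j<J + N. q ^ gap j J)"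
    using assms by (intro sum_mono2) auto
  also have "\<dots> = (\<Sum>j<J. q ^ gap j J) + (\<Sum>j<N. q ^ gap (J + j) J)"
    by (induction N) (auto simp: add.assoc)
  also have "(\<Sum>j<N. q ^ gap (J + j) J) = (\<Sum>j<N. q ^ j)"
    by (intro sum.cong) (auto simp: gap_def)
  also have "(\<Sum>j<J. q ^ gap j J) = (\<Sum>j<J. q ^ (J - j))"
    by (intro sum.cong) (auto simp: gap_def)
  also have "\<dots> \<le> (\<Sum>j<J. q ^ (J - Suc j))"
    using assms by (intro sum_mono power_decreasing) auto
  also have "\<dots> = (\<Sum>j<J. q ^ j)" by (rule sum.nat_diff_reindex)
  finally show ?thesis using geo[of J] geo[of N] by (simp add: add_divide_distrib[symmetric])
qed

text \<open>The terms far from \<^term>\<open>J\<close> are absorbed by splitting the geometric factor into two square roots.\<close>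
lemma two_sided_sum:
  fixes a :: "nat \<Rightarrow> real"
  assumes q: "0 < q" "q < 1" and S: "a sums S" and A: "A \<ge> 0" and b: "b \<ge> 0"
    and aA: "\<And>j. \<bar>a j\<bar> \<le> A * q ^ gap j J" and ab: "\<And>j. gap j J \<le> m \<Longrightarrow> \<bar>a j\<bar> \<le> b"
  shows "\<bar>S\<bar> \<le> real (2 * m + 1) * b + A * (sqrt q ^ m * (2 / (1 - sqrt q)))"
proof -
  define p where "p = sqrt q"
  have p: "0 < p" "p < 1" "q = p * p" using q by (auto simp: p_def)
  have le: "\<bar>a j\<bar> \<le> (if gap j J \<le> m then b else 0) + A * p ^ m * p ^ gap j J" for j
  proof (cases "gap j J \<le> m")
    case True
    have "0 \<le> A * p ^ m * p ^ gap j J" using A p by simp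
    then show ?thesis using ab[OF True] True by simp
  next
    case False
    have "p ^ gap j J \<le> p ^ m" using p False by (intro power_decreasing) auto
    then have "q ^ gap j J \<le> p ^ m * p ^ gap j J"
      unfolding p(3) power_mult_distrib using p by (intro mult_right_mono) auto
    then have "A * q ^ gap j J \<le> A * (p ^ m * p ^ gap j J)" using A by (rule mult_left_mono)
    then show ?thesis using aA[of j] False by simp
  qed
  have card: "card {j \<in> {..<N}. gap j J \<le> m} \<le> 2 * m + 1" for N
  proof -
    have "card {j \<in> {..<N}. gap j J \<le> m} \<le> card {J - m..J + m}"
      by (intro card_mono) (auto simp: gap_def split: if_splits)
    then show ?thesis by simp
  qed
  have "\<bar>\<Sum>j<N. a j\<bar> \<le> real (2 * m + 1) * b + A * (p ^ m * (2 / (1 - p)))" for N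
  proof -
    have "\<bar>\<Sum>j<N. a j\<bar> \<le> (\<Sum>j<N. (if gap j J \<le> m then b else 0) + A * p ^ m * p ^ gap j J)"
      by (intro order_trans[OF sum_abs] sum_mono le)
    also have "\<dots> = real (card {j \<in> {..<N}. gap j J \<le> m}) * b + A * p ^ m * (\<Sum>j<N. p ^ gap j J)"
      by (simp add: sum.distrib sum_distrib_left sum.If_cases Int_def)
    also have "\<dots> \<le> real (2 * m + 1) * b + A * p ^ m * (2 / (1 - p))"
      using card[of N] b A p sum_gap_power[OF p(1,2), where N=N and J=J]
      by (intro add_mono mult_right_mono mult_left_mono) (auto simp del: of_nat_add of_nat_mult)
    finally show ?thesis by (simp add: mult.assoc)
  qed
  moreover have "(\<lambda>N. \<bar>\<Sum>j<N. a j\<bar>) \<longlonglongrightarrow> \<bar>S\<bar>" using S unfolding sums_def by (rule tendsto_rabs)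
  ultimately show ?thesis unfolding p_def by (intro LIMSEQ_le_const2) auto
qed

section \<open>Dyadic scales and the norm of \<open>Lambda s\<close>\<close>

lemma dyadic_scale:
  fixes y :: real
  assumes "0 < y" "y \<le> 1"
  obtains J :: nat where "(1/2) ^ (J + 1) < y" "y \<le> (1/2) ^ J"
proof -
  obtain N where N: "(1/2::real) ^ N < y" using real_arch_pow_inv[of y "1/2"] assms by auto
  define J where "J = (LEAST N. (1/2::real) ^ N < y)"
  have J: "(1/2::real) ^ J < y" unfolding J_def by (rule LeastI[of _ N]) (rule N)
  have "J \<noteq> 0" using J assms by (intro notI) simp
  then obtain J' where J': "J = Suc J'" by (cases J) auto
  have "\<not> (1/2::real) ^ J' < y" using not_less_Least[of J' "\<lambda>N. (1/2::real) ^ N < y"] J' by (simp add: J_def)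
  then show ?thesis using that[of J'] J J' by simp
qed

text \<open>A strict lower bound for a supremum is witnessed by one step, so the supremum in
  \<open>Delta\<close> never has to be attained and later arguments can work with a single
  \<open>h\<close>.\<close>

lemma Delta_less_iff:
  fixes f :: "real^'n \<Rightarrow> real"
  assumes "y > 0"
  shows "ereal \<epsilon> < Delta r f x y / ereal (y powr s) \<longleftrightarrow> (\<exists>h. norm h = y \<and> \<epsilon> * y powr s < \<bar>diffpow r h f x\<bar>)"
proof -
  have p: "y powr s > 0" using assms by simp
  have "ereal \<epsilon> < Delta r f x y / ereal (y powr s) \<longleftrightarrow> ereal (\<epsilon> * y powr s) < Delta r f x y"
    using p by (simp add: ereal_less_divide_pos mult.commute)
  also have "\<dots> \<longleftrightarrow> (\<exists>h. norm h = y \<and> \<epsilon> * y powr s < \<bar>diffpow r h f x\<bar>)"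
    unfolding Delta_def less_SUP_iff by auto
  finally show ?thesis .
qed

lemma Delta_le_iff:
  fixes f :: "real^'n \<Rightarrow> real"
  assumes "y > 0"
  shows "Delta r f x y / ereal (y powr s) \<le> ereal \<epsilon> \<longleftrightarrow> (\<forall>h. norm h = y \<longrightarrow> \<bar>diffpow r h f x\<bar> \<le> \<epsilon> * y powr s)"
  using Delta_less_iff[OF assms, of \<epsilon> r f x s] by (auto simp: not_less[symmetric])

lemma Lambda_norm_le:
  fixes f :: "real^'n \<Rightarrow> real"
  assumes "\<And>x. \<bar>f x\<bar> \<le> A"
    "\<And>x h. 0 < norm h \<Longrightarrow> norm h \<le> 1 \<Longrightarrow> \<bar>diffpow (nat \<lfloor>s\<rfloor> + 1) h f x\<bar> \<le> B * norm h powr s"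
  shows "Lambda_norm s f \<le> ereal (A + B)"
proof -
  have "(SUP x. ereal \<bar>f x\<bar>) \<le> ereal A" by (intro SUP_least) (simp add: assms)
  moreover have "(SUP p\<in>(UNIV :: (real^'n) set) \<times> {0<..1}. Delta (nat \<lfloor>s\<rfloor> + 1) f (fst p) (snd p) / ereal (snd p powr s)) \<le> ereal B"
    by (intro SUP_least) (use assms(2) in \<open>auto simp: Delta_le_iff\<close>)
  ultimately show ?thesis unfolding Lambda_norm_def plus_ereal.simps(1)[symmetric] by (rule add_mono)
qed

lemma Delta_nonneg:
  fixes f :: "real^'n \<Rightarrow> real"
  assumes "y > 0"
  shows "0 \<le> Delta r f x y"
proof -
  obtain h :: "real^'n" where "norm h = y" using vector_choose_size[of y] assms by auto
  then have "ereal \<bar>diffpow r h f x\<bar> \<le> Delta r f x y" unfolding Delta_def by (intro SUP_upper) auto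
  then show ?thesis by (meson abs_ge_zero ereal_less_eq(5) order_trans)
qed

lemma Lambda_norm_bounds:
  fixes f :: "real^'n \<Rightarrow> real"
  assumes "Lambda_norm s f \<le> ereal M"
  shows "\<bar>f x\<bar> \<le> M" "0 < norm h \<Longrightarrow> norm h \<le> 1 \<Longrightarrow> \<bar>diffpow (nat \<lfloor>s\<rfloor> + 1) h f x\<bar> \<le> M * norm h powr s"
proof -
  define P where "P = (SUP x. ereal \<bar>f x\<bar>)"
  define Q where "Q = (SUP p\<in>(UNIV :: (real^'n) set) \<times> {0<..1}. Delta (nat \<lfloor>s\<rfloor> + 1) f (fst p) (snd p) / ereal (snd p powr s))"
  have P0: "0 \<le> P" unfolding P_def by (rule SUP_upper2[of 0]) auto
  have Q0: "0 \<le> Q" unfolding Q_def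
    by (rule SUP_upper2[of "(0, 1)"]) (auto simp: Delta_nonneg)
  have "P + Q \<le> ereal M" using assms by (simp add: Lambda_norm_def P_def Q_def)
  then have PM: "P \<le> ereal M" and QM: "Q \<le> ereal M"
    using add_mono[OF order_refl Q0, of P] add_mono[OF P0 order_refl, of Q] by auto
  have "ereal \<bar>f x\<bar> \<le> P" unfolding P_def by (rule SUP_upper) simp
  then show "\<bar>f x\<bar> \<le> M" using PM order_trans by fastforce
  assume h: "0 < norm h" "norm h \<le> 1"
  have "Delta (nat \<lfloor>s\<rfloor> + 1) f x (norm h) / ereal (norm h powr s) \<le> Q"
    unfolding Q_def by (rule SUP_upper2[of "(x, norm h)"]) (use h in auto)
  then have "Delta (nat \<lfloor>s\<rfloor> + 1) f x (norm h) / ereal (norm h powr s) \<le> ereal M" using QM by (rule order_trans)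
  then show "\<bar>diffpow (nat \<lfloor>s\<rfloor> + 1) h f x\<bar> \<le> M * norm h powr s" using h by (simp add: Delta_le_iff)
qed

lemma Lambda_norm_real:
  assumes "Lambda_norm s f < \<infinity>"
  obtains M where "M \<ge> 0" "Lambda_norm s f = ereal M"
proof -
  have "0 \<le> (SUP x. ereal \<bar>f x\<bar>)" by (rule SUP_upper2[of 0]) auto
  moreover have "0 \<le> (SUP p\<in>(UNIV :: (real^'a) set) \<times> {0<..1}. Delta (nat \<lfloor>s\<rfloor> + 1) f (fst p) (snd p) / ereal (snd p powr s))"
    by (rule SUP_upper2[of "(0, 1)"]) (auto simp: Delta_nonneg)
  ultimately have "0 \<le> Lambda_norm s f" unfolding Lambda_norm_def by simp
  then show ?thesis using assms that by (cases "Lambda_norm s f") auto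
qed

locale smooth_wavelets = wavelet_system L \<phi> \<psi>
  for L :: nat and \<phi> :: "real^'n \<Rightarrow> real" and \<psi> :: "nat \<Rightarrow> real^'n \<Rightarrow> real" +
  fixes s :: real and r :: nat
  assumes s0: "0 < s" and sL: "s < real L" and sr: "s < real r" and rL: "r - 1 \<le> L"
begin

text \<open>The order of differences in the norm of \<open>Lambda s\<close>. It exceeds
  \<open>s\<close>, which gives decay towards coarse levels, and is at most \<open>L\<close>,
  whereas \<open>r\<close> may be \<open>L + 1\<close>.\<close>

definition ks :: nat where "ks = nat \<lfloor>s\<rfloor> + 1"

lemma ks: "s < real ks" "ks \<le> L" "ks \<le> r" "ks \<ge> 1"
proof -
  have "\<lfloor>s\<rfloor> \<ge> 0" using s0 by simp
  moreover have "\<lfloor>s\<rfloor> < int L" "\<lfloor>s\<rfloor> < int r" using sL sr by (simp_all add: floor_less_iff)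
  ultimately show "ks \<le> L" "ks \<le> r" "ks \<ge> 1" unfolding ks_def by linarith+
  show "s < real ks" unfolding ks_def using s0 by linarith
qed

lemma r1: "r \<ge> 1" using sr s0 by (cases r) auto

text \<open>Relative to the scale of the step, finer levels decay with exponent \<open>s\<close> by
  size alone and coarser ones with exponent \<open>ks - s\<close> by smoothness; the worse of the
  two rates is used on both sides.\<close>

definition qs :: real where "qs = 2 powr (- min s (real ks - s))"

lemma qs: "0 < qs" "qs < 1"
proof -
  have "min s (real ks - s) > 0" using s0 ks by simp
  then show "0 < qs" "qs < 1" unfolding qs_def using powr_neg_lt1 by auto
qed

text \<open>The range of \<open>y\<close> is wider than the dyadic strip of \<open>J\<close> by a
  factor 2 at either end, so that a slightly perturbed step may be measured against the same
  \<open>J\<close>.\<close>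

lemma level_decay:
  assumes y: "0 < y" "(1/2) ^ (J + 2) < y" "y \<le> 2 * (1/2) ^ J"
  shows "2 powr (- real j * s) * min 1 ((2 ^ j * y) ^ ks) \<le> 4 powr real ks * y powr s * qs ^ gap j J"
proof (cases "j \<le> J")
  case False
  then have g: "gap j J = j - J" by (simp add: gap_def)
  have "2 powr (- real J) \<le> 4 * y" using y(2) by (simp add: powr_minus powr_realpow field_simps)
  then have "(2 powr (- real J)) powr s \<le> (4 * y) powr s" using s0 by (intro powr_mono2) auto
  also have "\<dots> = 4 powr s * y powr s" using y by (simp add: powr_mult)
  also have "\<dots> \<le> 4 powr real ks * y powr s" using ks(1) by (intro mult_right_mono powr_mono) auto
  finally have 1: "2 powr (- real J * s) \<le> 4 powr real ks * y powr s" by (simp add: powr_powr)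
  have "2 powr (- real (j - J) * s) \<le> qs ^ (j - J)"
  proof -
    have "qs ^ (j - J) = 2 powr (- real (j - J) * min s (real ks - s))"
      unfolding qs_def by (simp add: powr_geometric[symmetric])
    then show ?thesis by (simp add: mult_left_mono)
  qed
  then have "2 powr (- real J * s) * 2 powr (- real (j - J) * s) \<le> (4 powr real ks * y powr s) * qs ^ (j - J)"
    using 1 by (intro mult_mono) auto
  moreover have "2 powr (- real J * s) * 2 powr (- real (j - J) * s) = 2 powr (- real j * s)"
    using False by (simp add: powr_add[symmetric] algebra_simps of_nat_diff)
  moreover have "2 powr (- real j * s) * min 1 ((2 ^ j * y) ^ ks) \<le> 2 powr (- real j * s) * 1"
    by (intro mult_left_mono) auto
  ultimately show ?thesis unfolding g by linarith
next
  case True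
  then have g: "gap j J = J - j" by (simp add: gap_def)
  define t where "t = 2 ^ j * y"
  have t: "t > 0" using y by (simp add: t_def)
  have "t \<le> 2 ^ j * (2 * (1/2) ^ J)" unfolding t_def using y by (intro mult_left_mono) auto
  also have "\<dots> = 2 * 2 powr (- real (J - j))"
  proof -
    obtain d where "J = j + d" using True le_Suc_ex by blast
    then show ?thesis by (simp add: power_add power_one_over powr_minus powr_realpow inverse_eq_divide)
  qed
  finally have t2: "t \<le> 2 * 2 powr (- real (J - j))" .
  have "t powr (real ks - s) \<le> (2 * 2 powr (- real (J - j))) powr (real ks - s)"
    using t t2 ks by (intro powr_mono2) auto
  also have "\<dots> = 2 powr (real ks - s) * 2 powr (- real (J - j) * (real ks - s))" by (simp add: powr_mult powr_powr)
  also have "\<dots> \<le> 4 powr real ks * qs ^ (J - j)"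
  proof (intro mult_mono)
    have "2 powr (real ks - s) \<le> 2 powr real ks" using s0 by (intro powr_mono) auto
    also have "\<dots> \<le> 4 powr real ks" by (intro powr_mono2) auto
    finally show "2 powr (real ks - s) \<le> 4 powr real ks" .
    have "qs ^ (J - j) = 2 powr (- real (J - j) * min s (real ks - s))"
      unfolding qs_def by (simp add: powr_geometric[symmetric])
    then show "2 powr (- real (J - j) * (real ks - s)) \<le> qs ^ (J - j)" by (simp add: mult_left_mono)
  qed auto
  finally have 1: "t powr (real ks - s) \<le> 4 powr real ks * qs ^ (J - j)" .
  have "2 powr (- real j * s) * t ^ ks = y powr s * t powr (real ks - s)"
  proof -
    have "t ^ ks = t powr s * t powr (real ks - s)" using t by (simp add: powr_add[symmetric] powr_realpow)
    moreover have "t powr s = 2 powr (real j * s) * y powr s" using y by (simp add: t_def powr_mult powr_realpow[symmetric] powr_powr)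
    moreover have "2 powr (- real j * s) * 2 powr (real j * s) = 1" by (simp add: powr_add[symmetric])
    ultimately show ?thesis by simp
  qed
  also have "\<dots> \<le> y powr s * (4 powr real ks * qs ^ (J - j))" using 1 by (intro mult_left_mono) auto
  finally have "2 powr (- real j * s) * t ^ ks \<le> 4 powr real ks * y powr s * qs ^ (J - j)" by (simp add: mult_ac)
  moreover have "2 powr (- real j * s) * min 1 (t ^ ks) \<le> 2 powr (- real j * s) * t ^ ks" by (intro mult_left_mono) auto
  ultimately show ?thesis unfolding g t_def by linarith
qed

text \<open>The size estimate is the better one on fine levels, the estimate for
  \<open>ks\<close>-th differences on coarse ones; their minimum is what \<open>level_decay\<close>
  bounds. A higher order \<open>p\<close> only costs powers of 2.\<close>

lemma lev_decay:
  assumes "ks \<le> p"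
  obtains K where "K > 0" "\<And>M c j J x h. coef_bound s M c \<Longrightarrow> 0 \<le> M \<Longrightarrow> h \<noteq> 0 \<Longrightarrow> (1/2) ^ (J + 2) < norm h \<Longrightarrow>
     norm h \<le> 2 * (1/2) ^ J \<Longrightarrow> \<bar>diffpow p h (lev c j) x\<bar> \<le> K * M * norm h powr s * qs ^ gap j J"
proof -
  obtain B where B: "B > 0" "\<And>\<sigma> M c j x. coef_bound \<sigma> M c \<Longrightarrow> 0 \<le> M \<Longrightarrow> \<bar>lev c j x\<bar> \<le> B * M * 2 powr (- real j * \<sigma>)"
    using lev_bound by blast
  obtain B' where B': "B' > 0" "\<And>\<sigma> M c j x h. coef_bound \<sigma> M c \<Longrightarrow> 0 \<le> M \<Longrightarrow>
    \<bar>diffpow ks h (lev c j) x\<bar> \<le> B' * M * 2 powr (- real j * \<sigma>) * (2 ^ j * norm h) ^ ks"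
    using lev_diffpow_bound[OF ks(2)] by blast
  define D where "D = 2 ^ p * (B + B')"
  have D: "D > 0" using B B' by (simp add: D_def)
  have "\<bar>diffpow p h (lev c j) x\<bar> \<le> (D * 4 powr real ks) * M * norm h powr s * qs ^ gap j J"
    if c: "coef_bound s M c" "0 \<le> M" and h: "h \<noteq> 0" "(1/2) ^ (J + 2) < norm h" "norm h \<le> 2 * (1/2) ^ J" for M c j J x h
  proof -
    have a: "\<bar>diffpow p h (lev c j) x\<bar> \<le> D * M * 2 powr (- real j * s) * 1"
    proof -
      have "\<bar>diffpow p h (lev c j) x\<bar> \<le> 2 ^ p * (B * M * 2 powr (- real j * s))"
        by (rule diffpow_bound) (rule B(2)[OF c])
      also have "\<dots> \<le> 2 ^ p * ((B + B') * M * 2 powr (- real j * s))"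
        using c B' by (intro mult_left_mono mult_right_mono) auto
      finally show ?thesis by (simp add: D_def mult_ac)
    qed
    have b: "\<bar>diffpow p h (lev c j) x\<bar> \<le> D * M * 2 powr (- real j * s) * (2 ^ j * norm h) ^ ks"
    proof -
      have "\<bar>diffpow p h (lev c j) x\<bar> \<le> 2 ^ (p - ks) * (B' * M * 2 powr (- real j * s) * (2 ^ j * norm h) ^ ks)"
        by (rule diffpow_order_bound[OF assms]) (rule B'(2)[OF c])
      also have "\<dots> \<le> 2 ^ p * ((B + B') * M * 2 powr (- real j * s) * (2 ^ j * norm h) ^ ks)"
        using c B B' by (intro mult_mono mult_right_mono power_increasing) auto
      finally show ?thesis by (simp add: D_def mult_ac)
    qed
    have "\<bar>diffpow p h (lev c j) x\<bar> \<le> D * M * (2 powr (- real j * s) * min 1 ((2 ^ j * norm h) ^ ks))"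
      using a b by (auto simp: min_def mult.assoc)
    also have "\<dots> \<le> D * M * (4 powr real ks * norm h powr s * qs ^ gap j J)"
      using level_decay[of "norm h" J j] h D c by (intro mult_left_mono) auto
    finally show ?thesis by (simp add: mult_ac)
  qed
  then show ?thesis using that[of "D * 4 powr real ks"] D by auto
qed

lemma diffpow_synth_sums:
  assumes "coef_bound s M c" "M \<ge> 0"
  shows "(\<lambda>j. diffpow p h (lev c j) x) sums diffpow p h (synth c) x"
  unfolding diffpow_expand by (intro sums_sum sums_mult synth_sums[OF assms(1) s0 assms(2)])

lemma synth_bounds:
  assumes "ks \<le> p"
  obtains K where "K > 0" "\<And>M c x. coef_bound s M c \<Longrightarrow> 0 \<le> M \<Longrightarrow> \<bar>synth c x\<bar> \<le> K * M"
    "\<And>M c x h. coef_bound s M c \<Longrightarrow> 0 \<le> M \<Longrightarrow> 0 < norm h \<Longrightarrow> norm h \<le> 1 \<Longrightarrow>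
       \<bar>diffpow p h (synth c) x\<bar> \<le> K * M * norm h powr s"
proof -
  obtain B where B: "B > 0" "\<And>\<sigma> M c j x. coef_bound \<sigma> M c \<Longrightarrow> 0 \<le> M \<Longrightarrow> \<bar>lev c j x\<bar> \<le> B * M * 2 powr (- real j * \<sigma>)"
    using lev_bound by blast
  obtain K where K: "K > 0" "\<And>M c j J x h. coef_bound s M c \<Longrightarrow> 0 \<le> M \<Longrightarrow> h \<noteq> 0 \<Longrightarrow> (1/2) ^ (J + 2) < norm h \<Longrightarrow>
     norm h \<le> 2 * (1/2) ^ J \<Longrightarrow> \<bar>diffpow p h (lev c j) x\<bar> \<le> K * M * norm h powr s * qs ^ gap j J"
    using lev_decay[OF assms] by blast
  define G where "G = 2 / (1 - sqrt qs)"
  have sq: "sqrt qs < 1" "0 < sqrt qs" using qs by auto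
  have G: "G > 0" using sq by (simp add: G_def)
  define Q where "Q = 1 / (1 - 2 powr (- s))"
  have Q: "Q > 0" using powr_neg_lt1[OF s0] by (simp add: Q_def)
  have 1: "\<bar>synth c x\<bar> \<le> B * Q * M" if c: "coef_bound s M c" "0 \<le> M" for M c x
  proof -
    have "\<bar>\<Sum>j<N. lev c j x\<bar> \<le> B * Q * M" for N
    proof -
      have "\<bar>\<Sum>j<N. lev c j x\<bar> \<le> (\<Sum>j<N. B * M * (2 powr (- s)) ^ j)"
        using B(2)[OF c] unfolding powr_geometric by (intro order_trans[OF sum_abs] sum_mono)
      also have "\<dots> = B * M * (\<Sum>j<N. (2 powr (- s)) ^ j)" by (simp add: sum_distrib_left)
      also have "\<dots> \<le> B * M * Q"
      proof (intro mult_left_mono)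
        show "(\<Sum>j<N. (2 powr (- s)) ^ j) \<le> Q"
          using sum_le_suminf[of "\<lambda>d. (2 powr (- s)) ^ d" "{..<N}"] powr_neg_lt1[OF s0] suminf_geometric[of "2 powr (- s)"]
          by (simp add: summable_geometric Q_def)
      qed (use B c in auto)
      finally show ?thesis by (simp add: mult_ac)
    qed
    moreover have "(\<lambda>N. \<bar>\<Sum>j<N. lev c j x\<bar>) \<longlonglongrightarrow> \<bar>synth c x\<bar>"
      using synth_sums[OF c(1) s0 c(2)] unfolding sums_def by (rule tendsto_rabs)
    ultimately show ?thesis by (intro LIMSEQ_le_const2) auto
  qed
  have 2: "\<bar>diffpow p h (synth c) x\<bar> \<le> 2 * K * G * M * norm h powr s"
    if c: "coef_bound s M c" "0 \<le> M" and h: "0 < norm h" "norm h \<le> 1" for M c x h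
  proof -
    obtain J where J: "(1/2) ^ (J + 1) < norm h" "norm h \<le> (1/2) ^ J" using dyadic_scale[OF h] by blast
    have "(1/2::real) ^ (J + 2) \<le> (1/2) ^ (J + 1)" by (intro power_decreasing) auto
    then have J': "(1/2) ^ (J + 2) < norm h" "norm h \<le> 2 * (1/2) ^ J" using J h by auto
    have t: "\<bar>diffpow p h (lev c j) x\<bar> \<le> K * M * norm h powr s * qs ^ gap j J" for j
      using K(2)[OF c _ J'] h by auto
    \<comment> \<open>With window width 0 the two-sided estimate is, up to a constant, the total of
      the geometric bounds; no smallness is sought here.\<close>
    have "\<bar>diffpow p h (synth c) x\<bar> \<le> real (2 * 0 + 1) * (K * M * norm h powr s) + K * M * norm h powr s * (sqrt qs ^ 0 * (2 / (1 - sqrt qs)))"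
    proof (rule two_sided_sum[OF qs diffpow_synth_sums[OF c] _ _ t])
      fix j assume "gap j J \<le> 0"
      then show "\<bar>diffpow p h (lev c j) x\<bar> \<le> K * M * norm h powr s" using t[of j] by simp
    qed (use K c in auto)
    also have "\<dots> = K * M * norm h powr s * (1 + G)" by (simp add: G_def algebra_simps)
    also have "\<dots> \<le> K * M * norm h powr s * (2 * G)"
    proof (intro mult_left_mono)
      have "1 \<le> G" using sq by (simp add: G_def field_simps)
      then show "1 + G \<le> 2 * G" by simp
    qed (use K c in auto)
    finally show ?thesis by (simp add: mult_ac)
  qed
  show ?thesis
  proof (rule that[of "B * Q + 2 * K * G"])
    show "B * Q + 2 * K * G > 0" using B Q K G by (intro add_pos_pos mult_pos_pos) auto
    have nn: "0 \<le> B * Q" "0 \<le> 2 * K * G" using B Q K G by auto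
    show "\<bar>synth c x\<bar> \<le> (B * Q + 2 * K * G) * M" if "coef_bound s M c" "0 \<le> M" for M c x
      using 1[OF that, of x] mult_nonneg_nonneg[OF nn(2) that(2)] unfolding distrib_right by linarith
    show "\<bar>diffpow p h (synth c) x\<bar> \<le> (B * Q + 2 * K * G) * M * norm h powr s"
      if "coef_bound s M c" "0 \<le> M" "0 < norm h" "norm h \<le> 1" for M c x h
    proof -
      have "0 \<le> B * Q * M * norm h powr s" using nn that by auto
      then show ?thesis using 2[OF that, of x] unfolding distrib_right by linarith
    qed
  qed
qed

text \<open>The synthesis half of the wavelet characterisation of \<open>Lambda s\<close>.\<close>

lemma synth_Lambda:
  obtains K where "K > 0" "\<And>M c. coef_bound s M c \<Longrightarrow> 0 \<le> M \<Longrightarrow> synth c \<in> Lambda s \<and> Lambda_norm s (synth c) \<le> ereal (K * M)"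
proof -
  obtain K where K: "K > 0" "\<And>M c x. coef_bound s M c \<Longrightarrow> 0 \<le> M \<Longrightarrow> \<bar>synth c x\<bar> \<le> K * M"
    "\<And>M c x h. coef_bound s M c \<Longrightarrow> 0 \<le> M \<Longrightarrow> 0 < norm h \<Longrightarrow> norm h \<le> 1 \<Longrightarrow>
       \<bar>diffpow ks h (synth c) x\<bar> \<le> K * M * norm h powr s"
    using synth_bounds[OF order_refl] by blast
  have "synth c \<in> Lambda s \<and> Lambda_norm s (synth c) \<le> ereal (2 * K * M)" if c: "coef_bound s M c" "0 \<le> M" for M c
  proof -
    have n: "Lambda_norm s (synth c) \<le> ereal (K * M + K * M)"
      by (rule Lambda_norm_le) (use K(2,3)[OF c] in \<open>auto simp: ks_def\<close>)
    moreover have "bounded (range (synth c))" using K(2)[OF c] by (auto simp: bounded_iff)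
    ultimately show ?thesis using synth_continuous[OF c(1) s0 c(2)]
      by (auto simp: Lambda_def algebra_simps intro: le_less_trans)
  qed
  then show ?thesis using that[of "2 * K"] K(1) by simp
qed

definition coef :: "(real^'n \<Rightarrow> real) \<Rightarrow> nat \<times> (nat \<times> (int^'n)) \<Rightarrow> real" where
  "coef f \<omega> = L2inner f (W \<omega>)"

lemma Lambda_diffpow_r:
  assumes "Lambda_norm s f \<le> ereal M" "0 < norm h" "norm h \<le> 1"
  shows "\<bar>diffpow r h f x\<bar> \<le> 2 ^ r * M * norm h powr s"
proof -
  have M0: "M \<ge> 0" using Lambda_norm_bounds(1)[OF assms(1), of 0] abs_ge_zero[of "f 0"] by linarith
  have "\<bar>diffpow r h f x\<bar> \<le> 2 ^ (r - ks) * (M * norm h powr s)"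
    by (rule diffpow_order_bound[OF ks(3)]) (use Lambda_norm_bounds(2)[OF assms] in \<open>simp add: ks_def\<close>)
  also have "\<dots> \<le> 2 ^ r * (M * norm h powr s)"
    using M0 by (intro mult_right_mono power_increasing) auto
  finally show ?thesis by simp
qed

text \<open>The analysis half. Both \<open>f\<close> and the synthesis of its coefficients are
  continuous with equal coefficients, so \<open>zero_coef_imp_zero\<close> identifies them
  pointwise.\<close>

lemma Lambda_expansion:
  obtains K where "K > 0" "\<And>(f :: real^'n \<Rightarrow> real) M. f \<in> Lambda s \<Longrightarrow> Lambda_norm s f \<le> ereal M \<Longrightarrow>
     coef_bound s (K * M) (coef f) \<and> synth (coef f) = f \<and> 0 \<le> M"
proof -
  obtain K where K: "K > 0" "\<And>f A \<sigma>. continuous_on UNIV f \<Longrightarrow> (\<And>x. \<bar>f x\<bar> \<le> A) \<Longrightarrow> \<sigma> > 0 \<Longrightarrow>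
     (\<And>x h. 0 < norm h \<Longrightarrow> norm h \<le> 1 \<Longrightarrow> \<bar>diffpow r h f x\<bar> \<le> A * norm h powr \<sigma>) \<Longrightarrow>
     coef_bound \<sigma> (K * A) (\<lambda>\<omega>. L2inner f (W \<omega>))"
    using coef_bound_of_smooth[OF r1 rL] by blast
  show ?thesis
  proof (rule that[of "K * 2 ^ r"])
    show "K * 2 ^ r > 0" using K by simp
    fix f :: "real^'n \<Rightarrow> real" and M assume f: "f \<in> Lambda s" "Lambda_norm s f \<le> ereal M"
    have M0: "M \<ge> 0" using Lambda_norm_bounds(1)[OF f(2), of 0] abs_ge_zero[of "f 0"] by linarith
    have cf: "continuous_on UNIV f" using f by (simp add: Lambda_def)
    have cb: "coef_bound s (K * (2 ^ r * M)) (coef f)"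
      unfolding coef_def[abs_def]
    proof (rule K(2)[OF cf _ s0])
      have "1 * M \<le> 2 ^ r * M" using M0 by (intro mult_right_mono) auto
      then show "\<bar>f x\<bar> \<le> 2 ^ r * M" for x using Lambda_norm_bounds(1)[OF f(2), of x] by linarith
    qed (rule Lambda_diffpow_r[OF f(2)])
    have KM: "0 \<le> K * (2 ^ r * M)" using K M0 by simp
    define g where "g x = f x - synth (coef f) x" for x
    have cs: "continuous_on UNIV (synth (coef f))" by (rule synth_continuous[OF cb s0 KM])
    have cg: "continuous_on UNIV g" unfolding g_def by (intro continuous_intros cf cs)
    have "L2inner g (W \<omega>) = 0" if "\<omega> \<in> Omega" for \<omega>
    proof -
      have "L2inner g (W \<omega>) = L2inner f (W \<omega>) - L2inner (synth (coef f)) (W \<omega>)"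
        unfolding L2inner_def g_def left_diff_distrib
        by (rule Bochner_Integration.integral_diff) (intro pairing_integrable that cf cs)+
      then show ?thesis using synth_coef[OF cb s0 KM that] by (simp add: coef_def)
    qed
    from zero_coef_imp_zero[OF cg this] have "synth (coef f) = f" by (auto simp: g_def fun_eq_iff)
    then show "coef_bound s (K * 2 ^ r * M) (coef f) \<and> synth (coef f) = f \<and> 0 \<le> M"
      using cb M0 by (simp add: mult.assoc)
  qed
qed

lemma nearby_scale:
  assumes "gap j J \<le> m" "(1/2) ^ (J + 1) < y" "y \<le> (1/2) ^ J"
  shows "2 powr (- real j * s) \<le> 2 powr s * 2 powr (real m * s) * y powr s" "2 ^ j * y \<le> 2 ^ m"
proof -
  have y: "y > 0" using assms(2) by (meson le_less_trans zero_le_power zero_le_divide_1_iff zero_le_numeral)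
  have jm: "J \<le> j + m" "j \<le> J + m" using assms(1) by (auto simp: gap_def split: if_splits)
  have "2 powr (- real J) \<le> 2 * y" using assms(2) by (simp add: powr_minus powr_realpow field_simps)
  then have J: "2 powr (- real J * s) \<le> 2 powr s * y powr s"
    using powr_mono2[of s "2 powr (- real J)" "2 * y"] s0 y by (simp add: powr_powr powr_mult)
  have "2 powr (- real j * s) \<le> 2 powr (real m * s + - real J * s)"
  proof (intro powr_mono)
    have "real J \<le> real j + real m" using jm by linarith
    then have "real J * s \<le> (real j + real m) * s" using s0 by (intro mult_right_mono) auto
    then show "- real j * s \<le> real m * s + - real J * s" by (simp add: algebra_simps)
  qed simp
  also have "\<dots> = 2 powr (real m * s) * 2 powr (- real J * s)" by (rule powr_add)
  also have "\<dots> \<le> 2 powr (real m * s) * (2 powr s * y powr s)" using J by (intro mult_left_mono) auto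
  finally show "2 powr (- real j * s) \<le> 2 powr s * 2 powr (real m * s) * y powr s" by (simp add: mult_ac)
  have "2 ^ j * y \<le> 2 ^ (J + m) * (1/2) ^ J" using jm y assms(3) by (intro mult_mono power_increasing) auto
  also have "\<dots> = 2 ^ m" by (simp add: power_add power_one_over)
  finally show "2 ^ j * y \<le> 2 ^ m" .
qed

lemma small_power:
  assumes "e > 0"
  obtains m where "A * (sqrt qs ^ m * (2 / (1 - sqrt qs))) \<le> e"
proof -
  have "sqrt qs < 1" "0 < sqrt qs" using qs by auto
  then have "(\<lambda>m. A * (sqrt qs ^ m * (2 / (1 - sqrt qs)))) \<longlonglongrightarrow> A * (0 * (2 / (1 - sqrt qs)))"
    by (intro tendsto_intros LIMSEQ_power_zero) auto
  then have "\<forall>\<^sub>F m in sequentially. A * (sqrt qs ^ m * (2 / (1 - sqrt qs))) < e"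
    using assms by (intro order_tendstoD) auto
  then show ?thesis using that by (auto simp: eventually_sequentially intro: less_imp_le)
qed

text \<open>Equicontinuity of the normalised differences, uniform over all positions and scales.
  Levels further than \<open>m\<close> from the scale contribute at most \<open>\<tau> / 2\<close>
  for both steps together; the remaining ones are Lipschitz at a comparable scale, so a displacement
  relative to \<open>norm h\<close> costs a multiple of \<open>\<delta>\<close>.\<close>

lemma synth_uniformly_continuous:
  assumes c: "coef_bound s M c" "M \<ge> 0" and \<tau>: "\<tau> > 0"
  obtains \<delta> where "0 < \<delta>" "\<delta> \<le> 1/4" "\<And>x x' h h'. 0 < norm h \<Longrightarrow> norm h \<le> 1 \<Longrightarrow> norm (x - x') \<le> \<delta> * norm h \<Longrightarrow>
    norm (h - h') \<le> \<delta> * norm h \<Longrightarrow> \<bar>diffpow r h (synth c) x - diffpow r h' (synth c) x'\<bar> \<le> \<tau> * norm h powr s"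
proof -
  obtain K where K: "K > 0" "\<And>M c j J x h. coef_bound s M c \<Longrightarrow> 0 \<le> M \<Longrightarrow> h \<noteq> 0 \<Longrightarrow> (1/2) ^ (J + 2) < norm h \<Longrightarrow>
     norm h \<le> 2 * (1/2) ^ J \<Longrightarrow> \<bar>diffpow r h (lev c j) x\<bar> \<le> K * M * norm h powr s * qs ^ gap j J"
    using lev_decay[OF ks(3)] by blast
  obtain B where B: "B > 0" "\<And>\<sigma> M c j x y. coef_bound \<sigma> M c \<Longrightarrow> 0 \<le> M \<Longrightarrow>
    \<bar>lev c j x - lev c j y\<bar> \<le> B * M * 2 powr (- real j * \<sigma>) * (2 ^ j * norm (x - y))"
    using lev_lipschitz by blast
  \<comment> \<open>The term 1 accounts for \<open>h\<close>, the term \<open>2 powr s\<close> for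
    \<open>h'\<close>, whose length is at most twice that of \<open>h\<close>.\<close>
  define A where "A = K * M * (1 + 2 powr s)"
  have A: "A \<ge> 0" using K c by (simp add: A_def)
  obtain m where m: "A * (sqrt qs ^ m * (2 / (1 - sqrt qs))) \<le> \<tau> / 2" using small_power[of "\<tau>/2" A] \<tau> by auto
  define Z where "Z = 2 ^ r * (B * M * (2 powr s * 2 powr (real m * s)) * (2 ^ m * (1 + real r)))"
  have Z: "Z \<ge> 0" using B c by (simp add: Z_def)
  define N where "N = real (2 * m + 1)"
  have N: "N \<ge> 0" by (simp add: N_def)
  \<comment> \<open>The bound \<open>1/4\<close> keeps \<open>norm h'\<close> inside the range
    allowed by \<open>lev_decay\<close>; the other bound makes the at most \<open>N\<close> near
    levels total at most \<open>\<tau> / 2\<close>.\<close>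
  define \<delta> where "\<delta> = min (1/4) (\<tau> / (2 * (N * Z + 1)))"
  have NZ: "N * Z \<ge> 0" using N Z by simp
  have \<delta>: "0 < \<delta>" "\<delta> \<le> 1/4" unfolding \<delta>_def by (use \<tau> NZ in simp, rule min.cobounded1)
  have \<delta>2: "N * (Z * \<delta>) \<le> \<tau> / 2"
  proof -
    have "(N * Z) * \<delta> \<le> (N * Z + 1) * (\<tau> / (2 * (N * Z + 1)))"
      using \<delta> NZ \<tau> by (intro mult_mono) (auto simp: \<delta>_def)
    also have "\<dots> = \<tau> / 2" using NZ by (simp add: field_simps)
    finally show ?thesis by (simp add: mult.assoc)
  qed
  show ?thesis
  proof (rule that[OF \<delta>])
    fix x x' h h' :: "real^'n"
    assume h: "0 < norm h" "norm h \<le> 1" and xx: "norm (x - x') \<le> \<delta> * norm h" and hh: "norm (h - h') \<le> \<delta> * norm h"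
    define y where "y = norm h"
    define y' where "y' = norm h'"
    obtain J where J: "(1/2) ^ (J + 1) < y" "y \<le> (1/2) ^ J" using dyadic_scale[OF h] unfolding y_def by blast
    have "\<delta> * norm h \<le> 1/4 * y" unfolding y_def using \<delta> by (intro mult_right_mono) auto
    then have yy: "\<bar>y - y'\<bar> \<le> y / 4" using hh norm_triangle_ineq3[of h h'] by (simp add: y_def y'_def)
    have y0: "y > 0" using h by (simp add: y_def)
    have y'0: "y' > 0" using yy y0 by linarith
    have pw: "(1/2::real) ^ (J + 2) = (1/2) ^ (J + 1) / 2" by simp
    have dec: "\<bar>diffpow r g (lev c j) z\<bar> \<le> K * M * norm g powr s * qs ^ gap j J"
      if "norm g = y \<or> norm g = y'" for g z j
    proof (rule K(2)[OF c])
      show "g \<noteq> 0" using that y0 y'0 by auto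
      show "(1/2) ^ (J + 2) < norm g" unfolding pw using that J yy y0 by linarith
      show "norm g \<le> 2 * (1/2) ^ J" using that J yy y0 by linarith
    qed
    have y's: "y' powr s \<le> 2 powr s * y powr s"
    proof -
      have "y' \<le> 2 * y" using yy y0 by linarith
      then show ?thesis using powr_mono2[of s y' "2 * y"] s0 y'0 y0 by (simp add: powr_mult)
    qed
    define a where "a j = diffpow r h (lev c j) x - diffpow r h' (lev c j) x'" for j
    have "a sums (diffpow r h (synth c) x - diffpow r h' (synth c) x')"
      unfolding a_def by (intro sums_diff diffpow_synth_sums[OF c])
    then have "\<bar>diffpow r h (synth c) x - diffpow r h' (synth c) x'\<bar> \<le>
      real (2 * m + 1) * (Z * \<delta> * y powr s) + A * y powr s * (sqrt qs ^ m * (2 / (1 - sqrt qs)))"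
    proof (rule two_sided_sum[OF qs])
      show "0 \<le> A * y powr s" "0 \<le> Z * \<delta> * y powr s" using A Z \<delta> by auto
      fix j
      have "\<bar>a j\<bar> \<le> K * M * y powr s * qs ^ gap j J + K * M * y' powr s * qs ^ gap j J"
        unfolding a_def using dec[of h j x] dec[of h' j x'] by (simp add: y_def y'_def)
      also have "\<dots> \<le> K * M * y powr s * qs ^ gap j J + K * M * (2 powr s * y powr s) * qs ^ gap j J"
        using y's K c qs by (intro add_left_mono mult_right_mono mult_left_mono) auto
      also have "\<dots> = A * y powr s * qs ^ gap j J" by (simp add: A_def algebra_simps)
      finally show "\<bar>a j\<bar> \<le> A * y powr s * qs ^ gap j J" .
      assume g: "gap j J \<le> m"
      have aj: "a j = (\<Sum>i\<le>r. (-1)^i * real (r choose i) *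
          (lev c j (x + (real r / 2 - real i) *\<^sub>R h) - lev c j (x' + (real r / 2 - real i) *\<^sub>R h')))"
        unfolding a_def diffpow_expand by (simp add: right_diff_distrib sum_subtractf)
      have "\<bar>a j\<bar> \<le> (\<Sum>i\<le>r. real (r choose i) * (B * M * (2 powr s * 2 powr (real m * s) * y powr s) * (2 ^ m * ((1 + real r) * \<delta>))))"
        unfolding aj
      proof (intro order_trans[OF sum_abs] sum_mono)
        fix i assume i: "i \<in> {..r}"
        let ?p = "x + (real r / 2 - real i) *\<^sub>R h" and ?p' = "x' + (real r / 2 - real i) *\<^sub>R h'"
        have "?p - ?p' = (x - x') + (real r / 2 - real i) *\<^sub>R (h - h')" by (simp add: algebra_simps)
        then have "norm (?p - ?p') \<le> norm (x - x') + \<bar>real r / 2 - real i\<bar> * norm (h - h')"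
          by (metis norm_scaleR norm_triangle_ineq)
        also have "\<dots> \<le> \<delta> * y + real r * (\<delta> * y)"
          using xx hh i by (intro add_mono mult_mono) (auto simp: y_def)
        finally have pp: "norm (?p - ?p') \<le> (1 + real r) * \<delta> * y" by (simp add: algebra_simps)
        have "\<bar>lev c j ?p - lev c j ?p'\<bar> \<le> B * M * 2 powr (- real j * s) * (2 ^ j * norm (?p - ?p'))" by (rule B(2)[OF c])
        also have "\<dots> \<le> B * M * (2 powr s * 2 powr (real m * s) * y powr s) * (2 ^ m * ((1 + real r) * \<delta>))"
        proof (rule mult_mono)
          show "B * M * 2 powr (- real j * s) \<le> B * M * (2 powr s * 2 powr (real m * s) * y powr s)"
            using B c by (intro mult_left_mono nearby_scale(1)[OF g J]) auto
          have "2 ^ j * norm (?p - ?p') \<le> 2 ^ j * ((1 + real r) * \<delta> * y)" using pp by (intro mult_left_mono) auto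
          also have "\<dots> = (2 ^ j * y) * ((1 + real r) * \<delta>)" by simp
          also have "\<dots> \<le> 2 ^ m * ((1 + real r) * \<delta>)"
            using nearby_scale(2)[OF g J] \<delta> by (intro mult_right_mono) auto
          finally show "2 ^ j * norm (?p - ?p') \<le> 2 ^ m * ((1 + real r) * \<delta>)" .
        qed (use B c in auto)
        finally show "\<bar>(-1)^i * real (r choose i) * (lev c j ?p - lev c j ?p')\<bar>
            \<le> real (r choose i) * (B * M * (2 powr s * 2 powr (real m * s) * y powr s) * (2 ^ m * ((1 + real r) * \<delta>)))"
          by (simp add: abs_mult mult_left_mono)
      qed
      also have "\<dots> = Z * \<delta> * y powr s"
        unfolding sum_distrib_right[symmetric] sum_choose_real Z_def by (simp only: mult_ac)
      finally show "\<bar>a j\<bar> \<le> Z * \<delta> * y powr s" .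
    qed
    also have "\<dots> = (N * (Z * \<delta>) + A * (sqrt qs ^ m * (2 / (1 - sqrt qs)))) * y powr s"
      by (simp add: N_def algebra_simps)
    also have "\<dots> \<le> (\<tau> / 2 + \<tau> / 2) * y powr s" using m \<delta>2 by (intro mult_right_mono add_mono) auto
    finally show "\<bar>diffpow r h (synth c) x - diffpow r h' (synth c) x'\<bar> \<le> \<tau> * norm h powr s"
      by (simp add: y_def)
  qed
qed

text \<open>By contraposition: if every coefficient near \<open>x\<close> on levels within
  \<open>m\<close> of \<open>J\<close> is below the threshold, those levels give at most
  \<open>\<epsilon> / 2\<close>, and \<open>m\<close> is chosen so that the tail gives at most
  \<open>\<epsilon> / 2\<close>. The radius is \<open>\<rho>0\<close> plus the displacement of a
  node, at most \<open>r * 2 ^ m\<close> after dilation.\<close>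

lemma large_difference_large_coef:
  assumes c: "coef_bound s M c" "M \<ge> 0" and \<epsilon>: "\<epsilon> > 0"
  obtains m \<eta> where "\<eta> > 0" "\<And>x h J. (1/2) ^ (J + 1) < norm h \<Longrightarrow> norm h \<le> (1/2) ^ J \<Longrightarrow>
      \<epsilon> * norm h powr s < \<bar>diffpow r h (synth c) x\<bar> \<Longrightarrow>
      \<exists>\<omega>\<in>Omega. gap (lv \<omega>) J \<le> m \<and> \<eta> * 2 powr (- real (lv \<omega>) * (s + real CARD('n) / 2)) < \<bar>c \<omega>\<bar> \<and>
        norm (2 ^ lv \<omega> *\<^sub>R x - intvec (snd (snd \<omega>))) \<le> \<rho>0 + real r * 2 ^ m"
proof -
  obtain K where K: "K > 0" "\<And>M c j J x h. coef_bound s M c \<Longrightarrow> 0 \<le> M \<Longrightarrow> h \<noteq> 0 \<Longrightarrow> (1/2) ^ (J + 2) < norm h \<Longrightarrow>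
     norm h \<le> 2 * (1/2) ^ J \<Longrightarrow> \<bar>diffpow r h (lev c j) x\<bar> \<le> K * M * norm h powr s * qs ^ gap j J"
    using lev_decay[OF ks(3)] by blast
  obtain B where B: "B > 0" "\<And>\<sigma> M c j x. coef_bound \<sigma> M c \<Longrightarrow> 0 \<le> M \<Longrightarrow> \<bar>lev c j x\<bar> \<le> B * M * 2 powr (- real j * \<sigma>)"
    using lev_bound by blast
  define A where "A = K * M"
  have A: "A \<ge> 0" using K c by (simp add: A_def)
  obtain m where m: "A * (sqrt qs ^ m * (2 / (1 - sqrt qs))) \<le> \<epsilon> / 2" using small_power[of "\<epsilon>/2" A] \<epsilon> by auto
  define Z where "Z = 2 ^ r * (B * (2 powr s * 2 powr (real m * s)))"
  have Z: "Z > 0" using B by (simp add: Z_def)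
  define N where "N = real (2 * m + 1)"
  have N: "N > 0" by (simp add: N_def)
  define \<eta> where "\<eta> = \<epsilon> / (2 * (N * Z))"
  have \<eta>: "\<eta> > 0" using \<epsilon> N Z by (simp add: \<eta>_def)
  have NZ: "N * (Z * \<eta>) = \<epsilon> / 2" using N Z by (simp add: \<eta>_def)
  show ?thesis
  proof (rule that[OF \<eta>, of m], rule ccontr)
    fix x h :: "real^'n" and J
    assume J: "(1/2) ^ (J + 1) < norm h" "norm h \<le> (1/2) ^ J" and big: "\<epsilon> * norm h powr s < \<bar>diffpow r h (synth c) x\<bar>"
      and no: "\<not> (\<exists>\<omega>\<in>Omega. gap (lv \<omega>) J \<le> m \<and> \<eta> * 2 powr (- real (lv \<omega>) * (s + real CARD('n) / 2)) < \<bar>c \<omega>\<bar> \<and>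
        norm (2 ^ lv \<omega> *\<^sub>R x - intvec (snd (snd \<omega>))) \<le> \<rho>0 + real r * 2 ^ m)"
    define y where "y = norm h"
    have y0: "y > 0" unfolding y_def using J(1) by (meson le_less_trans zero_le_power zero_le_divide_1_iff zero_le_numeral)
    have pw: "(1/2::real) ^ (J + 2) \<le> (1/2) ^ (J + 1)" by (intro power_decreasing) auto
    have "\<bar>diffpow r h (synth c) x\<bar> \<le> real (2 * m + 1) * (Z * \<eta> * y powr s) + A * y powr s * (sqrt qs ^ m * (2 / (1 - sqrt qs)))"
    proof (rule two_sided_sum[OF qs diffpow_synth_sums[OF c]])
      show "0 \<le> A * y powr s" "0 \<le> Z * \<eta> * y powr s" using A Z \<eta> by auto
      fix j
      show "\<bar>diffpow r h (lev c j) x\<bar> \<le> A * y powr s * qs ^ gap j J"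
        unfolding A_def y_def by (rule K(2)[OF c]) (use J pw y0 y_def in auto)
      assume g: "gap j J \<le> m"
      define T where "T = (\<Union>i\<le>r. near j (x + (real r / 2 - real i) *\<^sub>R h))"
      \<comment> \<open>Truncation to the wavelets near the nodes: smallness is known for these
        only, but \<open>lev_bound\<close> wants it for all indices, and the difference at
        \<open>x\<close> does not change.\<close>
      define c' where "c' \<omega> = (if \<omega> \<in> T then c \<omega> else 0)" for \<omega>
      have cb': "coef_bound s \<eta> c'"
        unfolding coef_bound_def
      proof
        fix \<omega> :: "nat \<times> (nat \<times> (int^'n))" assume \<omega>: "\<omega> \<in> Omega"
        show "\<bar>c' \<omega>\<bar> \<le> \<eta> * 2 powr (- real (lv \<omega>) * (s + real CARD('n) / 2))"
        proof (cases "\<omega> \<in> T")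
          case True
          then obtain i where i: "i \<le> r" "\<omega> \<in> near j (x + (real r / 2 - real i) *\<^sub>R h)" by (auto simp: T_def)
          then have j: "lv \<omega> = j" by (simp add: near_def)
          let ?k = "intvec (snd (snd \<omega>))"
          have "2 ^ j *\<^sub>R x - ?k = (2 ^ j *\<^sub>R (x + (real r / 2 - real i) *\<^sub>R h) - ?k) - (2 ^ j * (real r / 2 - real i)) *\<^sub>R h"
            by (simp add: algebra_simps)
          then have "norm (2 ^ j *\<^sub>R x - ?k) \<le> norm (2 ^ j *\<^sub>R (x + (real r / 2 - real i) *\<^sub>R h) - ?k) + norm ((2 ^ j * (real r / 2 - real i)) *\<^sub>R h)"
            using norm_triangle_ineq4 by metis
          also have "\<dots> = norm (2 ^ j *\<^sub>R (x + (real r / 2 - real i) *\<^sub>R h) - ?k) + \<bar>real r / 2 - real i\<bar> * (2 ^ j * y)"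
            by (simp add: y_def abs_mult)
          also have "\<dots> \<le> \<rho>0 + real r * 2 ^ m"
            using i nearby_scale(2)[OF g, of y] J y0 by (intro add_mono mult_mono) (auto simp: near_def y_def)
          finally show ?thesis using no \<omega> g True j by (auto simp: c'_def not_less)
        qed (use \<eta> in \<open>simp add: c'_def\<close>)
      qed
      have eq': "diffpow r h (lev c j) x = diffpow r h (lev c' j) x"
        by (rule diffpow_cong) (auto simp: lev_def c'_def T_def intro!: sum.cong)
      have "\<bar>diffpow r h (lev c j) x\<bar> \<le> 2 ^ r * (B * \<eta> * 2 powr (- real j * s))"
        unfolding eq' by (rule diffpow_bound) (rule B(2)[OF cb' less_imp_le[OF \<eta>]])
      also have "\<dots> \<le> 2 ^ r * (B * \<eta> * (2 powr s * 2 powr (real m * s) * y powr s))"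
        using nearby_scale(1)[OF g, of y] J B \<eta> by (intro mult_left_mono) (auto simp: y_def)
      also have "\<dots> = Z * \<eta> * y powr s" unfolding Z_def by (simp only: mult_ac)
      finally show "\<bar>diffpow r h (lev c j) x\<bar> \<le> Z * \<eta> * y powr s" .
    qed
    also have "\<dots> = (N * (Z * \<eta>) + A * (sqrt qs ^ m * (2 / (1 - sqrt qs)))) * y powr s"
      by (simp add: N_def algebra_simps)
    also have "\<dots> \<le> (\<epsilon> / 2 + \<epsilon> / 2) * y powr s" using m NZ by (intro mult_right_mono add_mono) auto
    finally show False using big by (simp add: y_def)
  qed
qed

end

section \<open>Hyperbolic geometry and Carleson-type measures\<close>

lemma hrho_less_iff:
  assumes "p \<in> Hplus" "q \<in> Hplus" "R > 0"
  shows "hrho p q < R \<longleftrightarrow> (norm (p - q))\<^sup>2 < 2 * snd p * snd q * (cosh R - 1)"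
proof -
  have pos: "2 * snd p * snd q > 0" using assms by (simp add: Hplus_def)
  have "hrho p q < R \<longleftrightarrow> arcosh (1 + (norm (p - q))\<^sup>2 / (2 * snd p * snd q)) < arcosh (cosh R)"
    using assms(3) by (simp add: hrho_def arcosh_cosh_real)
  also have "\<dots> \<longleftrightarrow> 1 + (norm (p - q))\<^sup>2 / (2 * snd p * snd q) < cosh R"
    using pos by (intro arcosh_less_iff_real) (auto simp: cosh_real_ge_1)
  also have "\<dots> \<longleftrightarrow> (norm (p - q))\<^sup>2 / (2 * snd p * snd q) < cosh R - 1" by auto
  also have "\<dots> \<longleftrightarrow> (norm (p - q))\<^sup>2 < 2 * snd p * snd q * (cosh R - 1)"
    using pos by (simp add: pos_divide_less_eq mult.commute)
  finally show ?thesis .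
qed

text \<open>Every condition is homogeneous in \<open>t\<close>, so one radius serves all scales;
  \<open>V\<close> and \<open>R\<close> are chosen so that the estimate
  \<open>cosh R >= (1 + R) / 2\<close> already yields
  \<open>2 * (cosh R - 1) > a^2 / b\<close>.\<close>

lemma hrho_radius:
  fixes a b :: real
  assumes "b > 0"
  obtains R where "R > 0" "\<And>(p :: (real^'n) \<times> real) q t. p \<in> Hplus \<Longrightarrow> q \<in> Hplus \<Longrightarrow> t > 0 \<Longrightarrow>
      norm (p - q) \<le> a * t \<Longrightarrow> b * t\<^sup>2 \<le> snd p * snd q \<Longrightarrow> hrho p q < R"
proof -
  define V where "V = a\<^sup>2 / b + 1"
  define R where "R = 2 * V"
  have V: "V > 0" using assms by (simp add: V_def add_nonneg_pos)
  then have R: "R > 0" by (simp add: R_def)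
  have "cosh R \<ge> exp R / 2" by (simp add: cosh_def)
  moreover have "exp R \<ge> 1 + R" by (rule exp_ge_add_one_self)
  ultimately have cosh: "cosh R - 1 \<ge> V - 1 / 2" unfolding R_def by linarith
  show ?thesis
  proof (rule that[OF R])
    fix p q :: "(real^'n) \<times> real" and t
    assume pq: "p \<in> Hplus" "q \<in> Hplus" and t: "t > 0" and n: "norm (p - q) \<le> a * t" and bt: "b * t\<^sup>2 \<le> snd p * snd q"
    have "(norm (p - q))\<^sup>2 \<le> (a * t)\<^sup>2" using n by (intro power_mono) auto
    also have "\<dots> = (V - 1) * (b * t\<^sup>2)" using assms by (simp add: V_def power_mult_distrib)
    also have "\<dots> < (2 * (V - 1 / 2)) * (b * t\<^sup>2)" using assms t V by (intro mult_strict_right_mono) auto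
    also have "\<dots> \<le> (2 * (cosh R - 1)) * (snd p * snd q)"
      by (rule mult_mono) (use cosh bt assms cosh_real_ge_1[of R] in auto)
    finally show "hrho p q < R" unfolding hrho_less_iff[OF pq R] by (simp add: mult_ac)
  qed
qed

lemma borel_in_lebesgue: "S \<in> sets borel \<Longrightarrow> S \<in> sets lebesgue"
  using sets_completionI_sets[of S lborel] by simp

lemma open_Hplus: "open Hplus"
  unfolding Hplus_def by (intro open_Collect_less continuous_intros)

text \<open>A union of open sets whatever subset of the half-space \<open>A\<close> is, so
  measurability of neighbourhoods comes for free.\<close>

lemma hnbhd_open:
  assumes "A \<subseteq> Hplus" "R > 0"
  shows "open (hnbhd A R)"
proof -
  have "hnbhd A R = Hplus \<inter> (\<Union>q\<in>A. {p. (norm (p - q))\<^sup>2 < 2 * snd p * snd q * (cosh R - 1)})"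
    using hrho_less_iff[OF _ _ assms(2)] assms(1) unfolding hnbhd_def by blast
  moreover have "open \<dots>" by (intro open_Int open_Hplus open_UN ballI open_Collect_less continuous_intros)
  ultimately show ?thesis by simp
qed

lemma setseq_ok_hnbhd:
  assumes "setseq_ok A" "R > 0"
  shows "setseq_ok (\<lambda>j. hnbhd (A j) R)"
  unfolding setseq_ok_def
proof (intro allI conjI)
  fix j
  show "hnbhd (A j) R \<subseteq> Hplus" by (auto simp: hnbhd_def)
  show "hnbhd (A j) R \<in> sets lebesgue"
    using assms(1) by (intro borel_in_lebesgue borel_open hnbhd_open assms(2)) (auto simp: setseq_ok_def)
qed

lemma setseq_ok_Un: "setseq_ok A \<Longrightarrow> setseq_ok B \<Longrightarrow> setseq_ok (\<lambda>j. A j \<union> B j)"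
  by (simp add: setseq_ok_def sets.Un)

text \<open>Open balls of the sup norm: their volume is explicit and membership splits into
  coordinates, which makes them convenient substitutes for hyperbolic balls.\<close>

definition ocube :: "'a::euclidean_space \<Rightarrow> real \<Rightarrow> 'a set" where
  "ocube q t = {w. \<forall>i\<in>Basis. \<bar>(w - q) \<bullet> i\<bar> < t}"

lemma ocube_eq_box: "ocube q t = box (q - t *\<^sub>R One) (q + t *\<^sub>R One)"
  by (auto simp: ocube_def mem_box inner_diff_left inner_add_left inner_sum_left_Basis abs_less_iff algebra_simps)

lemma emeasure_ocube: "t \<ge> 0 \<Longrightarrow> emeasure lebesgue (ocube (q::'a::euclidean_space) t) = ennreal ((2 * t) ^ DIM('a))"
proof -
  assume t: "t \<ge> 0"
  have "(q + t *\<^sub>R One - (q - t *\<^sub>R One)) \<bullet> b = 2 * t" if "b \<in> Basis" for b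
    using that by (simp add: inner_diff_left inner_add_left inner_sum_left_Basis)
  then have "(\<Prod>b\<in>Basis. (q + t *\<^sub>R One - (q - t *\<^sub>R One)) \<bullet> b) = (2 * t) ^ DIM('a)" by simp
  moreover have "emeasure lborel (box (q - t *\<^sub>R One) (q + t *\<^sub>R One)) = ennreal (\<Prod>b\<in>Basis. (q + t *\<^sub>R One - (q - t *\<^sub>R One)) \<bullet> b)"
    using t by (intro emeasure_lborel_box) (simp add: inner_diff_left inner_add_left)
  ultimately show ?thesis unfolding ocube_eq_box by simp
qed

lemma ocube_mono: "t \<le> t' \<Longrightarrow> ocube q t \<subseteq> ocube q t'"
  by (auto simp: ocube_def)

lemma mem_ocube_prod:
  fixes w q :: "(real^'n) \<times> real"
  shows "w \<in> ocube q t \<longleftrightarrow> (\<forall>i. \<bar>fst w $ i - fst q $ i\<bar> < t) \<and> \<bar>snd w - snd q\<bar> < t"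
proof -
  have "w \<in> ocube q t \<longleftrightarrow> (\<forall>b\<in>(Basis::(real^'n) set). \<bar>(fst w - fst q) \<bullet> b\<bar> < t) \<and> \<bar>snd w - snd q\<bar> < t"
    by (auto simp: ocube_def Basis_prod_def inner_prod_def)
  also have "(\<forall>b\<in>(Basis::(real^'n) set). \<bar>(fst w - fst q) \<bullet> b\<bar> < t) \<longleftrightarrow> (\<forall>i. \<bar>fst w $ i - fst q $ i\<bar> < t)"
    by (auto simp: Basis_vec_def inner_axis)
  finally show ?thesis .
qed

text \<open>The premise of the neighbourhood axiom in \<open>carleson_type\<close>.\<close>

definition dense_seq :: "(nat \<Rightarrow> ((real^'n) \<times> real) set) \<Rightarrow> bool" where
  "dense_seq A \<longleftrightarrow> (\<exists>\<delta> \<delta>'. 0 < \<delta> \<and> \<delta> < 1/10 \<and> 0 < \<delta>' \<and> \<delta>' < 1/10 \<and>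
     (\<forall>j. \<forall>z\<in>A j. emeasure lebesgue (hball z \<delta> \<inter> A j) \<ge> ennreal \<delta>' * emeasure lebesgue (hball z \<delta>)))"

text \<open>A hyperbolic ball of fixed radius around \<open>z\<close> lies between two Euclidean
  cubes of size proportional to the height of \<open>z\<close>. It therefore suffices to find in
  \<open>A j\<close>, close to each of its points, one cube of proportional size.\<close>

lemma dense_seq_criterion:
  obtains \<theta> where "0 < \<theta>" "\<theta> < 1/2"
    "\<And>\<kappa> A. \<kappa> > 0 \<Longrightarrow> setseq_ok A \<Longrightarrow>
      (\<And>j z. z \<in> A j \<Longrightarrow> \<exists>q. ocube q (\<kappa> * snd z) \<subseteq> A j \<inter> ocube (z :: (real^'n) \<times> real) (\<theta> * snd z)) \<Longrightarrow> dense_seq A"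
proof -
  define D where "D = real DIM((real^'n) \<times> real)"
  have D1: "D \<ge> 1" unfolding D_def using DIM_positive[where 'a="(real^'n) \<times> real"] by linarith
  \<comment> \<open>A convenient radius below the bound \<open>1/10\<close> of the axiom.\<close>
  define \<delta> where "\<delta> = (1/20 :: real)"
  define \<gamma> where "\<gamma> = cosh \<delta> - 1"
  have \<gamma>0: "\<gamma> > 0" using cosh_real_strict_mono[of 0 \<delta>] by (simp add: \<gamma>_def \<delta>_def)
  have \<gamma>2: "\<gamma> \<le> 2"
  proof -
    have "cosh \<delta> \<le> exp \<delta>" by (simp add: cosh_def \<delta>_def)
    also have "\<dots> \<le> exp 1" by (simp add: \<delta>_def)
    also have "\<dots> \<le> 3" by (rule exp_le)
    finally show ?thesis by (simp add: \<gamma>_def)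
  qed
  \<comment> \<open>Through the l1 bound on the norm, \<open>D^2 * \<theta>^2 < \<gamma>\<close>
    helps put the cube of half-side \<open>\<theta> * snd z\<close> inside the hyperbolic ball;
    \<open>1/4\<close> keeps the heights in it comparable to that of \<open>z\<close>.\<close>
  define \<theta> where "\<theta> = min (1/4) (\<gamma> / (2 * D^2))"
  have \<theta>: "0 < \<theta>" "\<theta> \<le> 1/4" unfolding \<theta>_def by (use \<gamma>0 D1 in simp, rule min.cobounded1)
  have \<theta>\<gamma>: "D^2 * \<theta>^2 < \<gamma>"
  proof -
    have "D^2 * \<theta>^2 \<le> D^2 * (\<gamma> / (2 * D^2) * 1)"
      unfolding power2_eq_square[of \<theta>] using \<theta> D1 \<gamma>0 by (intro mult_left_mono mult_mono) (auto simp: \<theta>_def)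
    also have "\<dots> < \<gamma>" using D1 \<gamma>0 by simp
    finally show ?thesis .
  qed
  show ?thesis
  proof (rule that[of \<theta>])
    show "0 < \<theta>" "\<theta> < 1/2" using \<theta> by auto
    fix \<kappa> :: real and A :: "nat \<Rightarrow> ((real^'n) \<times> real) set"
    assume \<kappa>: "\<kappa> > 0" and ok: "setseq_ok A"
      and A: "\<And>j z. z \<in> A j \<Longrightarrow> \<exists>q. ocube q (\<kappa> * snd z) \<subseteq> A j \<inter> ocube z (\<theta> * snd z)"
    define N where "N = DIM((real^'n) \<times> real)"
    \<comment> \<open>The ratio of the volumes of the cubes with half-sides
      \<open>\<kappa> * y\<close> and \<open>5 * y\<close>, capped to stay below
      \<open>1/10\<close>.\<close>
    define \<delta>' where "\<delta>' = min (1/20) ((\<kappa> / 5) ^ N)"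
    have \<delta>': "0 < \<delta>'" "\<delta>' < 1/10" using \<kappa> by (auto simp: \<delta>'_def)
    have "emeasure lebesgue (hball z \<delta> \<inter> A j) \<ge> ennreal \<delta>' * emeasure lebesgue (hball z \<delta>)" if z: "z \<in> A j" for j z
    proof -
      define y where "y = snd z"
      have zH: "z \<in> Hplus" using z ok by (auto simp: setseq_ok_def)
      have y: "y > 0" using zH by (simp add: y_def Hplus_def)
      obtain q where q: "ocube q (\<kappa> * y) \<subseteq> A j \<inter> ocube z (\<theta> * y)" using A[OF z] by (auto simp: y_def)
      have in_ball: "ocube z (\<theta> * y) \<subseteq> hball z \<delta>"
      proof
        fix w assume w: "w \<in> ocube z (\<theta> * y)"
        have "norm (w - z) \<le> (\<Sum>b\<in>Basis. \<bar>(w - z) \<bullet> b\<bar>)" by (rule norm_le_l1)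
        also have "\<dots> \<le> (\<Sum>b\<in>(Basis::((real^'n) \<times> real) set). \<theta> * y)"
          using w by (intro sum_mono less_imp_le) (auto simp: ocube_def)
        finally have "norm (w - z) \<le> D * (\<theta> * y)" by (simp add: D_def)
        then have "(norm (z - w))\<^sup>2 \<le> (D * (\<theta> * y))\<^sup>2" by (intro power_mono) (auto simp: norm_minus_commute)
        also have "\<dots> = (D^2 * \<theta>^2) * y^2" by (simp add: power_mult_distrib)
        also have "\<dots> < \<gamma> * y^2" using \<theta>\<gamma> y by (intro mult_strict_right_mono) auto
        also have "\<dots> \<le> 2 * y * snd w * \<gamma>"
        proof -
          have "\<bar>snd w - y\<bar> < \<theta> * y" using w by (simp add: mem_ocube_prod y_def)
          moreover have "\<theta> * y \<le> 1/4 * y" using \<theta> y by (intro mult_right_mono) auto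
          ultimately have "y \<le> 2 * snd w" using y by linarith
          then have "y * y * \<gamma> \<le> y * (2 * snd w) * \<gamma>" using y \<gamma>0 by (intro mult_right_mono mult_left_mono) auto
          then show ?thesis by (simp add: power2_eq_square mult_ac)
        qed
        finally have lt: "(norm (z - w))\<^sup>2 < 2 * snd z * snd w * (cosh \<delta> - 1)" by (simp add: y_def \<gamma>_def)
        have wH: "w \<in> Hplus"
        proof -
          have "\<bar>snd w - y\<bar> < \<theta> * y" using w by (simp add: mem_ocube_prod y_def)
          moreover have "\<theta> * y \<le> 1/4 * y" using \<theta> y by (intro mult_right_mono) auto
          ultimately have "0 < snd w" using y by linarith
          then show ?thesis by (simp add: Hplus_def)
        qed
        show "w \<in> hball z \<delta>" using lt wH hrho_less_iff[OF zH wH, of \<delta>] by (simp add: hball_def \<delta>_def)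
      qed
      \<comment> \<open>With \<open>\<gamma> <= 2\<close>, the squared distance is below
        \<open>4 * (y * snd w)\<close>; this first forces \<open>snd w < 6 * y\<close> and then
        bounds the squared distance by \<open>24 * y^2\<close>.\<close>
      have out: "hball z \<delta> \<subseteq> ocube z (5 * y)"
      proof
        fix w assume w: "w \<in> hball z \<delta>"
        then have wH: "w \<in> Hplus" by (simp add: hball_def)
        have w0: "snd w > 0" using wH by (simp add: Hplus_def)
        have "(norm (z - w))\<^sup>2 < 2 * y * snd w * \<gamma>"
          using w hrho_less_iff[OF zH wH, of \<delta>] by (simp add: hball_def \<delta>_def \<gamma>_def y_def)
        also have "\<dots> \<le> 2 * y * snd w * 2" using \<gamma>2 y w0 by (intro mult_left_mono) auto
        finally have n: "(norm (z - w))\<^sup>2 < 4 * (y * snd w)" by simp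
        have "norm (snd (z - w)) \<le> norm (z - w)" by (metis norm_snd_le prod.collapse)
        then have "\<bar>y - snd w\<bar> \<le> norm (z - w)" by (simp add: y_def)
        then have "(y - snd w)\<^sup>2 \<le> (norm (z - w))\<^sup>2" by (metis abs_ge_zero power2_abs power_mono)
        then have "(y - snd w)\<^sup>2 < 4 * (y * snd w)" using n by simp
        then have "snd w * snd w + y * y < 6 * y * snd w" by (simp add: power2_eq_square algebra_simps)
        moreover have "0 \<le> y * y" by simp
        ultimately have "snd w * snd w < (6 * y) * snd w" by linarith
        then have "snd w < 6 * y" using w0 by simp
        then have "4 * (y * snd w) < 4 * (y * (6 * y))" using y by simp
        moreover have "4 * (y * (6 * y)) \<le> (5 * y)\<^sup>2" by (simp add: power2_eq_square)
        ultimately have "(norm (z - w))\<^sup>2 < (5 * y)\<^sup>2" using n by linarith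
        then have "norm (z - w) < 5 * y" using y by (auto intro: power2_less_imp_less)
        then have "\<bar>(w - z) \<bullet> b\<bar> < 5 * y" if "b \<in> Basis" for b
          using Basis_le_norm[OF that, of "w - z"] by (simp add: norm_minus_commute)
        then show "w \<in> ocube z (5 * y)" by (simp add: ocube_def)
      qed
      have ms: "hball z \<delta> \<inter> A j \<in> sets lebesgue"
      proof -
        have "hball z \<delta> = Hplus \<inter> {w. (norm (z - w))\<^sup>2 < 2 * snd z * snd w * (cosh \<delta> - 1)}"
          using hrho_less_iff[OF zH, of _ \<delta>] by (auto simp: hball_def \<delta>_def)
        moreover have "open \<dots>" by (intro open_Int open_Hplus open_Collect_less continuous_intros)
        ultimately have "hball z \<delta> \<in> sets lebesgue" by (simp add: borel_in_lebesgue)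
        then show ?thesis using ok by (auto simp: setseq_ok_def)
      qed
      have "ennreal \<delta>' * emeasure lebesgue (hball z \<delta>) \<le> ennreal \<delta>' * emeasure lebesgue (ocube z (5 * y))"
        using out by (intro mult_left_mono emeasure_mono) (auto simp: ocube_eq_box borel_in_lebesgue)
      also have "\<dots> = ennreal (\<delta>' * (10 * y) ^ N)"
        using y \<delta>' by (simp add: emeasure_ocube N_def ennreal_mult)
      also have "\<dots> \<le> ennreal ((2 * (\<kappa> * y)) ^ N)"
      proof (rule ennreal_leI)
        have "\<delta>' * (10 * y) ^ N \<le> (\<kappa> / 5) ^ N * (10 * y) ^ N"
          using y by (intro mult_right_mono) (auto simp: \<delta>'_def)
        also have "\<dots> = (2 * (\<kappa> * y)) ^ N" unfolding power_mult_distrib[symmetric] by simp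
        finally show "\<delta>' * (10 * y) ^ N \<le> (2 * (\<kappa> * y)) ^ N" .
      qed
      also have "\<dots> = emeasure lebesgue (ocube q (\<kappa> * y))" using \<kappa> y by (simp add: emeasure_ocube N_def)
      also have "\<dots> \<le> emeasure lebesgue (hball z \<delta> \<inter> A j)"
        using q in_ball ms by (intro emeasure_mono) auto
      finally show ?thesis .
    qed
    then show "dense_seq A" unfolding dense_seq_def using \<delta>'
      by (intro exI[of _ \<delta>] exI[of _ \<delta>']) (auto simp: \<delta>_def)
  qed
qed

section \<open>Whitney boxes over dyadic cubes\<close>

lemma Tbox_Hplus: "Tbox I \<subseteq> Hplus"
  by (auto simp: Tbox_def side_def Hplus_def intro: le_less_trans[OF _ ])

lemma cube_borel: "cube I \<in> sets borel"
proof -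
  have "cube I = (\<Inter>i. {x. real_of_int (snd I $ i) / 2 ^ fst I \<le> x $ i} \<inter> {x. x $ i < (real_of_int (snd I $ i) + 1) / 2 ^ fst I})"
    by (auto simp: cube_def)
  also have "\<dots> \<in> sets borel"
    by (intro sets.countable_INT'' sets.Int borel_closed borel_open closed_Collect_le open_Collect_less continuous_intros) auto
  finally show ?thesis .
qed

lemma Tbox_union_borel: "(\<Union>I\<in>\<A>. Tbox I) \<in> sets borel"
proof (intro sets.countable_UN'')
  show "countable \<A>" by (rule countable_subset[of _ UNIV]) auto
  show "Tbox I \<in> sets borel" for I :: "nat \<times> (int^'a)"
    unfolding Tbox_def borel_prod[symmetric] by (intro pair_measureI cube_borel) auto
qed

lemma setseq_ok_Tbox: "setseq_ok (\<lambda>j. \<Union>I\<in>\<A> j. Tbox I)"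
  using Tbox_Hplus Tbox_union_borel unfolding setseq_ok_def by (blast intro: borel_in_lebesgue)

text \<open>All sides of a box \<open>Tbox I\<close> are comparable to the height of its points, so
  moving inwards from any point leaves room for a cube of proportional size.\<close>

lemma dense_seq_Tbox:
  fixes \<A> :: "(nat \<times> (int^'n)) set"
  shows "dense_seq (\<lambda>j. \<Union>I\<in>{I\<in>\<A>. fst I = j}. Tbox I)"
proof -
  obtain \<theta> where \<theta>: "0 < \<theta>" "\<theta> < 1/2"
    "\<And>\<kappa> A. \<kappa> > 0 \<Longrightarrow> setseq_ok A \<Longrightarrow>
      (\<And>j z. z \<in> A j \<Longrightarrow> \<exists>q. ocube q (\<kappa> * snd z) \<subseteq> A j \<inter> ocube (z :: (real^'n) \<times> real) (\<theta> * snd z)) \<Longrightarrow> dense_seq A"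
    using dense_seq_criterion by blast
  show ?thesis
  proof (rule \<theta>(3)[of "\<theta> / 4", OF _ setseq_ok_Tbox])
    fix j and z :: "(real^'n) \<times> real"
    assume "z \<in> (\<Union>I\<in>{I\<in>\<A>. fst I = j}. Tbox I)"
    then obtain k where k: "(j, k) \<in> \<A>" "z \<in> Tbox (j, k)" by auto
    define l where "l = (1/2::real) ^ j"
    define x where "x = fst z"
    define y where "y = snd z"
    have l: "l > 0" by (simp add: l_def)
    define a where "a i = real_of_int (k $ i) * l" for i
    have cube_l: "u \<in> cube (j, k) \<longleftrightarrow> (\<forall>i. a i \<le> u $ i \<and> u $ i < a i + l)" for u
      by (simp add: cube_def a_def l_def power_one_over field_simps)
    have xi: "a i \<le> x $ i \<and> x $ i < a i + l" for i using k cube_l by (auto simp: Tbox_def x_def)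
    have yl: "l / 2 < y" "y \<le> l" using k by (auto simp: Tbox_def y_def side_def l_def)
    define t where "t = \<theta> / 4 * y"
    have t: "0 < t" "t \<le> l / 8"
    proof -
      show "0 < t" using \<theta> yl l by (simp add: t_def)
      have "\<theta> / 4 * y \<le> (1/2) / 4 * l" using \<theta> yl l by (intro mult_mono) auto
      then show "t \<le> l / 8" by (simp add: t_def)
    qed
    have t4: "4 * t = \<theta> * y" by (simp add: t_def)
    \<comment> \<open>In each coordinate the centre moves by \<open>t\<close> away from the nearer
      face; \<open>t <= l / 8\<close> leaves room even vertically, where the box has only length
      \<open>l / 2\<close> and midpoint \<open>3 / 4 * l\<close>.\<close>
    define q where "q = ((\<chi> i. if x $ i < a i + l / 2 then x $ i + t else x $ i - t), if y < 3 / 4 * l then y + t else y - t)"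
    have "ocube q t \<subseteq> Tbox (j, k) \<inter> ocube z (\<theta> * y)"
    proof
      fix w assume w: "w \<in> ocube q t"
      have wi: "\<bar>fst w $ i - (if x $ i < a i + l / 2 then x $ i + t else x $ i - t)\<bar> < t" for i
        using w by (simp add: mem_ocube_prod q_def)
      have wy: "\<bar>snd w - (if y < 3 / 4 * l then y + t else y - t)\<bar> < t" using w by (simp add: mem_ocube_prod q_def)
      have "a i \<le> fst w $ i \<and> fst w $ i < a i + l \<and> \<bar>fst w $ i - x $ i\<bar> < 4 * t" for i
        using wi[of i] xi[of i] t l by (auto split: if_splits)
      moreover have "l / 2 < snd w \<and> snd w \<le> l \<and> \<bar>snd w - y\<bar> < 4 * t"
        using wy yl t l by (auto split: if_splits)
      ultimately show "w \<in> Tbox (j, k) \<inter> ocube z (\<theta> * y)" unfolding t4[symmetric]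
        by (cases w) (auto simp: Tbox_def cube_l mem_ocube_prod side_def l_def[symmetric] x_def y_def)
    qed
    then show "\<exists>q. ocube q (\<theta> / 4 * snd z) \<subseteq> (\<Union>I\<in>{I\<in>\<A>. fst I = j}. Tbox I) \<inter> ocube z (\<theta> * snd z)"
      using k unfolding t_def y_def by (intro exI[of _ q]) fastforce
  qed (use \<theta> in simp)
qed

section \<open>Finiteness rules for a Carleson-type map\<close>

locale carleson =
  fixes \<nu> :: "(nat \<Rightarrow> ((real^'n) \<times> real) set) \<Rightarrow> ereal"
  assumes carleson: "carleson_type \<nu>"
begin

lemma nu_mono: "setseq_ok A \<Longrightarrow> setseq_ok B \<Longrightarrow> (\<And>j. A j \<subseteq> B j) \<Longrightarrow> \<nu> B < \<infinity> \<Longrightarrow> \<nu> A < \<infinity>"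
  using carleson unfolding carleson_type_def by (meson le_less_trans)

lemma nu_nonneg: "setseq_ok A \<Longrightarrow> 0 \<le> \<nu> A"
  using carleson unfolding carleson_type_def by blast

lemma ereal_mult_finite: "0 \<le> x \<Longrightarrow> x < \<infinity> \<Longrightarrow> ereal C * x < \<infinity>"
  by (cases x) auto

lemma nu_union: 
  assumes "setseq_ok A" "setseq_ok B" "\<nu> A < \<infinity>" "\<nu> B < \<infinity>"
  shows "\<nu> (\<lambda>j. A j \<union> B j) < \<infinity>"
proof -
  obtain C where "\<nu> (\<lambda>j. A j \<union> B j) \<le> ereal C * (\<nu> A + \<nu> B)"
    using carleson assms unfolding carleson_type_def by blast
  also have "\<dots> < \<infinity>" using assms nu_nonneg[OF assms(1)] nu_nonneg[OF assms(2)] by (intro ereal_mult_finite) auto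
  finally show ?thesis .
qed

lemma nu_shift:
  assumes "setseq_ok A" "\<nu> A < \<infinity>"
  shows "\<nu> (\<lambda>j. A (j + 1)) < \<infinity>" "\<nu> (\<lambda>j. if j = 0 then {} else A (j - 1)) < \<infinity>"
proof -
  obtain C where "\<nu> (\<lambda>j. A (j + 1)) \<le> ereal C * \<nu> A" "\<nu> (\<lambda>j. if j = 0 then {} else A (j - 1)) \<le> ereal C * \<nu> A"
    using carleson assms unfolding carleson_type_def by blast
  then show "\<nu> (\<lambda>j. A (j + 1)) < \<infinity>" "\<nu> (\<lambda>j. if j = 0 then {} else A (j - 1)) < \<infinity>"
    using ereal_mult_finite[OF nu_nonneg[OF assms(1)] assms(2)] le_less_trans by blast+
qed

lemma nu_fatten:
  assumes "setseq_ok A" "dense_seq A" "\<nu> A < \<infinity>" "R > 0"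
  shows "\<nu> (\<lambda>j. hnbhd (A j) R) < \<infinity>"
  using carleson assms unfolding carleson_type_def dense_seq_def by blast

text \<open>The next wider window is contained in the union of the two unit shifts of the previous
  one with \<open>A\<close>, so the shift and union axioms suffice. This absorbs the bounded
  mismatch between the level of a cube and the strip of a step.\<close>

lemma nu_window:
  assumes "setseq_ok A" "\<nu> A < \<infinity>"
  shows "setseq_ok (\<lambda>j. \<Union>i\<in>{i. gap i j \<le> m}. A i) \<and> \<nu> (\<lambda>j. \<Union>i\<in>{i. gap i j \<le> m}. A i) < \<infinity>"
proof (induction m)
  case 0
  have "(\<Union>i\<in>{i. gap i j \<le> 0}. A i) = A j" for j by (auto simp: gap_def)
  then show ?case using assms by simp
next
  case (Suc m)
  define U where "U j = (\<Union>i\<in>{i. gap i j \<le> m}. A i)" for j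
  have U: "setseq_ok U" "\<nu> U < \<infinity>" using Suc by (auto simp: U_def[abs_def])
  define V where "V j = U (j + 1) \<union> (if j = 0 then {} else U (j - 1)) \<union> A j" for j
  have ok1: "setseq_ok (\<lambda>j. U (j + 1))" "setseq_ok (\<lambda>j. if j = 0 then {} else U (j - 1))"
    using U(1) by (auto simp: setseq_ok_def)
  have ok2: "setseq_ok (\<lambda>j. U (j + 1) \<union> (if j = 0 then {} else U (j - 1)))"
    by (rule setseq_ok_Un[OF ok1])
  have V: "\<nu> V < \<infinity>" unfolding V_def
    by (intro nu_union[OF ok2 assms(1)] nu_union[OF ok1] nu_shift U assms)
  have okV: "setseq_ok V" unfolding V_def by (rule setseq_ok_Un[OF ok2 assms(1)])
  have sub: "(\<Union>i\<in>{i. gap i j \<le> Suc m}. A i) \<subseteq> V j" for j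
  proof
    fix z assume "z \<in> (\<Union>i\<in>{i. gap i j \<le> Suc m}. A i)"
    then obtain i where i: "gap i j \<le> Suc m" "z \<in> A i" by auto
    consider "i = j" | "i > j" | "i < j" by linarith
    then show "z \<in> V j"
    proof cases
      case 2
      then have "gap i (j + 1) \<le> m" using i by (auto simp: gap_def)
      then show ?thesis using i by (auto simp: V_def U_def)
    next
      case 3
      then have "gap i (j - 1) \<le> m" "j \<noteq> 0" using i by (auto simp: gap_def split: if_splits)
      then show ?thesis using i by (auto simp: V_def U_def)
    qed (use i in \<open>auto simp: V_def\<close>)
  qed
  have ok: "setseq_ok (\<lambda>j. \<Union>i\<in>{i. gap i j \<le> Suc m}. A i)"
    using assms(1) unfolding setseq_ok_def by (auto intro!: sets.countable_UN'')
  show ?case using ok nu_mono[OF ok okV sub V] by simp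
qed

end

section \<open>Level sets of differences and their measurability\<close>

lemma Sset_eq:
  fixes f :: "real^'n \<Rightarrow> real"
  shows "Sset r j s f \<epsilon> = {(x, y). y \<in> {(1/2) ^ (j + 1) <.. (1/2) ^ j} \<and> (\<exists>h. norm h = y \<and> \<epsilon> * y powr s < \<bar>diffpow r h f x\<bar>)}"
proof -
  have "y > 0" if "(1/2) ^ (j + 1) < y" for y :: real
    using that by (meson le_less_trans zero_le_power zero_le_divide_1_iff zero_le_numeral)
  then have eq: "(y \<in> {(1/2) ^ (j + 1) <.. (1/2) ^ j} \<and> ereal \<epsilon> < Delta r f x y / ereal (y powr s)) \<longleftrightarrow>
      (y \<in> {(1/2) ^ (j + 1) <.. (1/2) ^ j} \<and> (\<exists>h. norm h = y \<and> \<epsilon> * y powr s < \<bar>diffpow r h f x\<bar>))" for x y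
    using Delta_less_iff[of y \<epsilon> r f x s] by (auto simp del: power_Suc)
  show ?thesis unfolding Sset_def eq ..
qed

text \<open>Writing the step as height times a unit vector \<open>u\<close>, the condition for fixed
  \<open>u\<close> is open in the half-space. The union over the unit sphere is still open, although
  uncountable, so the level set is a strip intersected with an open set.\<close>

lemma setseq_ok_Sset:
  fixes f :: "real^'n \<Rightarrow> real"
  assumes f: "continuous_on UNIV f"
  shows "setseq_ok (\<lambda>j. Sset r j s f \<epsilon>)"
  unfolding setseq_ok_def
proof (intro allI conjI)
  fix j
  have pos: "y > 0" if "(1/2) ^ (j + 1) < y" for y :: real
    using that by (meson le_less_trans zero_le_power zero_le_divide_1_iff zero_le_numeral)
  then show "Sset r j s f \<epsilon> \<subseteq> Hplus" by (auto simp: Sset_def Hplus_def)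
  define Op where "Op u = {z \<in> Hplus. \<epsilon> * snd z powr s < \<bar>diffpow r (snd z *\<^sub>R u) f (fst z)\<bar>}" for u
  define St where "St = {z :: (real^'n) \<times> real. (1/2) ^ (j + 1) < snd z \<and> snd z \<le> (1/2) ^ j}"
  have "open (Op u)" for u
  proof -
    have c1: "continuous_on Hplus (\<lambda>z. \<epsilon> * snd z powr s)"
      by (intro continuous_intros) (auto simp: Hplus_def)
    have c2: "continuous_on Hplus (\<lambda>z. \<bar>diffpow r (snd z *\<^sub>R u) f (fst z)\<bar>)"
      unfolding diffpow_expand by (intro continuous_intros continuous_on_compose2[OF f]) auto
    have "continuous_on Hplus (\<lambda>z. \<bar>diffpow r (snd z *\<^sub>R u) f (fst z)\<bar> - \<epsilon> * snd z powr s)"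
      by (intro continuous_intros c1 c2)
    then have "open ((\<lambda>z. \<bar>diffpow r (snd z *\<^sub>R u) f (fst z)\<bar> - \<epsilon> * snd z powr s) -` {0<..} \<inter> Hplus)"
      using continuous_on_open_vimage[OF open_Hplus] open_greaterThan by blast
    moreover have "(\<lambda>z. \<bar>diffpow r (snd z *\<^sub>R u) f (fst z)\<bar> - \<epsilon> * snd z powr s) -` {0<..} \<inter> Hplus = Op u"
      by (auto simp: Op_def)
    ultimately show ?thesis by simp
  qed
  then have op: "(\<Union>u\<in>{u. norm u = 1}. Op u) \<in> sets borel" by (intro borel_open open_UN ballI)
  have st: "St \<in> sets borel"
  proof -
    have "St = {z. (1/2) ^ (j + 1) < snd z} \<inter> {z. snd z \<le> (1/2) ^ j}" by (auto simp: St_def)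
    also have "\<dots> \<in> sets borel"
      by (intro sets.Int borel_open borel_closed open_Collect_less closed_Collect_le continuous_intros)
    finally show ?thesis .
  qed
  have "Sset r j s f \<epsilon> = St \<inter> (\<Union>u\<in>{u. norm u = 1}. Op u)"
  proof (intro set_eqI iffI)
    fix z assume "z \<in> Sset r j s f \<epsilon>"
    then obtain h where h: "(1/2) ^ (j + 1) < snd z" "snd z \<le> (1/2) ^ j" "norm h = snd z" "\<epsilon> * snd z powr s < \<bar>diffpow r h f (fst z)\<bar>"
      unfolding Sset_eq by auto
    have y: "snd z > 0" using pos h(1) by simp
    define u where "u = (1 / snd z) *\<^sub>R h"
    have "norm u = 1" "snd z *\<^sub>R u = h" using y h(3) by (auto simp: u_def)
    then show "z \<in> St \<inter> (\<Union>u\<in>{u. norm u = 1}. Op u)" using h y by (auto simp: St_def Op_def Hplus_def intro!: bexI[of _ u])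
  next
    fix z assume "z \<in> St \<inter> (\<Union>u\<in>{u. norm u = 1}. Op u)"
    then obtain u where u: "z \<in> St" "norm u = 1" "z \<in> Op u" by auto
    then show "z \<in> Sset r j s f \<epsilon>"
      unfolding Sset_eq by (cases z) (auto simp: St_def Op_def Hplus_def intro!: exI[of _ "snd z *\<^sub>R u"])
  qed
  then show "Sset r j s f \<epsilon> \<in> sets lebesgue"
    using borel_in_lebesgue[OF sets.Int[OF st op]] by (simp only:)
qed

section \<open>The distance to the lattice space\<close>

lemma floorvec_measurable: "(floorvec j :: real^'n \<Rightarrow> int^'n) \<in> borel \<rightarrow>\<^sub>M count_space UNIV"
proof -
  have "floorvec j -` {k} \<inter> space borel = cube (j, k)" for k :: "int^'n"
    by (auto simp: cube_iff)
  then show ?thesis by (simp add: measurable_count_space_eq2_countable cube_borel)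
qed

lemma floorvec_compose_measurable: "(\<lambda>x. g (floorvec j x)) \<in> borel_measurable lborel"
  using measurable_compose[OF floorvec_measurable, of g borel] by simp

lemma infsum_cubes:
  "(\<Sum>\<^sub>\<infinity>I\<in>{I\<in>\<A>. fst I = j}. indicator (cube I) x) = (if (j, floorvec j x) \<in> \<A> then 1 else 0 :: real)"
proof -
  have "(\<Sum>\<^sub>\<infinity>I\<in>{I\<in>\<A>. fst I = j}. indicator (cube I) x :: real) = (\<Sum>\<^sub>\<infinity>I\<in>{I\<in>\<A>. I = (j, floorvec j x)}. indicator (cube I) x)"
  proof (rule infsum_cong_neutral)
    fix I assume "I \<in> {I\<in>\<A>. fst I = j} - {I\<in>\<A>. I = (j, floorvec j x)}"
    then show "indicator (cube I) x = (0::real)" by (cases I) (auto simp: indicator_def cube_iff)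
  qed auto
  also have "{I\<in>\<A>. I = (j, floorvec j x)} = (if (j, floorvec j x) \<in> \<A> then {(j, floorvec j x)} else {})" by auto
  also have "(\<Sum>\<^sub>\<infinity>I\<in>\<dots>. indicator (cube I) x :: real) = (if (j, floorvec j x) \<in> \<A> then 1 else 0)"
    by (auto simp: cube_iff)
  finally show ?thesis .
qed

lemma norm_prod_diff_le: "norm (p - q) \<le> norm (fst p - fst q) + norm (snd p - snd q)"
  using norm_Pair_le[of "fst p - fst q" "snd p - snd q"] by (simp add: minus_prod_def)

locale lattice_setting = smooth_wavelets L \<phi> \<psi> s r + carleson \<nu>
  for L :: nat and \<phi> :: "real^'n \<Rightarrow> real" and \<psi> :: "nat \<Rightarrow> real^'n \<Rightarrow> real" and s :: real and r :: nat
    and \<nu> :: "(nat \<Rightarrow> ((real^'n) \<times> real) set) \<Rightarrow> ereal" +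
  fixes X :: "(nat \<Rightarrow> real^'n \<Rightarrow> real) \<Rightarrow> ereal"
  assumes qn: "qn_lattice X" and II: "assumption_II X \<nu>"
begin

text \<open>The weight in \<open>LambdaX\<close> is the reciprocal of the decay factor in
  \<open>coef_bound\<close>, so thresholds for normalised coefficients become constants in
  \<open>coefseq\<close>.\<close>

lemma weight_cancel: "((1/2) ^ (j * CARD('n))) powr (- s / real CARD('n) - 1/2) * 2 powr (- real j * (s + real CARD('n) / 2)) = 1"
proof -
  have "((1/2::real) ^ (j * CARD('n))) = 2 powr (- real (j * CARD('n)))"
    by (simp only: powr_minus powr_realpow zero_less_numeral power_one_over inverse_eq_divide)
  then have "((1/2) ^ (j * CARD('n))) powr (- s / real CARD('n) - 1/2) = 2 powr (- real (j * CARD('n)) * (- s / real CARD('n) - 1/2))"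
    by (simp only: powr_powr)
  also have "- real (j * CARD('n)) * (- s / real CARD('n) - 1/2) = real j * (s + real CARD('n) / 2)"
    by (simp add: field_simps)
  finally show ?thesis by (simp add: powr_add[symmetric])
qed

definition coefseq :: "(nat \<times> (nat \<times> (int^'n)) \<Rightarrow> real) \<Rightarrow> nat \<Rightarrow> real^'n \<Rightarrow> real" where
  "coefseq c j x = (\<Sum>\<^sub>\<infinity>\<omega>\<in>{\<omega>\<in>Omega. lv \<omega> = j}. ((1/2) ^ (j * CARD('n))) powr (- s / real CARD('n) - 1/2) * \<bar>c \<omega>\<bar> * indicator (cube (snd \<omega>)) x)"

definition lset :: "nat \<Rightarrow> nat set" where
  "lset j = {l. l < 2 ^ CARD('n) \<and> (l = 0 \<longrightarrow> j = 0)}"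

lemma lset_finite: "finite (lset j)" and lset_card: "card (lset j) \<le> 2 ^ CARD('n)"
proof -
  have sub: "lset j \<subseteq> {..<2 ^ CARD('n)}" by (auto simp: lset_def)
  show "finite (lset j)" by (rule finite_subset[OF sub]) simp
  show "card (lset j) \<le> 2 ^ CARD('n)" using card_mono[OF finite_lessThan sub] by simp
qed

text \<open>Only the cube containing \<open>x\<close> contributes on level \<open>j\<close>, so the
  \<open>infsum\<close> is a finite sum and its default value for families that are not summable
  never intervenes.\<close>

lemma coefseq_eq: "coefseq c j x = (\<Sum>l\<in>lset j. ((1/2) ^ (j * CARD('n))) powr (- s / real CARD('n) - 1/2) * \<bar>c (l, (j, floorvec j x))\<bar>)"
proof -
  define T where "T = (\<lambda>l. (l, (j, floorvec j x))) ` lset j"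
  have "coefseq c j x = (\<Sum>\<^sub>\<infinity>\<omega>\<in>T. ((1/2) ^ (j * CARD('n))) powr (- s / real CARD('n) - 1/2) * \<bar>c \<omega>\<bar> * indicator (cube (snd \<omega>)) x)"
    unfolding coefseq_def
  proof (rule infsum_cong_neutral)
    fix \<omega> assume "\<omega> \<in> T - {\<omega>\<in>Omega. lv \<omega> = j}"
    then show "((1/2) ^ (j * CARD('n))) powr (- s / real CARD('n) - 1/2) * \<bar>c \<omega>\<bar> * indicator (cube (snd \<omega>)) x = 0" by (auto simp: T_def Omega_def lset_def)
  next
    fix \<omega> assume "\<omega> \<in> {\<omega>\<in>Omega. lv \<omega> = j} - T"
    then have "x \<notin> cube (snd \<omega>)" by (cases \<omega>) (auto simp: T_def Omega_def lset_def cube_iff)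
    then show "((1/2) ^ (j * CARD('n))) powr (- s / real CARD('n) - 1/2) * \<bar>c \<omega>\<bar> * indicator (cube (snd \<omega>)) x = 0" by simp
  qed auto
  also have "\<dots> = (\<Sum>\<omega>\<in>T. ((1/2) ^ (j * CARD('n))) powr (- s / real CARD('n) - 1/2) * \<bar>c \<omega>\<bar> * indicator (cube (snd \<omega>)) x)"
    by (rule infsum_finite) (simp add: T_def lset_finite)
  also have "\<dots> = (\<Sum>l\<in>lset j. ((1/2) ^ (j * CARD('n))) powr (- s / real CARD('n) - 1/2) * \<bar>c (l, (j, floorvec j x))\<bar>)"
    unfolding T_def by (subst sum.reindex) (auto simp: inj_on_def cube_iff)
  finally show ?thesis .
qed

definition cubeseq :: "(nat \<times> (int^'n)) set \<Rightarrow> nat \<Rightarrow> real^'n \<Rightarrow> real" where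
  "cubeseq \<A> j x = (\<Sum>\<^sub>\<infinity>I\<in>{I\<in>\<A>. fst I = j}. indicator (cube I) x)"

lemma coefseq_meas: "fseq_meas (coefseq c)"
  unfolding fseq_meas_def
proof
  fix j
  show "coefseq c j \<in> borel_measurable lborel"
    unfolding coefseq_eq[abs_def] by (rule floorvec_compose_measurable
      [of "\<lambda>k. \<Sum>l\<in>lset j. ((1/2) ^ (j * CARD('n))) powr (- s / real CARD('n) - 1/2) * \<bar>c (l, (j, k))\<bar>"])
qed

lemma cubeseq_meas: "fseq_meas (cubeseq \<A>)"
  unfolding fseq_meas_def
proof
  fix j
  show "cubeseq \<A> j \<in> borel_measurable lborel"
    unfolding cubeseq_def[abs_def] infsum_cubes by (rule floorvec_compose_measurable[of "\<lambda>k. if (j, k) \<in> \<A> then 1 else 0"])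
qed

lemma X_mono:
  assumes "fseq_meas F" "fseq_meas G" "\<And>j x. \<bar>F j x\<bar> \<le> a * G j x" "X G < \<infinity>"
  shows "X F < \<infinity>"
proof -
  have m: "fseq_meas (\<lambda>j x. a * G j x)" using assms(2) unfolding fseq_meas_def by (auto intro: borel_measurable_times)
  have le: "\<bar>F j x\<bar> \<le> \<bar>a * G j x\<bar>" for j x using assms(3)[of j x] by linarith
  note q = qn[unfolded qn_lattice_def]
  have "X F \<le> X (\<lambda>j x. a * G j x)"
    by (rule q[THEN conjunct2, THEN conjunct2, THEN conjunct2, THEN conjunct2, THEN conjunct1, rule_format, OF assms(1) m])
      (simp add: le)
  also have "\<dots> = ereal \<bar>a\<bar> * X G"
    by (rule q[THEN conjunct2, THEN conjunct2, THEN conjunct1, rule_format, OF assms(2)])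
  also have "\<dots> < \<infinity>"
    by (intro ereal_mult_finite q[THEN conjunct1, rule_format] assms)
  finally show ?thesis .
qed

lemma nu_cubes_iff: "\<nu> (\<lambda>j. \<Union>I\<in>{I\<in>\<A>. fst I = j}. Tbox I) < \<infinity> \<longleftrightarrow> X (cubeseq \<A>) < \<infinity>"
  using II unfolding assumption_II_def cubeseq_def[abs_def] by blast

text \<open>Bounded normalised coefficients carried by \<open>\<A>\<close> are dominated pointwise
  by a multiple of its indicator sequence; the factor \<open>2 ^ CARD('n)\<close> bounds the number
  of generators per cube.\<close>

lemma X_coefseq_finite:
  assumes M: "coef_bound s M c" "M \<ge> 0" and c: "\<And>\<omega>. \<omega> \<in> Omega \<Longrightarrow> c \<omega> \<noteq> 0 \<Longrightarrow> snd \<omega> \<in> \<A>"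
    and A: "X (cubeseq \<A>) < \<infinity>"
  shows "X (coefseq c) < \<infinity>"
proof (rule X_mono[OF coefseq_meas cubeseq_meas _ A])
  fix j x
  have t: "((1/2) ^ (j * CARD('n))) powr (- s / real CARD('n) - 1/2) * \<bar>c (l, (j, floorvec j x))\<bar> \<le> M * cubeseq \<A> j x" if "l \<in> lset j" for l
  proof -
    have o: "(l, (j, floorvec j x)) \<in> Omega" using that by (auto simp: lset_def Omega_def)
    show ?thesis
    proof (cases "c (l, (j, floorvec j x)) = 0")
      case True
      then show ?thesis using M(2) by (simp add: cubeseq_def infsum_cubes)
    next
      case False
      then have "(j, floorvec j x) \<in> \<A>" using c[OF o] by simp
      then have one: "cubeseq \<A> j x = 1" by (simp add: cubeseq_def infsum_cubes)
      have "\<bar>c (l, (j, floorvec j x))\<bar> \<le> M * 2 powr (- real j * (s + real CARD('n) / 2))" using M(1) o unfolding coef_bound_def by fastforce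
      then have "((1/2) ^ (j * CARD('n))) powr (- s / real CARD('n) - 1/2) * \<bar>c (l, (j, floorvec j x))\<bar> \<le> ((1/2) ^ (j * CARD('n))) powr (- s / real CARD('n) - 1/2) * (M * 2 powr (- real j * (s + real CARD('n) / 2)))" by (intro mult_left_mono) auto
      also have "\<dots> = M * (((1/2) ^ (j * CARD('n))) powr (- s / real CARD('n) - 1/2) * 2 powr (- real j * (s + real CARD('n) / 2)))" by (simp only: mult_ac)
      finally show ?thesis unfolding one weight_cancel .
    qed
  qed
  have c0: "0 \<le> M * cubeseq \<A> j x" using M(2) by (simp add: cubeseq_def infsum_cubes)
  have n0: "0 \<le> coefseq c j x" unfolding coefseq_eq by (intro sum_nonneg) auto
  have "coefseq c j x \<le> (\<Sum>l\<in>lset j. M * cubeseq \<A> j x)" unfolding coefseq_eq by (intro sum_mono t)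
  also have "\<dots> = real (card (lset j)) * (M * cubeseq \<A> j x)" by simp
  also have "\<dots> \<le> 2 ^ CARD('n) * (M * cubeseq \<A> j x)"
  proof (rule mult_right_mono[OF _ c0])
    show "real (card (lset j)) \<le> 2 ^ CARD('n)" using lset_card[of j] by (metis of_nat_le_iff of_nat_numeral of_nat_power)
  qed
  finally show "\<bar>coefseq c j x\<bar> \<le> (2 ^ CARD('n) * M) * cubeseq \<A> j x" using n0 by (simp add: mult.assoc)
qed

text \<open>A pointwise Chebyshev inequality: on a cube of \<open>\<A>\<close> the sequence
  \<open>coefseq c\<close> is at least \<open>\<eta>\<close>.\<close>

lemma X_cubeseq_finite:
  assumes c: "X (coefseq c) < \<infinity>" and \<eta>: "\<eta> > 0"
    and A: "\<And>I. I \<in> \<A> \<Longrightarrow> \<exists>l. (l, I) \<in> Omega \<and> \<eta> * 2 powr (- real (fst I) * (s + real CARD('n) / 2)) < \<bar>c (l, I)\<bar>"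
  shows "X (cubeseq \<A>) < \<infinity>"
proof (rule X_mono[OF cubeseq_meas coefseq_meas _ c])
  fix j x
  show "\<bar>cubeseq \<A> j x\<bar> \<le> (1 / \<eta>) * coefseq c j x"
  proof (cases "(j, floorvec j x) \<in> \<A>")
    case False
    have "0 \<le> coefseq c j x" unfolding coefseq_eq by (intro sum_nonneg) auto
    then show ?thesis using False \<eta> by (simp add: cubeseq_def infsum_cubes)
  next
    case True
    obtain l where l: "(l, (j, floorvec j x)) \<in> Omega" "\<eta> * 2 powr (- real j * (s + real CARD('n) / 2)) < \<bar>c (l, (j, floorvec j x))\<bar>"
      using A[OF True] by auto
    have "l \<in> lset j" using l(1) by (auto simp: Omega_def lset_def)
    then have "((1/2) ^ (j * CARD('n))) powr (- s / real CARD('n) - 1/2) * \<bar>c (l, (j, floorvec j x))\<bar> \<le> coefseq c j x"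
      unfolding coefseq_eq by (intro member_le_sum) (auto simp: lset_finite)
    moreover have "((1/2) ^ (j * CARD('n))) powr (- s / real CARD('n) - 1/2) * (\<eta> * 2 powr (- real j * (s + real CARD('n) / 2))) \<le> ((1/2) ^ (j * CARD('n))) powr (- s / real CARD('n) - 1/2) * \<bar>c (l, (j, floorvec j x))\<bar>" using l(2) by (intro mult_left_mono) auto
    moreover have "((1/2) ^ (j * CARD('n))) powr (- s / real CARD('n) - 1/2) * (\<eta> * 2 powr (- real j * (s + real CARD('n) / 2))) = \<eta>"
    proof -
      have "((1/2) ^ (j * CARD('n))) powr (- s / real CARD('n) - 1/2) * (\<eta> * 2 powr (- real j * (s + real CARD('n) / 2)))
        = \<eta> * (((1/2) ^ (j * CARD('n))) powr (- s / real CARD('n) - 1/2) * 2 powr (- real j * (s + real CARD('n) / 2)))"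
        by (simp only: mult_ac)
      then show ?thesis unfolding weight_cancel by simp
    qed
    ultimately have "\<eta> \<le> coefseq c j x" by linarith
    then show ?thesis using True \<eta> by (simp add: cubeseq_def infsum_cubes)
  qed
qed

lemma LambdaX_iff: "f \<in> LambdaX s X \<phi> \<psi> \<longleftrightarrow> f \<in> Lambda s \<and> X (coefseq (coef f)) < \<infinity>"
  unfolding LambdaX_def coefseq_def[abs_def] coef_def by simp

text \<open>\<^const>\<open>Sset\<close> itself need not satisfy the density condition in the definition of a Carleson-type
  measure, because points just above the threshold may be isolated; a small box neighbourhood
  within its strip does, and it only loses a constant factor in the threshold.\<close>
lemma nu_Sset_fatten:
  assumes f: "f \<in> Lambda s" and \<epsilon>: "\<epsilon> > 0" and fin: "\<nu> (\<lambda>j. Sset r j s f \<epsilon>) < \<infinity>" and R: "R > 0"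
  defines "A \<equiv> \<lambda>j. hnbhd (Sset r j s f (2 * 2 powr s * \<epsilon>)) R"
  shows "setseq_ok A" "\<nu> A < \<infinity>"
proof -
  have cf: "continuous_on UNIV f" using f by (simp add: Lambda_def)
  show okA: "setseq_ok A" unfolding A_def by (intro setseq_ok_hnbhd setseq_ok_Sset cf R)
  obtain K where K: "K > 0" "\<And>(f :: real^'n \<Rightarrow> real) M. f \<in> Lambda s \<Longrightarrow> Lambda_norm s f \<le> ereal M \<Longrightarrow>
     coef_bound s (K * M) (coef f) \<and> synth (coef f) = f \<and> 0 \<le> M" using Lambda_expansion by blast
  obtain M where M: "M \<ge> 0" "Lambda_norm s f = ereal M" using Lambda_norm_real[of s f] f by (auto simp: Lambda_def)
  have cb: "coef_bound s (K * M) (coef f)" "synth (coef f) = f" using K(2)[OF f] M by auto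
  have KM: "K * M \<ge> 0" using K M by simp
  \<comment> \<open>Half of the raised threshold: the oscillation over the box costs
    \<open>\<tau>\<close>, and the factor \<open>2 powr s\<close> left over compensates that heights
    within one strip differ by up to a factor 2.\<close>
  define \<tau> where "\<tau> = 2 powr s * \<epsilon>"
  have \<tau>: "\<tau> > 0" using \<epsilon> by (simp add: \<tau>_def)
  obtain \<delta> where \<delta>: "0 < \<delta>" "\<delta> \<le> 1/4" "\<And>x x' h h'. 0 < norm h \<Longrightarrow> norm h \<le> 1 \<Longrightarrow> norm (x - x') \<le> \<delta> * norm h \<Longrightarrow>
    norm (h - h') \<le> \<delta> * norm h \<Longrightarrow> \<bar>diffpow r h f x - diffpow r h' f x'\<bar> \<le> \<tau> * norm h powr s"
    using synth_uniformly_continuous[OF cb(1) KM \<tau>] unfolding cb(2) by blast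
  obtain \<theta> where \<theta>: "0 < \<theta>" "\<theta> < 1/2"
    "\<And>\<kappa> A. \<kappa> > 0 \<Longrightarrow> setseq_ok A \<Longrightarrow>
      (\<And>j z. z \<in> A j \<Longrightarrow> \<exists>q. ocube q (\<kappa> * snd z) \<subseteq> A j \<inter> ocube (z :: (real^'n) \<times> real) (\<theta> * snd z)) \<Longrightarrow> dense_seq A"
    using dense_seq_criterion by blast
  define n where "n = real CARD('n)"
  have n1: "n \<ge> 1" using zero_less_card_finite[where 'a='n] by (simp add: n_def)
  \<comment> \<open>The bound \<open>\<theta> / 4\<close> is for the density criterion;
    \<open>\<delta> / (2 * n)\<close> makes the Euclidean displacement inside the box at most
    \<open>\<delta> * norm h\<close>.\<close>
  define d where "d = min (\<theta> / 4) (\<delta> / (2 * n))"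
  have d: "0 < d" "d \<le> \<theta> / 4" "d \<le> \<delta> / (2 * n)" unfolding d_def by (use \<theta> \<delta> n1 in simp, simp_all)
  have dn: "2 * (n * d) \<le> \<delta>" using d(3) n1 by (simp add: field_simps)
  have d2: "2 * d \<le> \<delta>" using dn n1 d(1) mult_right_mono[of 1 n d] by linarith
  define l where "l j = (1/2::real) ^ j" for j :: nat
  have l0: "l j > 0" for j by (simp add: l_def)
  have strip: "{(1/2) ^ (j + 1) <.. (1/2) ^ j} = {l j / 2 <.. l j}" for j by (simp add: l_def)
  \<comment> \<open>Cutting with the strip keeps \<open>B j\<close> inside the lower level set with
    the same index \<open>j\<close>.\<close>
  define B where "B j = {z. snd z \<in> {l j / 2 <.. l j}} \<inter> (\<Union>p\<in>Sset r j s f (2 * 2 powr s * \<epsilon>). ocube p (d * l j))" for j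
  have sub1: "Sset r j s f (2 * 2 powr s * \<epsilon>) \<subseteq> B j" for j
  proof
    fix p assume p: "p \<in> Sset r j s f (2 * 2 powr s * \<epsilon>)"
    then have "snd p \<in> {l j / 2 <.. l j}" unfolding Sset_eq strip by auto
    moreover have "p \<in> ocube p (d * l j)" using d(1) l0[of j] by (simp add: ocube_def)
    ultimately show "p \<in> B j" using p by (auto simp: B_def)
  qed
  have sub2: "B j \<subseteq> Sset r j s f \<epsilon>" for j
  proof
    fix z assume "z \<in> B j"
    then obtain p where z: "l j / 2 < snd z" "snd z \<le> l j" and p: "p \<in> Sset r j s f (2 * 2 powr s * \<epsilon>)" "z \<in> ocube p (d * l j)"
      by (auto simp: B_def)
    obtain h where h: "l j / 2 < snd p" "snd p \<le> l j" "norm h = snd p" "2 * 2 powr s * \<epsilon> * snd p powr s < \<bar>diffpow r h f (fst p)\<bar>"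
      using p(1) unfolding Sset_eq strip by auto
    define y where "y = snd p"
    define y' where "y' = snd z"
    have "l j \<le> 1" unfolding l_def by (rule power_le_one) auto
    then have y: "y > 0" "y' > 0" "y \<le> 1" using h z l0[of j] unfolding y_def y'_def by linarith+
    \<comment> \<open>The step at \<open>z\<close> keeps the direction of \<open>h\<close> and takes
      the height of \<open>z\<close> as its length, as membership in \<open>Sset\<close>
      demands.\<close>
    define h' where "h' = (y' / y) *\<^sub>R h"
    have nh': "norm h' = y'" using y h by (simp add: h'_def y_def)
    have dl: "d * l j \<le> 2 * d * y"
      using mult_left_mono[of "l j" "2 * y" d] h d by (simp add: y_def)
    have zp: "\<bar>fst z $ i - fst p $ i\<bar> < d * l j" "\<bar>y' - y\<bar> < d * l j" for i
      using p(2) by (auto simp: mem_ocube_prod y_def y'_def)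
    have "norm (fst p - fst z) \<le> (\<Sum>i\<in>UNIV. \<bar>(fst p - fst z) $ i\<bar>)" by (rule norm_le_l1_cart)
    also have "\<dots> \<le> (\<Sum>i\<in>(UNIV::'n set). d * l j)" using zp(1) by (intro sum_mono) (simp add: abs_minus_commute less_imp_le)
    also have "\<dots> = n * (d * l j)" by (simp add: n_def)
    also have "\<dots> \<le> n * (2 * d * y)" using dl n1 by (intro mult_left_mono) auto
    also have "\<dots> = 2 * (n * d) * y" by simp
    also have "\<dots> \<le> \<delta> * y" using dn y by (intro mult_right_mono) auto
    finally have 1: "norm (fst p - fst z) \<le> \<delta> * norm h" using h by (simp add: y_def)
    have "h - h' = (1 - y' / y) *\<^sub>R h" by (simp add: h'_def scaleR_diff_left)
    then have "norm (h - h') = \<bar>1 - y' / y\<bar> * y" using h by (simp add: y_def)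
    also have "\<dots> = \<bar>y - y'\<bar>" using y by (simp add: abs_mult[symmetric, of _ y] abs_of_pos[symmetric] field_simps flip: abs_mult)
    also have "\<dots> \<le> 2 * d * y" using zp(2) dl by linarith
    also have "\<dots> \<le> \<delta> * y" using d2 y by (intro mult_right_mono) auto
    finally have 2: "norm (h - h') \<le> \<delta> * norm h" using h by (simp add: y_def)
    have "\<bar>diffpow r h f (fst p) - diffpow r h' f (fst z)\<bar> \<le> \<tau> * norm h powr s"
      by (rule \<delta>(3)[OF _ _ 1 2]) (use h y in \<open>auto simp: y_def\<close>)
    then have "2 * 2 powr s * \<epsilon> * y powr s - \<tau> * y powr s < \<bar>diffpow r h' f (fst z)\<bar>"
      using h(4) unfolding h(3) y_def by linarith
    then have "2 powr s * \<epsilon> * y powr s < \<bar>diffpow r h' f (fst z)\<bar>" by (simp add: \<tau>_def algebra_simps)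
    moreover have "\<epsilon> * y' powr s \<le> 2 powr s * \<epsilon> * y powr s"
    proof -
      have "y' \<le> 2 * y" using z h by (simp add: y_def y'_def)
      then have "y' powr s \<le> (2 * y) powr s" using y s0 by (intro powr_mono2) auto
      then have "\<epsilon> * y' powr s \<le> \<epsilon> * (2 powr s * y powr s)" using \<epsilon> y by (intro mult_left_mono) (auto simp: powr_mult)
      then show ?thesis by (simp add: mult_ac)
    qed
    ultimately have "\<epsilon> * snd z powr s < \<bar>diffpow r h' f (fst z)\<bar>" by (simp add: y'_def)
    then show "z \<in> Sset r j s f \<epsilon>" unfolding Sset_eq strip using z nh'
      by (cases z) (auto simp: y'_def)
  qed
  have okB: "setseq_ok B" unfolding setseq_ok_def
  proof (intro allI conjI)
    fix j
    show "B j \<subseteq> Hplus" using l0[of j] by (auto simp: B_def Hplus_def)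
    have "{z :: (real^'n) \<times> real. snd z \<in> {l j / 2 <.. l j}} = {z. l j / 2 < snd z} \<inter> {z. snd z \<le> l j}" by auto
    also have "\<dots> \<in> sets borel"
      by (intro sets.Int borel_open borel_closed open_Collect_less closed_Collect_le continuous_intros)
    finally have "{z :: (real^'n) \<times> real. snd z \<in> {l j / 2 <.. l j}} \<in> sets borel" .
    moreover have "(\<Union>p\<in>Sset r j s f (2 * 2 powr s * \<epsilon>). ocube p (d * l j)) \<in> sets borel"
      unfolding ocube_eq_box by (intro borel_open open_UN ballI open_box)
    ultimately show "B j \<in> sets lebesgue" unfolding B_def by (intro borel_in_lebesgue sets.Int)
  qed
  have denseB: "dense_seq B"
  proof (rule \<theta>(3)[of "d / 4", OF _ okB])
    fix j and z :: "(real^'n) \<times> real" assume "z \<in> B j"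
    then obtain p where z: "l j / 2 < snd z" "snd z \<le> l j" and p: "p \<in> Sset r j s f (2 * 2 powr s * \<epsilon>)" "z \<in> ocube p (d * l j)"
      by (auto simp: B_def)
    have ps: "l j / 2 < snd p" "snd p \<le> l j" using p(1) unfolding Sset_eq strip by auto
    define t where "t = d * l j / 4"
    have t: "t > 0" "t \<le> l j / 16"
    proof -
      show "t > 0" using d l0[of j] by (simp add: t_def)
      have "d \<le> 1/4" using d(2) \<theta>(2) by linarith
      then have "d * l j \<le> 1/4 * l j" using l0[of j] by (intro mult_right_mono) auto
      then show "t \<le> l j / 16" by (simp add: t_def)
    qed
    \<comment> \<open>The cube is placed around \<open>p\<close>, whose neighbourhood within the
      strip belongs to \<open>B j\<close>, rather than around \<open>z\<close>, which may lie at the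
      edge; only the height is moved, to stay in the strip.\<close>
    define q where "q = (fst p, if snd p < 3/4 * l j then snd p + t else snd p - t)"
    have t4: "d * l j = 4 * t" by (simp add: t_def)
    have \<theta>y: "8 * t \<le> \<theta> * snd z"
    proof -
      have "8 * t = 2 * d * l j" by (simp add: t_def)
      also have "\<dots> \<le> 2 * (\<theta> / 4) * l j" using d(2) l0[of j] by (intro mult_right_mono) auto
      also have "\<dots> = \<theta> * (l j / 2)" by simp
      also have "\<dots> \<le> \<theta> * snd z" using z \<theta>(1) by (intro mult_left_mono) auto
      finally show ?thesis .
    qed
    have "ocube q t \<subseteq> B j \<inter> ocube z (\<theta> * snd z)"
    proof
      fix w assume w: "w \<in> ocube q t"
      have wi: "\<bar>fst w $ i - fst p $ i\<bar> < t" for i using w by (simp add: mem_ocube_prod q_def)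
      have wy: "\<bar>snd w - (if snd p < 3/4 * l j then snd p + t else snd p - t)\<bar> < t" using w by (simp add: mem_ocube_prod q_def)
      have wy2: "l j / 2 < snd w" "snd w \<le> l j" "\<bar>snd w - snd p\<bar> < 2 * t"
        using wy ps t l0[of j] by (auto split: if_splits)
      have zi: "\<bar>fst z $ i - fst p $ i\<bar> < 4 * t" "\<bar>snd z - snd p\<bar> < 4 * t" for i
        using p(2) by (auto simp: mem_ocube_prod t4)
      have "\<bar>fst w $ i - fst p $ i\<bar> < 4 * t" for i using wi[of i] t by linarith
      then have "w \<in> ocube p (d * l j)" using wy2 t by (simp add: mem_ocube_prod t4)
      then have "w \<in> B j" using wy2 p(1) by (auto simp: B_def)
      moreover have "\<bar>fst w $ i - fst z $ i\<bar> < \<theta> * snd z" for i using wi[of i] zi(1)[of i] \<theta>y t by linarith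
      moreover have "\<bar>snd w - snd z\<bar> < \<theta> * snd z" using wy2 zi(2) \<theta>y t by linarith
      ultimately show "w \<in> B j \<inter> ocube z (\<theta> * snd z)" by (simp add: mem_ocube_prod)
    qed
    moreover have "ocube q (d / 4 * snd z) \<subseteq> ocube q t"
      using z d mult_left_mono[of "snd z" "l j" "d/4"] by (intro ocube_mono) (simp add: t_def)
    ultimately show "\<exists>q. ocube q (d / 4 * snd z) \<subseteq> B j \<inter> ocube z (\<theta> * snd z)" by blast
  qed (use d in simp)
  have "\<nu> B < \<infinity>" by (rule nu_mono[OF okB setseq_ok_Sset[OF cf] sub2 fin])
  then have "\<nu> (\<lambda>j. hnbhd (B j) R) < \<infinity>" by (rule nu_fatten[OF okB denseB _ R])
  moreover have "A j \<subseteq> hnbhd (B j) R" for j using sub1[of j] unfolding A_def hnbhd_def by blast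
  ultimately show "\<nu> A < \<infinity>" by (intro nu_mono[OF okA setseq_ok_hnbhd[OF okB R]]) auto
qed

section \<open>The upper bound for the distance\<close>

lemma nu1_cubes:
  assumes "\<And>I. I \<in> \<A> \<Longrightarrow> fst I = 0"
  shows "nu1 \<nu> (\<Union>I\<in>\<A>. Tbox I) = \<nu> (\<lambda>j. \<Union>I\<in>{I\<in>\<A>. fst I = j}. Tbox I)"
proof -
  have e0: "{I\<in>\<A>. fst I = 0} = \<A>" and e1: "j \<noteq> 0 \<Longrightarrow> {I\<in>\<A>. fst I = j} = {}" for j using assms by auto
  have "(if j = 0 then (\<Union>I\<in>\<A>. Tbox I) else {}) = (\<Union>I\<in>{I\<in>\<A>. fst I = j}. Tbox I)" for j
  proof (cases "j = 0")
    case True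
    show ?thesis unfolding True e0 by simp
  next
    case False
    show ?thesis unfolding e1[OF False] using False by simp
  qed
  then show ?thesis unfolding nu1_def by simp
qed

lemma lev_diff: "lev (\<lambda>\<omega>. c \<omega> - b \<omega>) j x = lev c j x - lev b j x"
  by (simp add: lev_def left_diff_distrib sum_subtractf)

text \<open>Contrapositive of \<open>coef_local_bound\<close> with
  \<open>E = \<epsilon> * 2 powr (- real j * s)\<close>: near the cube some step of length between
  \<open>c\<close> and 1 times the side has a large difference, and its strip is at most
  \<open>m\<close> levels finer because \<open>(1/2) ^ m < c\<close>.\<close>

lemma large_coef_near_Sset:
  obtains C m R where "C > 0" "R > 0" "\<And>f \<epsilon> j l k. f \<in> Lambda s \<Longrightarrow> \<epsilon> > 0 \<Longrightarrow> (l, (j, k)) \<in> Omega \<Longrightarrow> l \<noteq> 0 \<Longrightarrow>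
    C * \<epsilon> * 2 powr (- real j * (s + real CARD('n) / 2)) < \<bar>coef f (l, (j, k))\<bar> \<Longrightarrow> Tbox (j, k) \<subseteq> (\<Union>i\<in>{i. gap i j \<le> m}. hnbhd (Sset r i s f \<epsilon>) R)"
proof -
  obtain C c \<rho> where C: "C > 0" "c > 0" "c \<le> 1" "\<rho> > 0"
    "\<And>f \<omega> E. continuous_on UNIV f \<Longrightarrow> \<omega> \<in> Omega \<Longrightarrow> fst \<omega> \<noteq> 0 \<Longrightarrow> 0 \<le> E \<Longrightarrow>
      (\<And>x h. norm (2 ^ lv \<omega> *\<^sub>R x - intvec (snd (snd \<omega>))) \<le> \<rho> \<Longrightarrow> c \<le> 2 ^ lv \<omega> * norm h \<Longrightarrow> 2 ^ lv \<omega> * norm h \<le> 1 \<Longrightarrow>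
        \<bar>diffpow r h f x\<bar> \<le> E) \<Longrightarrow>
      \<bar>L2inner f (W \<omega>)\<bar> \<le> C * 2 powr (- real (lv \<omega>) * real CARD('n) / 2) * E"
    using coef_local_bound[OF r1 rL] by blast
  obtain m where m: "(1/2::real) ^ m < c" using real_arch_pow_inv[of c "1/2"] C(2) by auto
  define n where "n = real CARD('n)"
  have c2: "c / 2 > 0" using C by simp
  \<comment> \<open>In units of the side \<open>t\<close> of the cube: horizontal distance at most
    \<open>n + \<rho>\<close>, vertical distance at most 1, and heights at least \<open>1/2\<close>
    and \<open>c\<close>.\<close>
  obtain R where R: "R > 0" "\<And>(p :: (real^'n) \<times> real) q t. p \<in> Hplus \<Longrightarrow> q \<in> Hplus \<Longrightarrow> t > 0 \<Longrightarrow>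
      norm (p - q) \<le> (n + \<rho> + 1) * t \<Longrightarrow> c / 2 * t\<^sup>2 \<le> snd p * snd q \<Longrightarrow> hrho p q < R"
    using hrho_radius[OF c2] by blast
  show ?thesis
  proof (rule that[OF C(1) R(1), of m])
    fix f :: "real^'n \<Rightarrow> real" and \<epsilon> j l k
    assume f: "f \<in> Lambda s" and \<epsilon>: "\<epsilon> > 0" and o: "(l, (j, k)) \<in> Omega" "l \<noteq> 0"
      and big: "C * \<epsilon> * 2 powr (- real j * (s + real CARD('n) / 2)) < \<bar>coef f (l, (j, k))\<bar>"
    have cf: "continuous_on UNIV f" using f by (simp add: Lambda_def)
    define t where "t = (1/2::real) ^ j"
    have t: "t > 0" "2 ^ j * t = 1" by (auto simp: t_def power_one_over)
    have pd: "2 powr (- real j * real CARD('n) / 2) * 2 powr (- real j * s) = 2 powr (- real j * (s + real CARD('n) / 2))"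
      by (simp add: powr_add[symmetric] algebra_simps)
    have "\<exists>x h. norm (2 ^ j *\<^sub>R x - intvec k) \<le> \<rho> \<and> c \<le> 2 ^ j * norm h \<and> 2 ^ j * norm h \<le> 1 \<and>
        \<epsilon> * 2 powr (- real j * s) < \<bar>diffpow r h f x\<bar>"
    proof (rule ccontr)
      assume "\<not> ?thesis"
      then have "\<bar>L2inner f (W (l, (j, k)))\<bar> \<le> C * 2 powr (- real (lv (l, (j, k))) * real CARD('n) / 2) * (\<epsilon> * 2 powr (- real j * s))"
        using \<epsilon> o by (intro C(5)[OF cf]) (auto simp: not_less)
      also have "\<dots> = C * \<epsilon> * (2 powr (- real j * real CARD('n) / 2) * 2 powr (- real j * s))" by simp
      finally show False using big unfolding pd coef_def by simp
    qed
    then obtain x h where xh: "norm (2 ^ j *\<^sub>R x - intvec k) \<le> \<rho>" "c \<le> 2 ^ j * norm h" "2 ^ j * norm h \<le> 1"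
        "\<epsilon> * 2 powr (- real j * s) < \<bar>diffpow r h f x\<bar>" by blast
    define y where "y = norm h"
    have yt: "c * t \<le> y" "y \<le> t"
    proof -
      have "c * t \<le> (2 ^ j * y) * t" "(2 ^ j * y) * t \<le> 1 * t"
        using xh t unfolding y_def by (intro mult_right_mono; simp)+
      moreover have "(2 ^ j * y) * t = y" using t(2) by (metis mult.assoc mult.commute mult_1)
      ultimately show "c * t \<le> y" "y \<le> t" by auto
    qed
    have ct: "c * t > 0" using C t by simp
    have y0: "y > 0" using yt ct by linarith
    have "t \<le> 1" unfolding t_def by (rule power_le_one) auto
    then have y1: "y \<le> 1" using yt by linarith
    obtain i where i: "(1/2) ^ (i + 1) < y" "y \<le> (1/2) ^ i" using dyadic_scale[OF y0 y1] by blast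
    have "(1/2::real) ^ (i + 1) < (1/2) ^ j" using i yt by (simp add: t_def)
    then have "j < i + 1" by (simp only: power_strict_decreasing_iff)
    moreover have "(1/2::real) ^ (m + j) < (1/2) ^ i"
    proof -
      have "(1/2::real) ^ (m + j) = (1/2) ^ m * t" by (simp add: t_def power_add)
      also have "\<dots> < c * t" using m t by (intro mult_strict_right_mono) auto
      finally show ?thesis using yt i by linarith
    qed
    then have "i < m + j" by (simp only: power_strict_decreasing_iff)
    ultimately have g: "gap i j \<le> m" by (auto simp: gap_def)
    have "y powr s \<le> t powr s" using y0 yt s0 by (intro powr_mono2) auto
    also have "t powr s = 2 powr (- real j * s)"
    proof -
      have "t = 2 powr (- real j)" unfolding t_def by (simp add: powr_minus powr_realpow power_one_over inverse_eq_divide)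
      then show ?thesis by (simp add: powr_powr)
    qed
    finally have "\<epsilon> * y powr s \<le> \<epsilon> * 2 powr (- real j * s)" using \<epsilon> by (intro mult_left_mono) auto
    then have "\<epsilon> * y powr s < \<bar>diffpow r h f x\<bar>" using xh(4) by linarith
    then have pS: "(x, y) \<in> Sset r i s f \<epsilon>" unfolding Sset_eq using i y_def by (auto simp del: power_Suc)
    have pH: "(x, y) \<in> Hplus" using y0 by (simp add: Hplus_def)
    have "Tbox (j, k) \<subseteq> hnbhd (Sset r i s f \<epsilon>) R"
    proof
      fix z assume z: "z \<in> Tbox (j, k)"
      then have zH: "z \<in> Hplus" using Tbox_Hplus by blast
      have zc: "fst z \<in> cube (j, k)" "t / 2 < snd z" "snd z \<le> t" using z by (auto simp: Tbox_def side_def t_def)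
      have "norm (2 ^ j *\<^sub>R fst z - intvec k) \<le> (\<Sum>i\<in>UNIV. \<bar>(2 ^ j *\<^sub>R fst z - intvec k) $ i\<bar>)" by (rule norm_le_l1_cart)
      also have "\<dots> \<le> (\<Sum>i\<in>(UNIV::'n set). 1)"
      proof (rule sum_mono)
        fix i
        have "k $ i = \<lfloor>2 ^ j * fst z $ i\<rfloor>" using zc(1) unfolding cube_iff by (simp add: floorvec_def)
        then show "\<bar>(2 ^ j *\<^sub>R fst z - intvec k) $ i\<bar> \<le> 1" by (simp add: intvec_def) linarith
      qed
      finally have n: "norm (2 ^ j *\<^sub>R fst z - intvec k) \<le> n" by (simp add: n_def)
      have "2 ^ j *\<^sub>R (fst z - x) = (2 ^ j *\<^sub>R fst z - intvec k) - (2 ^ j *\<^sub>R x - intvec k)" by (simp add: algebra_simps)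
      then have "norm (2 ^ j *\<^sub>R (fst z - x)) \<le> n + \<rho>" using n xh(1) norm_triangle_ineq4 by (smt (verit))
      then have "2 ^ j * norm (fst z - x) \<le> n + \<rho>" by simp
      then have "(2 ^ j * norm (fst z - x)) * t \<le> (n + \<rho>) * t" using t by (intro mult_right_mono) auto
      moreover have "(2 ^ j * norm (fst z - x)) * t = norm (fst z - x)" using t(2) by (metis mult.assoc mult.commute mult_1)
      ultimately have d1: "norm (fst z - x) \<le> (n + \<rho>) * t" by simp
      have d2: "norm (snd z - y) \<le> t" using zc yt y0 t by (auto simp: abs_le_iff)
      have "norm (z - (x, y)) \<le> (n + \<rho> + 1) * t"
        using norm_prod_diff_le[of z "(x, y)"] d1 d2 by (simp add: algebra_simps)
      moreover have "c / 2 * t\<^sup>2 \<le> snd z * snd (x, y)"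
      proof -
        have "(t / 2) * (c * t) \<le> snd z * y" using zc yt ct t by (intro mult_mono) auto
        then show ?thesis by (simp add: power2_eq_square mult_ac)
      qed
      ultimately have "hrho z (x, y) < R" by (rule R(2)[OF zH pH t(1)])
      then show "z \<in> hnbhd (Sset r i s f \<epsilon>) R" using zH pS by (auto simp: hnbhd_def)
    qed
    then show "Tbox (j, k) \<subseteq> (\<Union>i\<in>{i. gap i j \<le> m}. hnbhd (Sset r i s f \<epsilon>) R)" using g by blast
  qed
qed

lemma dist_upper_bound:
  obtains D where "D > 0" "\<And>f \<epsilon>. f \<in> Lambda s \<Longrightarrow> \<epsilon> > 0 \<Longrightarrow> \<nu> (\<lambda>j. Sset r j s f \<epsilon>) < \<infinity> \<Longrightarrow>
    nu1 \<nu> (\<Union>I\<in>V0 \<phi> \<psi> f \<epsilon>. Tbox I) < \<infinity> \<Longrightarrow> Lambda_dist s f (LambdaX s X \<phi> \<psi>) \<le> ereal (D * \<epsilon>)"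
proof -
  show ?thesis
  proof (rule large_coef_near_Sset)
    fix C m R
    assume C: "C > 0" "R > 0" "\<And>f \<epsilon> j l k. f \<in> Lambda s \<Longrightarrow> \<epsilon> > 0 \<Longrightarrow> (l, (j, k)) \<in> Omega \<Longrightarrow> l \<noteq> 0 \<Longrightarrow>
      C * \<epsilon> * 2 powr (- real j * (s + real CARD('n) / 2)) < \<bar>coef f (l, (j, k))\<bar> \<Longrightarrow> Tbox (j, k) \<subseteq> (\<Union>i\<in>{i. gap i j \<le> m}. hnbhd (Sset r i s f \<epsilon>) R)"
    obtain K where K: "K > 0" "\<And>(f :: real^'n \<Rightarrow> real) M. f \<in> Lambda s \<Longrightarrow> Lambda_norm s f \<le> ereal M \<Longrightarrow>
       coef_bound s (K * M) (coef f) \<and> synth (coef f) = f \<and> 0 \<le> M" using Lambda_expansion by blast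
    obtain K' where K': "K' > 0" "\<And>M c. coef_bound s M c \<Longrightarrow> 0 \<le> M \<Longrightarrow> synth c \<in> Lambda s \<and> Lambda_norm s (synth c) \<le> ereal (K' * M)"
      using synth_Lambda by blast
    \<comment> \<open>The loss of threshold in \<open>nu_Sset_fatten\<close>.\<close>
    define a where "a = 2 * 2 powr s"
    have a0: "a > 0" by (simp add: a_def)
    define D where "D = C * a + 1"
    have D0: "D > 0" using C a0 by (simp add: D_def add_pos_pos)
    have "Lambda_dist s f (LambdaX s X \<phi> \<psi>) \<le> ereal (K' * D * \<epsilon>)"
      if f: "f \<in> Lambda s" and \<epsilon>: "\<epsilon> > 0" and fin: "\<nu> (\<lambda>j. Sset r j s f \<epsilon>) < \<infinity>"
        and fin0: "nu1 \<nu> (\<Union>I\<in>V0 \<phi> \<psi> f \<epsilon>. Tbox I) < \<infinity>" for f \<epsilon>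
    proof -
      obtain M where M: "M \<ge> 0" "Lambda_norm s f = ereal M" using Lambda_norm_real[of s f] f by (auto simp: Lambda_def)
      have cb: "coef_bound s (K * M) (coef f)" "synth (coef f) = f" using K(2)[OF f] M by auto
      have KM: "K * M \<ge> 0" using K M by simp
      \<comment> \<open>Hard thresholding with two thresholds: \<open>\<epsilon>\<close> for the
        scaling coefficients, matching \<open>V0\<close>, and \<open>C * (a * \<epsilon>)\<close>
        for the normalised wavelet coefficients, matching \<open>large_coef_near_Sset\<close> at
        threshold \<open>a * \<epsilon>\<close>. The summand 1 in \<open>D\<close> covers the
        former.\<close>
      define sel where "sel \<omega> \<longleftrightarrow> (if fst \<omega> = 0 then \<epsilon> < \<bar>coef f \<omega>\<bar> else C * (a * \<epsilon>) * 2 powr (- real (lv \<omega>) * (s + real CARD('n) / 2)) < \<bar>coef f \<omega>\<bar>)"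
        for \<omega> :: "nat \<times> (nat \<times> (int^'n))"
      define b where "b \<omega> = (if sel \<omega> then coef f \<omega> else 0)" for \<omega>
      have cbb: "coef_bound s (K * M) b"
        using cb(1) KM unfolding coef_bound_def b_def by auto
      have cbd: "coef_bound s (D * \<epsilon>) (\<lambda>\<omega>. coef f \<omega> - b \<omega>)"
        unfolding coef_bound_def
      proof
        fix \<omega> :: "nat \<times> (nat \<times> (int^'n))" assume \<omega>: "\<omega> \<in> Omega"
        have nn: "0 \<le> D * \<epsilon> * 2 powr (- real (lv \<omega>) * (s + real CARD('n) / 2))" using D0 \<epsilon> by simp
        show "\<bar>coef f \<omega> - b \<omega>\<bar> \<le> D * \<epsilon> * 2 powr (- real (lv \<omega>) * (s + real CARD('n) / 2))"
        proof (cases "sel \<omega>")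
          case True
          then show ?thesis using nn by (simp add: b_def)
        next
          case False
          show ?thesis
          proof (cases "fst \<omega> = 0")
            case True
            then have l0: "lv \<omega> = 0" using \<omega> by (auto simp: Omega_def)
            have "1 * \<epsilon> \<le> D * \<epsilon>" using C a0 \<epsilon> by (intro mult_right_mono) (auto simp: D_def)
            then show ?thesis using False True by (simp add: b_def sel_def l0)
          next
            case nz: False
            have "\<bar>coef f \<omega>\<bar> \<le> C * (a * \<epsilon>) * 2 powr (- real (lv \<omega>) * (s + real CARD('n) / 2))" using False nz by (simp add: sel_def)
            also have "\<dots> = (C * a) * \<epsilon> * 2 powr (- real (lv \<omega>) * (s + real CARD('n) / 2))" by simp
            also have "\<dots> \<le> D * \<epsilon> * 2 powr (- real (lv \<omega>) * (s + real CARD('n) / 2))" using \<epsilon> by (intro mult_right_mono) (auto simp: D_def)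
            finally show ?thesis using False by (simp add: b_def)
          qed
        qed
      qed
      have De: "0 \<le> D * \<epsilon>" using D0 \<epsilon> by simp
      define g where "g = synth b"
      have gL: "g \<in> Lambda s" using K'(2)[OF cbb KM] by (simp add: g_def)
      have fg: "(\<lambda>x. f x - g x) = synth (\<lambda>\<omega>. coef f \<omega> - b \<omega>)"
      proof
        fix x
        have "(\<lambda>j. lev (coef f) j x - lev b j x) sums (synth (coef f) x - synth b x)"
          by (intro sums_diff synth_sums[OF _ s0 KM] cb cbb)
        moreover have "(\<lambda>j. lev (\<lambda>\<omega>. coef f \<omega> - b \<omega>) j x) sums synth (\<lambda>\<omega>. coef f \<omega> - b \<omega>) x"
          by (rule synth_sums[OF cbd s0 De])
        ultimately show "f x - g x = synth (\<lambda>\<omega>. coef f \<omega> - b \<omega>) x"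
          unfolding lev_diff cb(2) g_def by (rule sums_unique2)
      qed
      have coefg: "coef g \<omega> = b \<omega>" if "\<omega> \<in> Omega" for \<omega>
        unfolding coef_def g_def by (rule synth_coef[OF cbb s0 KM that])
      define \<A> where "\<A> = {I. \<exists>l. (l, I) \<in> Omega \<and> b (l, I) \<noteq> 0}"
      define S where "S j = hnbhd (Sset r j s f (2 * 2 powr s * \<epsilon>)) R" for j
      have S: "setseq_ok S" "\<nu> S < \<infinity>" unfolding S_def by (rule nu_Sset_fatten[OF f \<epsilon> fin C(2)])+
      have Win: "setseq_ok (\<lambda>j. \<Union>i\<in>{i. gap i j \<le> m}. S i)" "\<nu> (\<lambda>j. \<Union>i\<in>{i. gap i j \<le> m}. S i) < \<infinity>"
        using nu_window[OF S] by auto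
      define V where "V = V0 \<phi> \<psi> f \<epsilon>"
      have V0: "fst I = 0" if "I \<in> V" for I using that by (simp add: V_def V0_def)
      have finV: "\<nu> (\<lambda>j. \<Union>I\<in>{I\<in>V. fst I = j}. Tbox I) < \<infinity>" using fin0 nu1_cubes[OF V0] by (simp add: V_def)
      have okV: "setseq_ok (\<lambda>j. \<Union>I\<in>{I\<in>V. fst I = j}. Tbox I)" by (rule setseq_ok_Tbox)
      have sub: "(\<Union>I\<in>{I\<in>\<A>. fst I = j}. Tbox I) \<subseteq> (\<Union>i\<in>{i. gap i j \<le> m}. S i) \<union> (\<Union>I\<in>{I\<in>V. fst I = j}. Tbox I)" for j
      proof (rule UN_least)
        fix I assume "I \<in> {I\<in>\<A>. fst I = j}"
        then obtain l k where I: "I = (j, k)" "(l, (j, k)) \<in> Omega" "b (l, (j, k)) \<noteq> 0"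
          unfolding \<A>_def by (cases I) auto
        then have sel: "sel (l, (j, k))" by (auto simp: b_def split: if_splits)
        show "Tbox I \<subseteq> (\<Union>i\<in>{i. gap i j \<le> m}. S i) \<union> (\<Union>I\<in>{I\<in>V. fst I = j}. Tbox I)"
        proof (cases "l = 0")
          case True
          then have "I \<in> V" using sel I by (auto simp: V_def V0_def sel_def coef_def Omega_def)
          then show ?thesis using I by auto
        next
          case False
          then have "C * (a * \<epsilon>) * 2 powr (- real j * (s + real CARD('n) / 2)) < \<bar>coef f (l, (j, k))\<bar>" using sel by (simp add: sel_def)
          from C(3)[OF f _ I(2) False this] a0 \<epsilon> show ?thesis unfolding I(1) S_def a_def by (auto simp: mult_pos_pos)
        qed
      qed
      have "\<nu> (\<lambda>j. \<Union>I\<in>{I\<in>\<A>. fst I = j}. Tbox I) < \<infinity>"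
        by (rule nu_mono[OF setseq_ok_Tbox setseq_ok_Un[OF Win(1) okV] sub nu_union[OF Win(1) okV Win(2) finV]])
      then have XA: "X (cubeseq \<A>) < \<infinity>" unfolding nu_cubes_iff .
      have "coef_bound s (K * M) (coef g)" using cbb coefg unfolding coef_bound_def by auto
      then have "X (coefseq (coef g)) < \<infinity>"
      proof (rule X_coefseq_finite[OF _ KM _ XA])
        fix \<omega> :: "nat \<times> (nat \<times> (int^'n))" assume "\<omega> \<in> Omega" "coef g \<omega> \<noteq> 0"
        then show "snd \<omega> \<in> \<A>" using coefg[of \<omega>] unfolding \<A>_def by (cases \<omega>) auto
      qed
      then have gX: "g \<in> LambdaX s X \<phi> \<psi>" using gL by (simp add: LambdaX_iff)
      have "Lambda_dist s f (LambdaX s X \<phi> \<psi>) \<le> Lambda_norm s (\<lambda>x. f x - g x)"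
        unfolding Lambda_dist_def by (rule INF_lower) (use gX gL in auto)
      also have "\<dots> \<le> ereal (K' * (D * \<epsilon>))" unfolding fg using K'(2)[OF cbd De] by simp
      finally show ?thesis by (simp add: mult.assoc)
    qed
    then show ?thesis using that[of "K' * D"] K' D0 by auto
  qed
qed

section \<open>The lower bound for the distance\<close>

lemma LambdaX_nu_finite:
  assumes g: "g \<in> LambdaX s X \<phi> \<psi>" and \<epsilon>: "\<epsilon> > 0"
  shows "\<nu> (\<lambda>j. Sset r j s g \<epsilon>) < \<infinity>" "nu1 \<nu> (\<Union>I\<in>V0 \<phi> \<psi> g \<epsilon>. Tbox I) < \<infinity>"
proof -
  have gL: "g \<in> Lambda s" and gX: "X (coefseq (coef g)) < \<infinity>" using g by (auto simp: LambdaX_iff)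
  have cg: "continuous_on UNIV g" using gL by (simp add: Lambda_def)
  \<comment> \<open>On level 0 the normalising weight is 1, so membership in \<open>V0\<close> is
    already the threshold condition of \<open>X_cubeseq_finite\<close>.\<close>
  have "X (cubeseq (V0 \<phi> \<psi> g \<epsilon>)) < \<infinity>"
  proof (rule X_cubeseq_finite[OF gX \<epsilon>])
    fix I :: "nat \<times> (int^'n)" assume "I \<in> V0 \<phi> \<psi> g \<epsilon>"
    then show "\<exists>l. (l, I) \<in> Omega \<and> \<epsilon> * 2 powr (- real (fst I) * (s + real CARD('n) / 2)) < \<bar>coef g (l, I)\<bar>"
      by (intro exI[of _ 0]) (auto simp: V0_def coef_def Omega_def)
  qed
  then show "nu1 \<nu> (\<Union>I\<in>V0 \<phi> \<psi> g \<epsilon>. Tbox I) < \<infinity>"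
    unfolding nu_cubes_iff[symmetric] by (subst nu1_cubes) (auto simp: V0_def)
  obtain K where K: "K > 0" "\<And>(f :: real^'n \<Rightarrow> real) M. f \<in> Lambda s \<Longrightarrow> Lambda_norm s f \<le> ereal M \<Longrightarrow>
     coef_bound s (K * M) (coef f) \<and> synth (coef f) = f \<and> 0 \<le> M" using Lambda_expansion by blast
  obtain M where M: "M \<ge> 0" "Lambda_norm s g = ereal M" using Lambda_norm_real[of s g] gL by (auto simp: Lambda_def)
  have cb: "coef_bound s (K * M) (coef g)" "synth (coef g) = g" using K(2)[OF gL] M by auto
  have KM: "K * M \<ge> 0" using K M by simp
  show "\<nu> (\<lambda>j. Sset r j s g \<epsilon>) < \<infinity>"
  proof (rule large_difference_large_coef[OF cb(1) KM \<epsilon>])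
    fix m \<eta>
    assume m': "\<eta> > 0" "\<And>x h J. (1/2) ^ (J + 1) < norm h \<Longrightarrow> norm h \<le> (1/2) ^ J \<Longrightarrow>
        \<epsilon> * norm h powr s < \<bar>diffpow r h (synth (coef g)) x\<bar> \<Longrightarrow>
        \<exists>\<omega>\<in>Omega. gap (lv \<omega>) J \<le> m \<and> \<eta> * 2 powr (- real (lv \<omega>) * (s + real CARD('n) / 2)) < \<bar>coef g \<omega>\<bar> \<and>
          norm (2 ^ lv \<omega> *\<^sub>R x - intvec (snd (snd \<omega>))) \<le> \<rho>0 + real r * 2 ^ m"
    note m = m'[unfolded cb(2)]
    define \<A> where "\<A> = {I. \<exists>l. (l, I) \<in> Omega \<and> \<eta> * 2 powr (- real (fst I) * (s + real CARD('n) / 2)) < \<bar>coef g (l, I)\<bar>}"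
    define T where "T j = (\<Union>I\<in>{I\<in>\<A>. fst I = j}. Tbox I)" for j
    have "X (cubeseq \<A>) < \<infinity>" by (rule X_cubeseq_finite[OF gX m(1)]) (simp add: \<A>_def)
    then have T: "\<nu> T < \<infinity>" unfolding T_def nu_cubes_iff .
    have okT: "setseq_ok T" unfolding T_def by (rule setseq_ok_Tbox)
    have dT: "dense_seq T" unfolding T_def by (rule dense_seq_Tbox)
    \<comment> \<open>In units of the side \<open>t\<close> of the cube: horizontal distance at most
      \<open>\<rho>0 + real r * 2 ^ m\<close>, vertical distance at most
      \<open>2 ^ m + 1\<close>.\<close>
    define a where "a = \<rho>0 + real r * 2 ^ m + 2 ^ m + 1"
    \<comment> \<open>A strip \<open>j <= i + m\<close> has all heights above
      \<open>(1/2) ^ (i + m + 1)\<close>, which is \<open>e * t\<close>.\<close>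
    define e where "e = (1/2::real) ^ (m + 1)"
    have e: "e > 0" by (simp add: e_def)
    obtain R where R: "R > 0" "\<And>(p :: (real^'n) \<times> real) q t. p \<in> Hplus \<Longrightarrow> q \<in> Hplus \<Longrightarrow> t > 0 \<Longrightarrow>
        norm (p - q) \<le> a * t \<Longrightarrow> e * t\<^sup>2 \<le> snd p * snd q \<Longrightarrow> hrho p q < R"
      using hrho_radius[OF e] by blast
    define H where "H j = hnbhd (T j) R" for j
    have H: "setseq_ok H" "\<nu> H < \<infinity>" unfolding H_def
      by (intro setseq_ok_hnbhd okT R nu_fatten dT T)+
    have Win: "setseq_ok (\<lambda>j. \<Union>i\<in>{i. gap i j \<le> m}. H i)" "\<nu> (\<lambda>j. \<Union>i\<in>{i. gap i j \<le> m}. H i) < \<infinity>"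
      using nu_window[OF H] by auto
    have sub: "Sset r j s g \<epsilon> \<subseteq> (\<Union>i\<in>{i. gap i j \<le> m}. H i)" for j
    proof
      fix z assume z: "z \<in> Sset r j s g \<epsilon>"
      define x where "x = fst z"
      define y where "y = snd z"
      obtain h where h: "(1/2) ^ (j + 1) < y" "y \<le> (1/2) ^ j" "norm h = y" "\<epsilon> * y powr s < \<bar>diffpow r h g x\<bar>"
        using z unfolding Sset_eq x_def y_def by auto
      have zH: "z \<in> Hplus" using z setseq_ok_Sset[OF cg] unfolding setseq_ok_def by blast
      have y0: "y > 0" using zH by (simp add: Hplus_def y_def)
      obtain \<omega> where \<omega>: "\<omega> \<in> Omega" "gap (lv \<omega>) j \<le> m" "\<eta> * 2 powr (- real (lv \<omega>) * (s + real CARD('n) / 2)) < \<bar>coef g \<omega>\<bar>"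
          "norm (2 ^ lv \<omega> *\<^sub>R x - intvec (snd (snd \<omega>))) \<le> \<rho>0 + real r * 2 ^ m"
        using m(2)[of j h x] h by auto
      define i where "i = lv \<omega>"
      define k where "k = snd (snd \<omega>)"
      have I: "(i, k) \<in> \<A>" unfolding \<A>_def using \<omega> by (auto simp: i_def k_def intro!: exI[of _ "fst \<omega>"])
      define t where "t = (1/2::real) ^ i"
      have t: "t > 0" "2 ^ i * t = 1" by (auto simp: t_def power_one_over)
      \<comment> \<open>The lower corner of the cube at the top height \<open>t\<close>: half-open
        cubes contain this corner, and \<open>Tbox\<close> contains its top face.\<close>
      define w where "w = (t *\<^sub>R intvec k, t)"
      have "t *\<^sub>R intvec k \<in> cube (i, k)"
      proof -
        have "2 ^ i * (t * real_of_int (k $ c)) = real_of_int (k $ c)" for c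
          using t(2) by (simp add: mult.assoc[symmetric])
        then show ?thesis unfolding cube_iff floorvec_def vec_eq_iff
          by (simp only: vec_lambda_beta vector_scaleR_component intvec_def real_scaleR_def floor_of_int simp_thms)
      qed
      then have wT: "w \<in> T i" unfolding T_def w_def using I t
        by (auto simp: Tbox_def side_def t_def[symmetric] intro!: bexI[of _ "(i, k)"])
      have wH: "w \<in> Hplus" using t by (simp add: w_def Hplus_def)
      have yi: "2 ^ i * y \<le> 2 ^ m" by (rule nearby_scale(2)[OF \<omega>(2)[folded i_def] h(1,2)])
      have d2: "y \<le> 2 ^ m * t"
      proof -
        have "(2 ^ i * y) * t \<le> 2 ^ m * t" using yi t by (intro mult_right_mono) auto
        moreover have "(2 ^ i * y) * t = y" using t(2) by (metis mult.assoc mult.commute mult_1)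
        ultimately show ?thesis by simp
      qed
      have d1: "norm (x - t *\<^sub>R intvec k) \<le> (\<rho>0 + real r * 2 ^ m) * t"
      proof -
        have "x - t *\<^sub>R intvec k = t *\<^sub>R (2 ^ i *\<^sub>R x - intvec k)"
          using t(2) by (simp add: scaleR_diff_right mult.commute)
        then have "norm (x - t *\<^sub>R intvec k) = t * norm (2 ^ i *\<^sub>R x - intvec k)" using t by simp
        also have "\<dots> \<le> t * (\<rho>0 + real r * 2 ^ m)"
          using \<omega>(4) t unfolding i_def[symmetric] k_def[symmetric] by (intro mult_left_mono) auto
        finally show ?thesis by (simp add: mult.commute)
      qed
      have "norm (z - w) \<le> norm (x - t *\<^sub>R intvec k) + norm (y - t)"
        using norm_prod_diff_le[of z w] by (simp add: w_def x_def y_def)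
      also have "norm (y - t) \<le> 2 ^ m * t + t" using d2 y0 t by (auto simp: abs_le_iff)
      finally have n: "norm (z - w) \<le> a * t" using d1 by (simp add: a_def algebra_simps)
      have "e * t\<^sup>2 \<le> snd z * snd w"
      proof -
        have "j \<le> i + m" using \<omega>(2) by (auto simp: gap_def i_def split: if_splits)
        then have "(1/2::real) ^ (i + m + 1) \<le> (1/2) ^ (j + 1)" by (intro power_decreasing) auto
        moreover have "(1/2::real) ^ (i + m + 1) = e * t" by (simp add: e_def t_def power_add)
        ultimately have "e * t \<le> y" using h(1) by linarith
        then have "e * t * t \<le> y * t" using t by (intro mult_right_mono) auto
        then show ?thesis by (simp add: w_def y_def power2_eq_square mult.assoc)
      qed
      then have "hrho z w < R" by (rule R(2)[OF zH wH t(1) n])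
      then have "z \<in> H i" using wT zH by (auto simp: H_def hnbhd_def)
      then show "z \<in> (\<Union>i\<in>{i. gap i j \<le> m}. H i)" using \<omega>(2) by (auto simp: i_def)
    qed
    show "\<nu> (\<lambda>j. Sset r j s g \<epsilon>) < \<infinity>"
      by (rule nu_mono[OF setseq_ok_Sset[OF cg] Win(1) sub Win(2)])
  qed
qed

text \<open>Passing from \<open>f\<close> to \<open>g\<close> changes normalised \<open>r\<close>-th
  differences by at most \<open>2 ^ r * M\<close> and scaling coefficients by at most
  \<open>K * M\<close>, so what exceeds \<open>D * M + \<tau>\<close> for \<open>f\<close> exceeds
  \<open>\<tau>\<close> for \<open>g\<close>. The extra \<open>\<tau>\<close> supplies the positive
  threshold that finiteness for \<open>g\<close> requires, also when \<open>M = 0\<close>.\<close>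

lemma nu_finite_of_dist:
  obtains D where "D > 0" "\<And>f g M \<tau>. f \<in> Lambda s \<Longrightarrow> g \<in> LambdaX s X \<phi> \<psi> \<Longrightarrow> Lambda_norm s (\<lambda>x. f x - g x) \<le> ereal M \<Longrightarrow>
     \<tau> > 0 \<Longrightarrow> \<nu> (\<lambda>j. Sset r j s f (D * M + \<tau>)) < \<infinity> \<and> nu1 \<nu> (\<Union>I\<in>V0 \<phi> \<psi> f (D * M + \<tau>). Tbox I) < \<infinity> \<and> 0 \<le> M"
proof -
  obtain K where K: "K > 0" "\<And>(f :: real^'n \<Rightarrow> real) M. f \<in> Lambda s \<Longrightarrow> Lambda_norm s f \<le> ereal M \<Longrightarrow>
     coef_bound s (K * M) (coef f) \<and> synth (coef f) = f \<and> 0 \<le> M" using Lambda_expansion by blast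
  define D where "D = 2 ^ r + K"
  have "\<nu> (\<lambda>j. Sset r j s f (D * M + \<tau>)) < \<infinity> \<and> nu1 \<nu> (\<Union>I\<in>V0 \<phi> \<psi> f (D * M + \<tau>). Tbox I) < \<infinity> \<and> 0 \<le> M"
    if f: "f \<in> Lambda s" and g: "g \<in> LambdaX s X \<phi> \<psi>" and M: "Lambda_norm s (\<lambda>x. f x - g x) \<le> ereal M" and \<tau>: "\<tau> > 0" for f g M \<tau>
  proof -
    have gL: "g \<in> Lambda s" using g by (simp add: LambdaX_iff)
    have cf: "continuous_on UNIV f" and cg: "continuous_on UNIV g" using f gL by (auto simp: Lambda_def)
    have u: "(\<lambda>x. f x - g x) \<in> Lambda s"
    proof -
      have "bounded (range (\<lambda>x. f x - g x))"
        using Lambda_norm_bounds(1)[OF M] by (auto simp: bounded_iff)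
      moreover have "Lambda_norm s (\<lambda>x. f x - g x) < \<infinity>" using M by (rule le_less_trans) simp
      ultimately show ?thesis using cf cg by (auto simp: Lambda_def intro!: continuous_intros)
    qed
    have cb: "coef_bound s (K * M) (coef (\<lambda>x. f x - g x))" "0 \<le> M" using K(2)[OF u M] by auto
    have sub: "Sset r j s f (D * M + \<tau>) \<subseteq> Sset r j s g \<tau>" for j
    proof
      fix z assume z: "z \<in> Sset r j s f (D * M + \<tau>)"
      define x where "x = fst z"
      define y where "y = snd z"
      obtain h where h: "(1/2) ^ (j + 1) < y" "y \<le> (1/2) ^ j" "norm h = y" "(D * M + \<tau>) * y powr s < \<bar>diffpow r h f x\<bar>"
        using z unfolding Sset_eq x_def y_def by auto
      have "z \<in> Hplus" using z setseq_ok_Sset[OF cf] unfolding setseq_ok_def by blast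
      then have y0: "y > 0" by (simp add: Hplus_def y_def)
      have "(1/2::real) ^ j \<le> 1" by (rule power_le_one) auto
      then have y1: "y \<le> 1" using h by linarith
      have d: "\<bar>diffpow r h (\<lambda>x. f x - g x) x\<bar> \<le> 2 ^ r * M * y powr s"
        using Lambda_diffpow_r[OF M, of h x] h y0 y1 by simp
      have "2 ^ r * M * y powr s \<le> D * M * y powr s"
        using cb K by (intro mult_right_mono) (auto simp: D_def)
      then have "\<tau> * y powr s < \<bar>diffpow r h g x\<bar>"
        using d h(4) unfolding diffpow_diff by (simp add: distrib_right)
      then show "z \<in> Sset r j s g \<tau>" unfolding Sset_eq using h
        by (cases z) (auto simp: x_def y_def simp del: power_Suc)
    qed
    have 1: "\<nu> (\<lambda>j. Sset r j s f (D * M + \<tau>)) < \<infinity>"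
      by (rule nu_mono[OF setseq_ok_Sset[OF cf] setseq_ok_Sset[OF cg] sub LambdaX_nu_finite(1)[OF g \<tau>]])
    have V: "V0 \<phi> \<psi> f (D * M + \<tau>) \<subseteq> V0 \<phi> \<psi> g \<tau>"
    proof
      fix I assume I: "I \<in> V0 \<phi> \<psi> f (D * M + \<tau>)"
      then have I0: "fst I = 0" and big: "D * M + \<tau> < \<bar>coef f (0, I)\<bar>" by (auto simp: V0_def coef_def)
      have o: "(0, I) \<in> Omega" using I0 by (cases I) (auto simp: Omega_def)
      have "coef (\<lambda>x. f x - g x) (0, I) = coef f (0, I) - coef g (0, I)"
        unfolding coef_def L2inner_def left_diff_distrib
        by (rule Bochner_Integration.integral_diff) (intro pairing_integrable o cf cg)+
      moreover have "\<bar>coef (\<lambda>x. f x - g x) (0, I)\<bar> \<le> K * M"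
        using cb(1) o I0 unfolding coef_bound_def by fastforce
      moreover have "K * M \<le> D * M" using cb(2) by (intro mult_right_mono) (auto simp: D_def)
      ultimately have "\<tau> < \<bar>coef g (0, I)\<bar>" using big by linarith
      then show "I \<in> V0 \<phi> \<psi> g \<tau>" using I0 by (simp add: V0_def coef_def)
    qed
    have "\<nu> (\<lambda>j. \<Union>I\<in>{I\<in>V0 \<phi> \<psi> f (D * M + \<tau>). fst I = j}. Tbox I) < \<infinity>"
    proof (rule nu_mono[OF setseq_ok_Tbox setseq_ok_Tbox])
      show "\<nu> (\<lambda>j. \<Union>I\<in>{I\<in>V0 \<phi> \<psi> g \<tau>. fst I = j}. Tbox I) < \<infinity>"
        using LambdaX_nu_finite(2)[OF g \<tau>] by (subst (asm) nu1_cubes) (auto simp: V0_def)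
    qed (use V in blast)
    then have 2: "nu1 \<nu> (\<Union>I\<in>V0 \<phi> \<psi> f (D * M + \<tau>). Tbox I) < \<infinity>"
      by (subst nu1_cubes) (auto simp: V0_def)
    show ?thesis using 1 2 cb(2) by simp
  qed
  then show ?thesis using that[of D] K by (simp add: D_def add_pos_pos)
qed

end

theorem mainTheorem2:
  fixes X :: "(nat \<Rightarrow> (real^'n::finite) \<Rightarrow> real) \<Rightarrow> ereal"
    and \<nu> :: "(nat \<Rightarrow> ((real^'n) \<times> real) set) \<Rightarrow> ereal"
    and s :: real and r L :: nat
    and \<phi> :: "real^'n \<Rightarrow> real" and \<psi> :: "nat \<Rightarrow> real^'n \<Rightarrow> real"
  assumes "qn_lattice X"
    and "assumption_II X \<nu>"
    and "0 < s" and "real r > s"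
    and "Daubechies L \<phi> \<psi>" and "real L > s" and "L \<ge> r - 1"
  shows "\<exists>C>0. \<forall>f\<in>Lambda s.
           Lambda_dist s f (LambdaX s X \<phi> \<psi>) \<le> ereal C * (eps_Xnu \<nu> r s f + eps_V0 \<nu> \<phi> \<psi> f) \<and>
           eps_Xnu \<nu> r s f + eps_V0 \<nu> \<phi> \<psi> f \<le> ereal C * Lambda_dist s f (LambdaX s X \<phi> \<psi>)"
proof -
  have L1: "L \<ge> 1" using assms(3,6) by (cases L) auto
  have rL: "r - 1 \<le> L" using assms(7) .
  have ct: "carleson_type \<nu>" using assms(2) by (simp add: assumption_II_def)
  interpret lattice_setting L \<phi> \<psi> s r \<nu> X
    by unfold_locales (use assms L1 rL ct in auto)
  define E where "E f = eps_Xnu \<nu> r s f + eps_V0 \<nu> \<phi> \<psi> f" for f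
  obtain D where D: "D > 0" "\<And>f \<epsilon>. f \<in> Lambda s \<Longrightarrow> \<epsilon> > 0 \<Longrightarrow> \<nu> (\<lambda>j. Sset r j s f \<epsilon>) < \<infinity> \<Longrightarrow>
    nu1 \<nu> (\<Union>I\<in>V0 \<phi> \<psi> f \<epsilon>. Tbox I) < \<infinity> \<Longrightarrow> Lambda_dist s f (LambdaX s X \<phi> \<psi>) \<le> ereal (D * \<epsilon>)"
    using dist_upper_bound by blast
  obtain D' where D': "D' > 0" "\<And>f g M \<tau>. f \<in> Lambda s \<Longrightarrow> g \<in> LambdaX s X \<phi> \<psi> \<Longrightarrow> Lambda_norm s (\<lambda>x. f x - g x) \<le> ereal M \<Longrightarrow>
     \<tau> > 0 \<Longrightarrow> \<nu> (\<lambda>j. Sset r j s f (D' * M + \<tau>)) < \<infinity> \<and> nu1 \<nu> (\<Union>I\<in>V0 \<phi> \<psi> f (D' * M + \<tau>). Tbox I) < \<infinity> \<and> 0 \<le> M"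
    using nu_finite_of_dist by blast
  have nn: "0 \<le> eps_Xnu \<nu> r s f" "0 \<le> eps_V0 \<nu> \<phi> \<psi> f" for f
    unfolding eps_Xnu_def eps_V0_def by (auto intro!: Inf_greatest)
  have up: "Lambda_dist s f (LambdaX s X \<phi> \<psi>) \<le> ereal D * E f" if f: "f \<in> Lambda s" for f
  proof -
    have cf: "continuous_on UNIV f" using f by (simp add: Lambda_def)
    \<comment> \<open>Working with the real upper bounds \<open>z\<close> of \<open>E f\<close> also
      covers the case \<open>E f = \<infinity>\<close>, where there are none.\<close>
    have "Lambda_dist s f (LambdaX s X \<phi> \<psi>) / ereal D \<le> E f"
    proof (rule ereal_le_real)
      fix z assume z: "E f \<le> ereal z"
      \<comment> \<open>A number \<open>\<epsilon>\<close> above the sum exceeds both infima; by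
        monotonicity in the threshold, finiteness at smaller thresholds passes to
        \<open>\<epsilon>\<close> itself, so one threshold serves both conditions.\<close>
      have step: "Lambda_dist s f (LambdaX s X \<phi> \<psi>) \<le> ereal (D * \<epsilon>)" if \<epsilon>: "z < \<epsilon>" for \<epsilon>
      proof -
        have Xl: "eps_Xnu \<nu> r s f < ereal \<epsilon>" "eps_V0 \<nu> \<phi> \<psi> f < ereal \<epsilon>"
        proof -
          have "eps_Xnu \<nu> r s f \<le> E f" "eps_V0 \<nu> \<phi> \<psi> f \<le> E f"
            unfolding E_def using nn[of f] by (simp_all add: add_increasing add_increasing2)
          moreover have "E f < ereal \<epsilon>" using z \<epsilon> by (simp add: le_less_trans)
          ultimately show "eps_Xnu \<nu> r s f < ereal \<epsilon>" "eps_V0 \<nu> \<phi> \<psi> f < ereal \<epsilon>" by (auto intro: le_less_trans)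
        qed
        have \<epsilon>0: "\<epsilon> > 0" using le_less_trans[OF nn(1) Xl(1)] by simp
        obtain \<epsilon>1 where e1: "0 < \<epsilon>1" "\<nu> (\<lambda>j. Sset r j s f \<epsilon>1) < \<infinity>" "\<epsilon>1 < \<epsilon>"
          using Xl(1) unfolding eps_Xnu_def Inf_less_iff by auto
        obtain \<epsilon>2 where e2: "0 < \<epsilon>2" "nu1 \<nu> (\<Union>I\<in>V0 \<phi> \<psi> f \<epsilon>2. Tbox I) < \<infinity>" "\<epsilon>2 < \<epsilon>"
          using Xl(2) unfolding eps_V0_def Inf_less_iff by auto
        have 1: "\<nu> (\<lambda>j. Sset r j s f \<epsilon>) < \<infinity>"
        proof (rule nu_mono[OF setseq_ok_Sset[OF cf] setseq_ok_Sset[OF cf] _ e1(2)])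
          show "Sset r j s f \<epsilon> \<subseteq> Sset r j s f \<epsilon>1" for j
            unfolding Sset_def using e1(3) by (auto intro: less_trans[of "ereal \<epsilon>1" "ereal \<epsilon>"])
        qed
        have 2: "nu1 \<nu> (\<Union>I\<in>V0 \<phi> \<psi> f \<epsilon>. Tbox I) < \<infinity>"
        proof -
          have V: "V0 \<phi> \<psi> f \<epsilon> \<subseteq> V0 \<phi> \<psi> f \<epsilon>2" using e2(3) by (auto simp: V0_def)
          have "\<nu> (\<lambda>j. \<Union>I\<in>{I\<in>V0 \<phi> \<psi> f \<epsilon>. fst I = j}. Tbox I) < \<infinity>"
          proof (rule nu_mono[OF setseq_ok_Tbox setseq_ok_Tbox])
            show "\<nu> (\<lambda>j. \<Union>I\<in>{I\<in>V0 \<phi> \<psi> f \<epsilon>2. fst I = j}. Tbox I) < \<infinity>"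
              using e2(2) by (subst (asm) nu1_cubes) (auto simp: V0_def)
          qed (use V in blast)
          then show ?thesis by (subst nu1_cubes) (auto simp: V0_def)
        qed
        show ?thesis by (rule D(2)[OF f \<epsilon>0 1 2])
      qed
      have "Lambda_dist s f (LambdaX s X \<phi> \<psi>) \<le> ereal (D * z)"
      proof (rule ereal_le_epsilon2)
        fix e :: real assume "e > 0"
        then have "Lambda_dist s f (LambdaX s X \<phi> \<psi>) \<le> ereal (D * (z + e / D))" using D(1) by (intro step) simp
        then show "Lambda_dist s f (LambdaX s X \<phi> \<psi>) \<le> ereal (D * z) + ereal e" using D(1) by (simp add: distrib_left)
      qed
      then show "Lambda_dist s f (LambdaX s X \<phi> \<psi>) / ereal D \<le> ereal z"
        using D(1) by (simp add: ereal_divide_le_pos)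
    qed
    then show ?thesis using D(1) by (simp add: ereal_divide_le_pos)
  qed
  \<comment> \<open>The factor 2 arises because each of the two infima is bounded by the same
    multiple of the distance.\<close>
  have low: "E f \<le> ereal (2 * D') * Lambda_dist s f (LambdaX s X \<phi> \<psi>)" if f: "f \<in> Lambda s" for f
  proof -
    have "E f / ereal (2 * D') \<le> Lambda_dist s f (LambdaX s X \<phi> \<psi>)"
      unfolding Lambda_dist_def
    proof (rule INF_greatest)
      fix g assume g: "g \<in> LambdaX s X \<phi> \<psi> \<inter> Lambda s"
      show "E f / ereal (2 * D') \<le> Lambda_norm s (\<lambda>x. f x - g x)"
      proof (cases "Lambda_norm s (\<lambda>x. f x - g x) < \<infinity>")
        case True
        obtain M where M: "Lambda_norm s (\<lambda>x. f x - g x) = ereal M" using Lambda_norm_real[OF True] by blast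
        have "E f \<le> ereal (2 * D' * M)"
        proof (rule ereal_le_epsilon2)
          fix e :: real assume e: "e > 0"
          have fin: "\<nu> (\<lambda>j. Sset r j s f (D' * M + e / 2)) < \<infinity>" "nu1 \<nu> (\<Union>I\<in>V0 \<phi> \<psi> f (D' * M + e / 2). Tbox I) < \<infinity>" "0 \<le> M"
            using D'(2)[OF f IntD1[OF g] eq_refl[OF M] half_gt_zero[OF e]] by auto
          have pos: "0 < D' * M + e / 2" using fin(3) D'(1) e by (intro add_nonneg_pos) auto
          have "eps_Xnu \<nu> r s f \<le> ereal (D' * M + e / 2)" "eps_V0 \<nu> \<phi> \<psi> f \<le> ereal (D' * M + e / 2)"
            unfolding eps_Xnu_def eps_V0_def using fin pos by (auto intro!: Inf_lower)
          then have "E f \<le> ereal (D' * M + e / 2) + ereal (D' * M + e / 2)" unfolding E_def by (rule add_mono)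
          then show "E f \<le> ereal (2 * D' * M) + ereal e" by (simp add: algebra_simps)
        qed
        then show ?thesis using D'(1) unfolding M by (simp add: ereal_divide_le_pos)
      qed simp
    qed
    then show ?thesis using D'(1) by (simp add: ereal_divide_le_pos)
  qed
  have E0: "0 \<le> E f" for f unfolding E_def using nn[of f] by simp
  show ?thesis
  \<comment> \<open>One constant for both directions; enlarging it is harmless since
    \<open>E f\<close> and the distance are nonnegative.\<close>
  proof (intro exI[of _ "D + 2 * D'"] conjI ballI)
    show "D + 2 * D' > 0" using D(1) D'(1) by simp
    fix f :: "real^'n \<Rightarrow> real" assume f: "f \<in> Lambda s"
    have d0: "0 \<le> Lambda_dist s f (LambdaX s X \<phi> \<psi>)"
      unfolding Lambda_dist_def
    proof (rule INF_greatest)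
      fix g
      show "0 \<le> Lambda_norm s (\<lambda>x. f x - g x)"
      proof (cases "Lambda_norm s (\<lambda>x. f x - g x) < \<infinity>")
        case True
        then obtain M where "M \<ge> 0" "Lambda_norm s (\<lambda>x. f x - g x) = ereal M" by (rule Lambda_norm_real)
        then show ?thesis by simp
      qed auto
    qed
    have "ereal D * E f \<le> ereal (D + 2 * D') * E f"
      using D(1) D'(1) E0[of f] by (intro ereal_mult_right_mono) auto
    then show "Lambda_dist s f (LambdaX s X \<phi> \<psi>) \<le> ereal (D + 2 * D') * (eps_Xnu \<nu> r s f + eps_V0 \<nu> \<phi> \<psi> f)"
      using up[OF f] unfolding E_def by (rule order_trans[rotated])
    have "ereal (2 * D') * Lambda_dist s f (LambdaX s X \<phi> \<psi>) \<le> ereal (D + 2 * D') * Lambda_dist s f (LambdaX s X \<phi> \<psi>)"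
      using D(1) D'(1) d0 by (intro ereal_mult_right_mono) auto
    then show "eps_Xnu \<nu> r s f + eps_V0 \<nu> \<phi> \<psi> f \<le> ereal (D + 2 * D') * Lambda_dist s f (LambdaX s X \<phi> \<psi>)"
      using low[OF f] unfolding E_def by (rule order_trans[rotated])
  qed
qed

end
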